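(* For each of the quivers $\tilde D_N$ with $N\ge5$ odd, $\tilde E_6$, $\tilde E_7$ and $\tilde E_8$, the reduced cluster map $\hat\varphi$ is Liouville (completely) integrable: with $2m$ the dimension of the reduced space ($2m=N-1,6,6,8$ respectively), there exist $m$ functionally independent first integrals $\mathcal I_1,\dots,\mathcal I_m$ of $\hat\varphi$ with $\{\mathcal I_i,\mathcal I_j\}=0$ for all $i,j$.
   Context: The reduced cluster map $\hat\varphi:(y^1_n,\dots,y^{2m}_n)\mapsto(y^1_{n+1},\dots,y^{2m}_{n+1})$ is the birational map of $2m$-dimensional space (coordinates $y^1,\dots,y^{2m}$, complex) given below; it is symplectic for the log-canonical form $\hat\omega=\sum_{i<j}\frac{\hat b_{ij}}{y^iy^j}\,dy^i\wedge dy^j$, with $\hat B=(\hat b_{ij})$ invertible and skew-symmetric. The Poisson bracket is $\{y^i,y^j\}=c_{ij}y^iy^j$ with $C=(c_{ij})=\hat B^{-1}$ (up to an irrelevant overall nonzero scalar). A first integral is a (nonconstant, rational) function fixed by pullback along $\hat\varphi$. A symplectic map of a $2m$-dimensional symplectic manifold is called completely integrable if it has $m$ functionally independent first integrals in involution. $\tilde D_N$, $N\ge 5$ odd ($2m=N-1$). Coordinates $y^1=p$, $y^{i}=X^{i+1}$ for $2\le i\le N-2$, $y^{N-1}=q$. The map is determined by $p_{n+1}p_n=(1+X^3_{n+1})^2$; $X^3_{n+1}X^3_n=1+p_nX^4_n$; $X^i_{n+1}X^i_n=1+X^{i-1}_{n+1}X^{i+1}_{n+1}$ for $i$ even, $3<i<N-1$;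 $X^i_{n+1}X^i_n=1+X^{i-1}_{n}X^{i+1}_{n}$ for $i$ odd, $3<i<N-1$; $X^{N-1}_{n+1}X^{N-1}_n=1+q_{n+1}X^{N-2}_{n+1}$; $q_{n+1}q_n=(1+X^{N-1}_n)^2$. Here $\hat b_{i,i+1}=(-1)^{i+1}=-\hat b_{i+1,i}$ for $1\le i\le N-2$, and all other entries of $\hat B$ vanish. (In terms of the $\tilde D_N$ frieze variables, $p_n=X^1_nX^2_n$ and $q_n=X^N_nX^{N+1}_n$.) For the $\tilde E$ types, the only nonzero brackets of coordinates are $\{y^{2i-1},y^{2i}\}=y^{2i-1}y^{2i}=-\{y^{2i},y^{2i-1}\}$ for $1\le i\le m$. $\tilde E_6$ ($2m=6$; $y^1=ac$, $y^2=b$, $y^3=ce$, $y^4=d$, $y^5=cg$, $y^6=f$ in terms of frieze variables): $y^1_{n+1}y^1_n=(1+y^2_n)(1+y^2_ny^4_ny^6_n)$, $y^2_{n+1}y^2_n=1+y^1_{n+1}$, $y^3_{n+1}y^3_n=(1+y^2_ny^4_ny^6_n)(1+y^4_n)$, $y^4_{n+1}y^4_n=1+y^3_{n+1}$, $y^5_{n+1}y^5_n=(1+y^2_ny^4_ny^6_n)(1+y^6_n)$, $y^6_{n+1}y^6_n=1+y^5_{n+1}$. $\tilde E_7$ ($2m=6$; $y^1=ac$, $y^2=b$, $y^3=cef$, $y^4=d$, $y^5=fh$, $y^6=g$): $y^1_{n+1}y^1_n=(1+y^2_n)(1+y^2_ny^4_n)$, $y^2_{n+1}y^2_n=1+y^1_{n+1}$,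 $y^3_{n+1}y^3_n=(1+y^2_ny^4_n)(1+y^4_n)(1+y^4_ny^6_n)$, $y^4_{n+1}y^4_n=1+y^3_{n+1}$, $y^5_{n+1}y^5_n=(1+y^4_ny^6_n)(1+y^6_n)$, $y^6_{n+1}y^6_n=1+y^5_{n+1}$. $\tilde E_8$ ($2m=8$; $y^1=ac$, $y^2=b$, $y^3=ce$, $y^4=d$, $y^5=egh$, $y^6=f$, $y^7=h$, $y^8=i$): $y^1_{n+1}y^1_n=(1+y^2_n)(1+y^2_ny^4_n)$, $y^2_{n+1}y^2_n=1+y^1_{n+1}$, $y^3_{n+1}y^3_n=(1+y^2_ny^4_n)(1+y^4_ny^6_n)$, $y^4_{n+1}y^4_n=1+y^3_{n+1}$, $y^5_{n+1}y^5_n=(1+y^4_ny^6_n)(1+y^6_n)(1+y^6_ny^8_n)$, $y^6_{n+1}y^6_n=1+y^5_{n+1}$, $y^7_{n+1}y^7_n=1+y^6_ny^8_n$, $y^8_{n+1}y^8_n=1+y^7_{n+1}$. *)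

theory Defs
  imports "HOL-Analysis.Analysis"
begin

text \<open>
  The dimension of the reduced space depends on \<open>N\<close>, so points of the \<open>n\<close>-dimensional complex
  space are functions \<open>x :: nat \<Rightarrow> complex\<close> with coordinates \<open>x 1, \<dots>, x n\<close>; the remaining values
  are irrelevant.
\<close>

section \<open>Rational functions\<close>

inductive polynomial_fun :: "nat \<Rightarrow> ((nat \<Rightarrow> complex) \<Rightarrow> complex) \<Rightarrow> bool" for n where
  const: "polynomial_fun n (\<lambda>x. c)"
| coord: "1 \<le> i \<Longrightarrow> i \<le> n \<Longrightarrow> polynomial_fun n (\<lambda>x. x i)"
| add: "polynomial_fun n f \<Longrightarrow> polynomial_fun n g \<Longrightarrow> polynomial_fun n (\<lambda>x. f x + g x)"
| mult: "polynomial_fun n f \<Longrightarrow> polynomial_fun n g \<Longrightarrow> polynomial_fun n (\<lambda>x. f x * g x)"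

text \<open>
  \<open>P\<close> holds on a nonempty Zariski-open set.  Identities between rational functions are stated
  generically: two rational functions are equal iff their values agree on such a set, and the
  convention \<open>z / 0 = 0\<close> plays no role there.
\<close>

definition generically :: "nat \<Rightarrow> ((nat \<Rightarrow> complex) \<Rightarrow> bool) \<Rightarrow> bool" where
  "generically n P \<longleftrightarrow>
     (\<exists>R. polynomial_fun n R \<and> (\<exists>x. R x \<noteq> 0) \<and> (\<forall>x. R x \<noteq> 0 \<longrightarrow> P x))"

definition rational_fun :: "nat \<Rightarrow> ((nat \<Rightarrow> complex) \<Rightarrow> complex) \<Rightarrow> bool" where
  "rational_fun n f \<longleftrightarrow>
     (\<exists>P Q. polynomial_fun n P \<and> polynomial_fun n Q \<and> (\<exists>x. Q x \<noteq> 0) \<and> f = (\<lambda>x. P x / Q x))"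

definition partial_deriv :: "nat \<Rightarrow> ((nat \<Rightarrow> complex) \<Rightarrow> complex) \<Rightarrow> (nat \<Rightarrow> complex) \<Rightarrow> complex" where
  "partial_deriv k f x = deriv (\<lambda>t. f (x(k := t))) (x k)"

section \<open>Log-canonical structures and complete integrability\<close>

definition skew_on :: "nat \<Rightarrow> (nat \<Rightarrow> nat \<Rightarrow> complex) \<Rightarrow> bool" where
  "skew_on n B \<longleftrightarrow> (\<forall>i\<in>{1..n}. \<forall>j\<in>{1..n}. B j i = - B i j)"

definition inverse_on :: "nat \<Rightarrow> (nat \<Rightarrow> nat \<Rightarrow> complex) \<Rightarrow> (nat \<Rightarrow> nat \<Rightarrow> complex) \<Rightarrow> bool" where
  "inverse_on n B C \<longleftrightarrow>
     (\<forall>i\<in>{1..n}. \<forall>j\<in>{1..n}.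
        (\<Sum>k=1..n. B i k * C k j) = (if i = j then 1 else 0) \<and>
        (\<Sum>k=1..n. C i k * B k j) = (if i = j then 1 else 0))"

text \<open>The pullback along \<open>\<phi>\<close> of the form
  \<open>\<Sum>\<^sub>i\<^sub><\<^sub>j B i j / (x i * x j) dx\<^sub>i \<and> dx\<^sub>j\<close> equals the form itself; both
  sides are evaluated on the pair of coordinate vector fields \<open>k\<close>, \<open>l\<close>, and the sum over
  \<open>i < j\<close> becomes a sum over all \<open>i\<close>, \<open>j\<close> because \<open>B\<close> is skew-symmetric.\<close>

definition symplectic_map ::
  "nat \<Rightarrow> (nat \<Rightarrow> nat \<Rightarrow> complex) \<Rightarrow> ((nat \<Rightarrow> complex) \<Rightarrow> (nat \<Rightarrow> complex)) \<Rightarrow> bool" where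
  "symplectic_map n B \<phi> \<longleftrightarrow>
     generically n (\<lambda>x. \<forall>k\<in>{1..n}. \<forall>l\<in>{1..n}.
       (\<Sum>i=1..n. \<Sum>j=1..n. B i j / (\<phi> x i * \<phi> x j) *
          partial_deriv k (\<lambda>y. \<phi> y i) x * partial_deriv l (\<lambda>y. \<phi> y j) x)
       = B k l / (x k * x l))"

definition poisson_bracket ::
  "nat \<Rightarrow> (nat \<Rightarrow> nat \<Rightarrow> complex) \<Rightarrow> ((nat \<Rightarrow> complex) \<Rightarrow> complex) \<Rightarrow>
     ((nat \<Rightarrow> complex) \<Rightarrow> complex) \<Rightarrow> (nat \<Rightarrow> complex) \<Rightarrow> complex" where
  "poisson_bracket n C f g x =
     (\<Sum>i=1..n. \<Sum>j=1..n. C i j * x i * x j * partial_deriv i f x * partial_deriv j g x)"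

definition first_integral ::
  "nat \<Rightarrow> ((nat \<Rightarrow> complex) \<Rightarrow> (nat \<Rightarrow> complex)) \<Rightarrow> ((nat \<Rightarrow> complex) \<Rightarrow> complex) \<Rightarrow> bool" where
  "first_integral n \<phi> f \<longleftrightarrow>
     rational_fun n f \<and> \<not> (\<exists>c. generically n (\<lambda>x. f x = c)) \<and>
     generically n (\<lambda>x. f (\<phi> x) = f x)"

text \<open>The differentials of \<open>F 1, \<dots>, F m\<close> are linearly independent at generic points.\<close>

definition functionally_independent ::
  "nat \<Rightarrow> nat \<Rightarrow> (nat \<Rightarrow> (nat \<Rightarrow> complex) \<Rightarrow> complex) \<Rightarrow> bool" where
  "functionally_independent n m F \<longleftrightarrow>
     generically n (\<lambda>x. \<forall>a :: nat \<Rightarrow> complex.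
       (\<forall>k\<in>{1..n}. (\<Sum>i=1..m. a i * partial_deriv k (F i) x) = 0) \<longrightarrow> (\<forall>i\<in>{1..m}. a i = 0))"

text \<open>
  Complete (Liouville) integrability of the map \<open>\<phi>\<close> in dimension \<open>2 * m\<close> with respect to the
  log-canonical symplectic form with coefficient matrix \<open>B\<close>.  The entries \<open>1..2 * m\<close> of \<open>C\<close> are
  uniquely determined by those of \<open>B\<close>.
\<close>

definition completely_integrable ::
  "nat \<Rightarrow> (nat \<Rightarrow> nat \<Rightarrow> complex) \<Rightarrow> ((nat \<Rightarrow> complex) \<Rightarrow> (nat \<Rightarrow> complex)) \<Rightarrow> bool" where
  "completely_integrable m B \<phi> \<longleftrightarrow>
     skew_on (2 * m) B \<and> symplectic_map (2 * m) B \<phi> \<and>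
     (\<exists>C. inverse_on (2 * m) B C \<and>
       (\<exists>I. (\<forall>i\<in>{1..m}. first_integral (2 * m) \<phi> (I i)) \<and>
            functionally_independent (2 * m) m I \<and>
            (\<forall>i\<in>{1..m}. \<forall>j\<in>{1..m}.
               generically (2 * m) (\<lambda>x. poisson_bracket (2 * m) C (I i) (I j) x = 0))))"

section \<open>The reduced cluster maps\<close>

text \<open>
  Type \<open>D\<close>, \<open>N\<close> odd.  In the coordinates \<open>x 1 = p\<close>, \<open>x i = X\<^sup>i\<^sup>+\<^sup>1\<close> for
  \<open>2 \<le> i \<le> N - 2\<close>, \<open>x (N - 1) = q\<close>, the even-indexed coordinates (the \<open>X\<close>'s with odd upper
  index, and \<open>q\<close>) are updated first and the odd-indexed ones then use the new values; see
  \<open>D_map_iff_recurrence\<close> for the recurrence this encodes.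
\<close>

definition D_even_step :: "nat \<Rightarrow> (nat \<Rightarrow> complex) \<Rightarrow> (nat \<Rightarrow> complex)" where
  "D_even_step N x = (\<lambda>i.
     if i = N - 1 then (1 + x (N - 2))\<^sup>2 / x i
     else if even i \<and> 2 \<le> i \<and> i < N - 1 then (1 + x (i - 1) * x (i + 1)) / x i
     else x i)"

definition D_odd_step :: "nat \<Rightarrow> (nat \<Rightarrow> complex) \<Rightarrow> (nat \<Rightarrow> complex)" where
  "D_odd_step N x = (\<lambda>i.
     if i = 1 then (1 + x 2)\<^sup>2 / x i
     else if odd i \<and> 3 \<le> i \<and> i < N - 1 then (1 + x (i - 1) * x (i + 1)) / x i
     else x i)"

definition D_map :: "nat \<Rightarrow> (nat \<Rightarrow> complex) \<Rightarrow> (nat \<Rightarrow> complex)" where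
  "D_map N x = D_odd_step N (D_even_step N x)"

definition D_form :: "nat \<Rightarrow> nat \<Rightarrow> complex" where
  "D_form i j = (if j = i + 1 then (-1) ^ (i + 1) else if i = j + 1 then - ((-1) ^ (j + 1)) else 0)"

text \<open>Primed arguments are the values at time \<open>n + 1\<close>, the others those at time \<open>n\<close>.\<close>

definition D_recurrence ::
  "nat \<Rightarrow> complex \<Rightarrow> (nat \<Rightarrow> complex) \<Rightarrow> complex \<Rightarrow> complex \<Rightarrow> (nat \<Rightarrow> complex) \<Rightarrow> complex \<Rightarrow> bool" where
  "D_recurrence N p X q p' X' q' \<longleftrightarrow>
     p' * p = (1 + X' 3)\<^sup>2 \<and>
     X' 3 * X 3 = 1 + p * X 4 \<and>
     (\<forall>i. even i \<and> 3 < i \<and> i < N - 1 \<longrightarrow> X' i * X i = 1 + X' (i - 1) * X' (i + 1)) \<and>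
     (\<forall>i. odd i \<and> 3 < i \<and> i < N - 1 \<longrightarrow> X' i * X i = 1 + X (i - 1) * X (i + 1)) \<and>
     X' (N - 1) * X (N - 1) = 1 + q' * X' (N - 2) \<and>
     q' * q = (1 + X (N - 1))\<^sup>2"

lemma D_map_iff_recurrence:
  fixes x y :: "nat \<Rightarrow> complex"
  assumes N: "5 \<le> N" "odd N" and nz: "\<And>i. i \<in> {1..N - 1} \<Longrightarrow> x i \<noteq> 0"
  shows "(\<forall>i\<in>{1..N - 1}. y i = D_map N x i) \<longleftrightarrow>
    D_recurrence N (x 1) (\<lambda>i. x (i - 1)) (x (N - 1)) (y 1) (\<lambda>i. y (i - 1)) (y (N - 1))"
proof -
  let ?e = "\<forall>i. even i \<and> 2 \<le> i \<and> i < N - 1 \<longrightarrow> y i * x i = 1 + x (i - 1) * x (i + 1)"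
  let ?o = "\<forall>i. odd i \<and> 3 \<le> i \<and> i < N - 1 \<longrightarrow> y i * x i = 1 + y (i - 1) * y (i + 1)"
  let ?q = "y (N - 1) * x (N - 1) = (1 + x (N - 2))\<^sup>2"
  let ?p = "y 1 * x 1 = (1 + y 2)\<^sup>2"
  have ev: "D_map N x i = D_even_step N x i" if "even i" for i
    using that by (auto simp: D_map_def D_odd_step_def)
  have od: "D_map N x i = (1 + D_map N x (i - 1) * D_map N x (i + 1)) / x i"
    if "odd i" "3 \<le> i" "i < N - 1" for i
  proof -
    have "D_map N x (i - 1) = D_even_step N x (i - 1)" "D_map N x (i + 1) = D_even_step N x (i + 1)"
      using that by (auto intro!: ev)
    moreover have "D_even_step N x i = x i" using that by (auto simp: D_even_step_def)
    ultimately show ?thesis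
      using that by (simp add: D_map_def D_odd_step_def)
  qed
  have one: "D_map N x 1 = (1 + D_map N x 2)\<^sup>2 / x 1"
    using N ev[of 2] by (auto simp: D_map_def D_odd_step_def D_even_step_def)
  have ev': "D_map N x i = (1 + x (i - 1) * x (i + 1)) / x i"
    if "even i" "2 \<le> i" "i < N - 1" for i
    using that by (auto simp: ev D_even_step_def)
  have q: "D_map N x (N - 1) = (1 + x (N - 2))\<^sup>2 / x (N - 1)"
    using N by (subst ev) (auto simp: D_even_step_def)
  have A: "(\<forall>i\<in>{1..N - 1}. y i = D_map N x i) \<longleftrightarrow> ?p \<and> ?e \<and> ?o \<and> ?q"
  proof
    assume y: "\<forall>i\<in>{1..N - 1}. y i = D_map N x i"
    have ?p using N one y nz[of 1] by auto
    moreover have ?e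
    proof (intro allI impI)
      fix i assume i: "even i \<and> 2 \<le> i \<and> i < N - 1"
      have "y i = (1 + x (i - 1) * x (i + 1)) / x i" using i y ev'[of i] by auto
      then show "y i * x i = 1 + x (i - 1) * x (i + 1)" using i nz[of i] by (simp add: field_simps)
    qed
    moreover have ?o
    proof (intro allI impI)
      fix i assume i: "odd i \<and> 3 \<le> i \<and> i < N - 1"
      have "y i = (1 + y (i - 1) * y (i + 1)) / x i"
      proof -
        have "i - 1 \<in> {1..N - 1}" "i \<in> {1..N - 1}" "i + 1 \<in> {1..N - 1}" using i by auto
        with y have "y (i - 1) = D_map N x (i - 1)" "y i = D_map N x i" "y (i + 1) = D_map N x (i + 1)"
          by blast+
        then show ?thesis using i od[of i] by simp
      qed
      then show "y i * x i = 1 + y (i - 1) * y (i + 1)" using i nz[of i] by (simp add: field_simps)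
    qed
    moreover have ?q using N y q nz[of "N - 1"] by auto
    ultimately show "?p \<and> ?e \<and> ?o \<and> ?q" by blast
  next
    assume S: "?p \<and> ?e \<and> ?o \<and> ?q"
    have yq: "y (N - 1) = D_map N x (N - 1)"
    proof -
      have "x (N - 1) \<noteq> 0" using N by (intro nz) auto
      then have "y (N - 1) = (1 + x (N - 2))\<^sup>2 / x (N - 1)" using S by (simp only: eq_divide_eq) simp
      then show ?thesis using q by simp
    qed
    have ye: "y i = D_map N x i" if "even i" "i \<in> {1..N - 1}" for i
    proof (cases "i = N - 1")
      case False
      then have i: "2 \<le> i" "i < N - 1" using that by (auto elim: evenE)
      have "y i * x i = 1 + x (i - 1) * x (i + 1)" using S that i by blast
      then show ?thesis using nz[OF that(2)] ev'[OF that(1) i]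
        by (metis nonzero_mult_div_cancel_right)
    qed (use yq in simp)
    have yo: "y i = D_map N x i" if "odd i" "i \<in> {1..N - 1}" for i
    proof (cases "i = 1")
      case True
      have "y 2 = D_map N x 2" using N by (intro ye) auto
      moreover have "y 1 * x 1 = (1 + y 2)\<^sup>2" using S by blast
      ultimately have "y 1 * x 1 = (1 + D_map N x 2)\<^sup>2" by simp
      moreover have "x 1 \<noteq> 0" using N by (intro nz) auto
      ultimately show ?thesis using one True by (metis nonzero_mult_div_cancel_right)
    next
      case False
      then have i: "3 \<le> i" using that by (auto elim: oddE)
      have "i \<noteq> N - 1" using that N by auto
      then have i': "i < N - 1" using that by auto
      have "y i * x i = 1 + y (i - 1) * y (i + 1)" using S that i i' by blast
      also have "\<dots> = 1 + D_map N x (i - 1) * D_map N x (i + 1)"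
      proof -
        have "i - 1 \<in> {1..N - 1}" "i + 1 \<in> {1..N - 1}" "even (i - 1)" "even (i + 1)"
          using that i i' by auto
        then show ?thesis by (simp only: ye)
      qed
      finally show ?thesis using nz[OF that(2)] od[OF that(1) i i']
        by (metis nonzero_mult_div_cancel_right)
    qed
    show "\<forall>i\<in>{1..N - 1}. y i = D_map N x i" using ye yo by blast
  qed
  have e: "?e \<longleftrightarrow> y 2 * x 2 = 1 + x 1 * x 3 \<and>
    (\<forall>i. odd i \<and> 3 < i \<and> i < N - 1 \<longrightarrow> y (i - 1) * x (i - 1) = 1 + x (i - 2) * x i)" (is "_ \<longleftrightarrow> ?e'")
  proof
    assume E: ?e
    show ?e'
    proof (intro conjI allI impI)
      show "y 2 * x 2 = 1 + x 1 * x 3" using E[rule_format, of 2] N by simp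
      fix i assume i: "odd i \<and> 3 < i \<and> i < N - 1"
      then obtain k where k: "i = k + 2" using that[of "i - 2"] by linarith
      then show "y (i - 1) * x (i - 1) = 1 + x (i - 2) * x i"
        using i E[rule_format, of "k + 1"] by simp
    qed
  next
    assume E: ?e'
    show ?e
    proof (intro allI impI)
      fix i assume i: "even i \<and> 2 \<le> i \<and> i < N - 1"
      show "y i * x i = 1 + x (i - 1) * x (i + 1)"
      proof (cases "i = 2")
        case False
        have "i + 1 \<noteq> N - 1" using i N by presburger
        then show ?thesis using conjunct2[OF E, rule_format, of "i + 1"] i False by simp
      qed (use E in simp)
    qed
  qed
  have o: "?o \<longleftrightarrow> y (N - 2) * x (N - 2) = 1 + y (N - 1) * y (N - 3) \<and>
    (\<forall>i. even i \<and> 3 < i \<and> i < N - 1 \<longrightarrow> y (i - 1) * x (i - 1) = 1 + y (i - 2) * y i)" (is "_ \<longleftrightarrow> ?o'")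
  proof
    assume O: ?o
    show ?o'
    proof (intro conjI allI impI)
      have "N - 2 - 1 = N - 3" "N - 2 + 1 = N - 1" using N by auto
      then show "y (N - 2) * x (N - 2) = 1 + y (N - 1) * y (N - 3)"
        using O[rule_format, of "N - 2"] N by (simp add: mult.commute)
      fix i assume i: "even i \<and> 3 < i \<and> i < N - 1"
      then obtain k where k: "i = k + 2" using that[of "i - 2"] by linarith
      then show "y (i - 1) * x (i - 1) = 1 + y (i - 2) * y i"
        using i O[rule_format, of "k + 1"] by simp
    qed
  next
    assume O: ?o'
    show ?o
    proof (intro allI impI)
      fix i assume i: "odd i \<and> 3 \<le> i \<and> i < N - 1"
      show "y i * x i = 1 + y (i - 1) * y (i + 1)"
      proof (cases "i = N - 2")
        case True
        have "N - 2 - 1 = N - 3" "N - 2 + 1 = N - 1" using N by auto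
        then show ?thesis using O True by (simp add: mult.commute)
      next
        case False
        then have "i + 1 < N - 1" using i by linarith
        then show ?thesis using conjunct2[OF O, rule_format, of "i + 1"] i by simp
      qed
    qed
  qed
  show ?thesis
    unfolding A e o D_recurrence_def
    by (auto simp: numeral_2_eq_2 numeral_3_eq_3 diff_diff_add)
qed

text \<open>
  Types \<open>E\<close>.  \<open>E_bracket\<close> is the Poisson matrix with \<open>{x (2 i - 1), x (2 i)} = x (2 i - 1) * x (2 i)\<close>;
  the symplectic form has the inverse matrix as coefficients, which is \<open>- E_bracket\<close>.
\<close>

definition E_bracket :: "nat \<Rightarrow> nat \<Rightarrow> complex" where
  "E_bracket i j = (if odd i \<and> j = i + 1 then 1 else if odd j \<and> i = j + 1 then - 1 else 0)"

definition E_form :: "nat \<Rightarrow> nat \<Rightarrow> complex" where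
  "E_form i j = - E_bracket i j"

lemma E_form_inverse: "inverse_on (2 * m) E_form E_bracket"
proof -
  define s where "s i = (if odd i then i + 1 else i - 1)" for i :: nat
  have E0: "E_bracket i k = 0" if "i \<ge> 1" "k \<noteq> s i" for i k
    using that by (auto simp: E_bracket_def s_def)
  have sum: "(\<Sum>k=1..2 * m. E_bracket i k * E_bracket k j) = (if i = j then - 1 else 0)"
    if i: "i \<in> {1..2 * m}" and j: "j \<in> {1..2 * m}" for i j
  proof -
    have s: "s i \<in> {1..2 * m}"
    proof (cases "odd i")
      case True
      then have "i \<noteq> 2 * m" by auto
      then show ?thesis using i True by (auto simp: s_def)
    next
      case False
      then have "i \<noteq> 1" by auto
      then show ?thesis using i False by (auto simp: s_def)
    qed
    have "(\<Sum>k=1..2 * m. E_bracket i k * E_bracket k j) =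
      (\<Sum>k\<in>{s i}. E_bracket i k * E_bracket k j)"
      using s i by (intro sum.mono_neutral_right) (auto simp: E0)
    also have "\<dots> = (if i = j then - 1 else 0)"
    proof (cases "odd i")
      case True
      then show ?thesis by (auto simp: E_bracket_def s_def)
    next
      case False
      then obtain k where "i = Suc k" "odd k" using i by (cases i) auto
      then show ?thesis by (auto simp: E_bracket_def s_def)
    qed
    finally show ?thesis .
  qed
  show ?thesis
    unfolding inverse_on_def
  proof (intro ballI conjI)
    fix i j assume ij: "i \<in> {1..2 * m}" "j \<in> {1..2 * m}"
    have "(\<Sum>k=1..2 * m. E_form i k * E_bracket k j) = - (\<Sum>k=1..2 * m. E_bracket i k * E_bracket k j)"
      by (simp add: E_form_def sum_negf)
    then show "(\<Sum>k=1..2 * m. E_form i k * E_bracket k j) = (if i = j then 1 else 0)"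
      by (simp only: sum[OF ij]) simp
    have "(\<Sum>k=1..2 * m. E_bracket i k * E_form k j) = - (\<Sum>k=1..2 * m. E_bracket i k * E_bracket k j)"
      by (simp add: E_form_def sum_negf)
    then show "(\<Sum>k=1..2 * m. E_bracket i k * E_form k j) = (if i = j then 1 else 0)"
      by (simp only: sum[OF ij]) simp
  qed
qed

definition E6_map :: "(nat \<Rightarrow> complex) \<Rightarrow> (nat \<Rightarrow> complex)" where
  "E6_map x =
    (let y1 = (1 + x 2) * (1 + x 2 * x 4 * x 6) / x 1;
         y3 = (1 + x 2 * x 4 * x 6) * (1 + x 4) / x 3;
         y5 = (1 + x 2 * x 4 * x 6) * (1 + x 6) / x 5
     in x(1 := y1, 2 := (1 + y1) / x 2,
          3 := y3, 4 := (1 + y3) / x 4,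
          5 := y5, 6 := (1 + y5) / x 6))"

definition E7_map :: "(nat \<Rightarrow> complex) \<Rightarrow> (nat \<Rightarrow> complex)" where
  "E7_map x =
    (let y1 = (1 + x 2) * (1 + x 2 * x 4) / x 1;
         y3 = (1 + x 2 * x 4) * (1 + x 4) * (1 + x 4 * x 6) / x 3;
         y5 = (1 + x 4 * x 6) * (1 + x 6) / x 5
     in x(1 := y1, 2 := (1 + y1) / x 2,
          3 := y3, 4 := (1 + y3) / x 4,
          5 := y5, 6 := (1 + y5) / x 6))"

definition E8_map :: "(nat \<Rightarrow> complex) \<Rightarrow> (nat \<Rightarrow> complex)" where
  "E8_map x =
    (let y1 = (1 + x 2) * (1 + x 2 * x 4) / x 1;
         y3 = (1 + x 2 * x 4) * (1 + x 4 * x 6) / x 3;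
         y5 = (1 + x 4 * x 6) * (1 + x 6) * (1 + x 6 * x 8) / x 5;
         y7 = (1 + x 6 * x 8) / x 7
     in x(1 := y1, 2 := (1 + y1) / x 2,
          3 := y3, 4 := (1 + y3) / x 4,
          5 := y5, 6 := (1 + y5) / x 6,
          7 := y7, 8 := (1 + y7) / x 8))"

end

theory Submission
  imports Defs "Jordan_Normal_Form.Determinant"
begin

text \<open>
  Each reduced map is the composition of two involutive half steps, which mutate the even-indexed
  and the odd-indexed coordinates.  Both half steps are anti-Poisson, so the map is symplectic.

  For each exceptional tube of the tame quiver let \<open>J\<^sub>1, \<dots>, J\<^sub>n\<close> be the cluster characters of its
  quasi-simple modules, expressed in the reduced coordinates.  The half steps act on them by
  reflections of the cycle, and their brackets are
  \<open>{J\<^sub>i, J\<^sub>j} = \<epsilon>\<^sub>i\<^sub>j (J\<^sub>i J\<^sub>j - 1)\<close> if \<open>i, j\<close> are adjacent on the cycle, \<open>\<epsilon>\<^sub>i\<^sub>j J\<^sub>i J\<^sub>j\<close> otherwise, with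
  signs \<open>\<epsilon>\<^sub>i\<^sub>j\<close>; this is a sum of two compatible brackets.  A Lenard recursion shows that the sums
  \<open>M\<^sub>k\<close> over the \<open>k\<close>-matchings of the cycle of the products of the unmatched \<open>J\<^sub>i\<close> commute.  They are
  invariant under the reflections and provide the integrals in type \<open>D\<close>.  In type \<open>E\<close> quantities
  from different tubes commute, so that invariants of two tubes together suffice.  Independence is
  checked asymptotically in type \<open>D\<close> and at one point in type \<open>E\<close>.
\<close>

section \<open>Generic properties and regular functions\<close>

text \<open>Division is total with \<open>z / 0 = 0\<close>, so invariance, brackets and
  involutivity of the half steps hold only off zero sets of denominators. Every identity is
  therefore generic, and composing with a half step requires that preimages of generic sets be
  generic; for an involution this is automatic, which is a second reason to split the maps into half
  steps. The tubes are chosen by counting. A cycle of odd length n has nonzero matching sums for k =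
  0, ..., (n - 1) / 2. In type D one cycle of length 2m - 1 yields exactly m of them. In E6 two
  cycles of length 3 give 2 + 1 integrals, in E8 cycles of length 5 and 3 give 3 + 1, and in E7 a
  cycle of length 3 gives 2, the third coming from a cycle of length 4. Type D is an infinite
  family, so commutation has to be a statement about matchings and independence cannot be a
  numerical check: a one-parameter curve is used along which each integral has a leading term and
  the Jacobian becomes triangular. In type E everything is finite, and the remaining obstacle is the
  size of the rational identities, which the symmetry under the half steps keeps small in
  number.\<close>

lemma polynomial_fun_cong:
  assumes "polynomial_fun n f" "\<And>i. i \<in> {1..n} \<Longrightarrow> x i = y i"
  shows "f x = f y"
  using assms by induction auto

lemma polynomial_fun_uminus: "polynomial_fun n f \<Longrightarrow> polynomial_fun n (\<lambda>x. - f x)"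
  using polynomial_fun.mult[OF polynomial_fun.const[of n "-1"]] by simp

lemma polynomial_fun_diff:
  "polynomial_fun n f \<Longrightarrow> polynomial_fun n g \<Longrightarrow> polynomial_fun n (\<lambda>x. f x - g x)"
  using polynomial_fun.add[OF _ polynomial_fun_uminus] by fastforce

lemma polynomial_fun_sum:
  "(\<And>i. i \<in> A \<Longrightarrow> polynomial_fun n (f i)) \<Longrightarrow> polynomial_fun n (\<lambda>x. \<Sum>i\<in>A. f i x)"
  by (induction A rule: infinite_finite_induct) (auto intro: polynomial_fun.intros)

lemma polynomial_fun_prod:
  "(\<And>i. i \<in> A \<Longrightarrow> polynomial_fun n (f i)) \<Longrightarrow> polynomial_fun n (\<lambda>x. \<Prod>i\<in>A. f i x)"
  by (induction A rule: infinite_finite_induct) (auto intro: polynomial_fun.intros)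

lemma polynomial_fun_power: "polynomial_fun n f \<Longrightarrow> polynomial_fun n (\<lambda>x. f x ^ k)"
  by (induction k) (auto intro: polynomial_fun.intros)

lemma polynomial_fun_on_line:
  assumes "polynomial_fun n f"
  shows "\<exists>p. \<forall>t. f (\<lambda>i. a i + t * b i) = poly p t"
  using assms
proof induction
  case (const c)
  show ?case by (rule exI[of _ "[:c:]"]) simp
next
  case (coord i)
  show ?case by (rule exI[of _ "[:a i, b i:]"]) simp
next
  case (add f g)
  then show ?case by (metis poly_add)
next
  case (mult f g)
  then show ?case by (metis poly_mult)
qed

text \<open>On the line through \<open>a\<close> and \<open>b\<close> both factors become univariate
  polynomials, nonzero at parameter 0 and 1 respectively, and their product has finitely many roots.
  This is the irreducibility of affine space: it lets two generic properties hold
  simultaneously.\<close>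

lemma polynomial_fun_mult_nonzero:
  assumes "polynomial_fun n f" "polynomial_fun n g" "f a \<noteq> 0" "g b \<noteq> 0"
  shows "\<exists>x. f x * g x \<noteq> 0"
proof -
  let ?l = "\<lambda>t i. a i + t * (b i - a i)"
  obtain p q where p: "\<And>t. f (?l t) = poly p t" and q: "\<And>t. g (?l t) = poly q t"
    using polynomial_fun_on_line assms(1,2) by meson
  have "poly p 0 \<noteq> 0" "poly q 1 \<noteq> 0" using p[of 0] q[of 1] assms by auto
  then have "p * q \<noteq> 0" by auto
  then have "finite {t. poly (p * q) t = 0}" by (rule poly_roots_finite)
  then obtain t where "poly (p * q) t \<noteq> 0"
    using ex_new_if_finite[OF infinite_UNIV_char_0, of "{t. poly (p * q) t = 0}"] by auto
  then have "f (?l t) * g (?l t) \<noteq> 0" by (simp add: p q)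
  then show ?thesis by blast
qed

text \<open>As a filter, genericity combines through \<open>eventually_elim\<close>, and the
  transport of generic identities along a map becomes a \<open>filterlim\<close> statement.\<close>

definition gen :: "nat \<Rightarrow> (nat \<Rightarrow> complex) filter" where
  "gen n = Abs_filter (generically n)"

lemma eventually_gen: "eventually P (gen n) \<longleftrightarrow> generically n P"
  unfolding gen_def
proof (rule eventually_Abs_filter, standard)
  show "generically n (\<lambda>_. True)"
    unfolding generically_def by (rule exI[of _ "\<lambda>_. 1"]) (auto intro: polynomial_fun.const)
next
  fix P Q assume "generically n P" "generically n Q"
  then obtain R S a b where R: "polynomial_fun n R" "R a \<noteq> 0" "\<And>x. R x \<noteq> 0 \<Longrightarrow> P x"
    and S: "polynomial_fun n S" "S b \<noteq> 0" "\<And>x. S x \<noteq> 0 \<Longrightarrow> Q x"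
    unfolding generically_def by blast
  then show "generically n (\<lambda>x. P x \<and> Q x)"
    unfolding generically_def
    by (intro exI[of _ "\<lambda>x. R x * S x"] conjI polynomial_fun.mult polynomial_fun_mult_nonzero[of n R S a b]) auto
next
  fix P Q :: "(nat \<Rightarrow> complex) \<Rightarrow> bool"
  assume "\<forall>x. P x \<longrightarrow> Q x" "generically n P"
  then show "generically n Q" unfolding generically_def by blast
qed

lemma gen_neq_bot: "gen n \<noteq> bot"
  by (auto simp: eventually_False[symmetric] eventually_gen generically_def)

lemma eventually_gen_ex: "eventually P (gen n) \<Longrightarrow> \<exists>x. P x"
  using eventually_happens gen_neq_bot by blast

lemma eventually_gen_nonzero:
  "polynomial_fun n f \<Longrightarrow> f a \<noteq> 0 \<Longrightarrow> \<forall>\<^sub>F x in gen n. f x \<noteq> 0"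
  by (auto simp: eventually_gen generically_def)

text \<open>\<open>reg n a f\<close>: near \<open>a\<close>, in the Zariski sense, \<open>f\<close> is a quotient of polynomials.  Unlike
  \<open>rational_fun\<close> this is stable under sums of quotients, whose value \<open>z / 0 = 0\<close> at a pole of one
  summand is not that of a single quotient.\<close>

definition reg :: "nat \<Rightarrow> (nat \<Rightarrow> complex) \<Rightarrow> ((nat \<Rightarrow> complex) \<Rightarrow> complex) \<Rightarrow> bool" where
  "reg n a f \<longleftrightarrow> (\<exists>P Q. polynomial_fun n P \<and> polynomial_fun n Q \<and> Q a \<noteq> 0 \<and>
     (\<forall>x. Q x \<noteq> 0 \<longrightarrow> f x = P x / Q x))"

lemma regI:
  "polynomial_fun n P \<Longrightarrow> polynomial_fun n Q \<Longrightarrow> Q a \<noteq> 0 \<Longrightarrow> (\<And>x. Q x \<noteq> 0 \<Longrightarrow> f x = P x / Q x) \<Longrightarrow> reg n a f"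
  unfolding reg_def by blast

lemma reg_polynomial: "polynomial_fun n f \<Longrightarrow> reg n a f"
  by (rule regI[of n f "\<lambda>_. 1"]) (auto intro: polynomial_fun.const)

lemma reg_const [intro, simp]: "reg n a (\<lambda>x. c)"
  by (intro reg_polynomial polynomial_fun.const)

lemma reg_coord [intro]: "i \<in> {1..n} \<Longrightarrow> reg n a (\<lambda>x. x i)"
  by (intro reg_polynomial polynomial_fun.coord) auto

lemma reg_add [intro]:
  assumes "reg n a f" "reg n a g" shows "reg n a (\<lambda>x. f x + g x)"
proof -
  from assms obtain P Q P' Q' where *: "polynomial_fun n P" "polynomial_fun n Q" "Q a \<noteq> 0"
    "\<And>x. Q x \<noteq> 0 \<Longrightarrow> f x = P x / Q x" "polynomial_fun n P'" "polynomial_fun n Q'" "Q' a \<noteq> 0"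
    "\<And>x. Q' x \<noteq> 0 \<Longrightarrow> g x = P' x / Q' x"
    unfolding reg_def by blast
  show ?thesis
    by (rule regI[of n "\<lambda>x. P x * Q' x + P' x * Q x" "\<lambda>x. Q x * Q' x"])
      (use * in \<open>auto intro!: polynomial_fun.intros simp: field_simps\<close>)
qed

lemma reg_mult [intro]:
  assumes "reg n a f" "reg n a g" shows "reg n a (\<lambda>x. f x * g x)"
proof -
  from assms obtain P Q P' Q' where *: "polynomial_fun n P" "polynomial_fun n Q" "Q a \<noteq> 0"
    "\<And>x. Q x \<noteq> 0 \<Longrightarrow> f x = P x / Q x" "polynomial_fun n P'" "polynomial_fun n Q'" "Q' a \<noteq> 0"
    "\<And>x. Q' x \<noteq> 0 \<Longrightarrow> g x = P' x / Q' x"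
    unfolding reg_def by blast
  show ?thesis
    by (rule regI[of n "\<lambda>x. P x * P' x" "\<lambda>x. Q x * Q' x"])
      (use * in \<open>auto intro!: polynomial_fun.mult\<close>)
qed

lemma reg_inverse [intro]:
  assumes "reg n a f" "f a \<noteq> 0" shows "reg n a (\<lambda>x. inverse (f x))"
proof -
  from assms obtain P Q where *: "polynomial_fun n P" "polynomial_fun n Q" "Q a \<noteq> 0"
    "\<And>x. Q x \<noteq> 0 \<Longrightarrow> f x = P x / Q x"
    unfolding reg_def by blast
  then have "P a \<noteq> 0" using assms by force
  with * show ?thesis
    by (intro regI[of n "\<lambda>x. Q x * Q x" "\<lambda>x. P x * Q x"])
      (auto intro!: polynomial_fun.mult)
qed

lemma reg_divide [intro]: "reg n a f \<Longrightarrow> reg n a g \<Longrightarrow> g a \<noteq> 0 \<Longrightarrow> reg n a (\<lambda>x. f x / g x)"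
  unfolding divide_inverse by (intro reg_mult reg_inverse)

lemma reg_uminus [intro]: "reg n a f \<Longrightarrow> reg n a (\<lambda>x. - f x)"
  using reg_mult[OF reg_const[of n a "-1"]] by simp

lemma reg_diff [intro]: "reg n a f \<Longrightarrow> reg n a g \<Longrightarrow> reg n a (\<lambda>x. f x - g x)"
  using reg_add[OF _ reg_uminus, of n a f g] by simp

lemma reg_power [intro]: "reg n a f \<Longrightarrow> reg n a (\<lambda>x. f x ^ k)"
  by (induction k) auto

lemma reg_sum [intro]: "(\<And>i. i \<in> A \<Longrightarrow> reg n a (f i)) \<Longrightarrow> reg n a (\<lambda>x. \<Sum>i\<in>A. f i x)"
  by (induction A rule: infinite_finite_induct) auto

lemma reg_prod [intro]: "(\<And>i. i \<in> A \<Longrightarrow> reg n a (f i)) \<Longrightarrow> reg n a (\<lambda>x. \<Prod>i\<in>A. f i x)"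
  by (induction A rule: infinite_finite_induct) auto

text \<open>The quotient representing \<open>g\<close> is expanded by numerator and denominator of
  \<open>h\<close>. Where the new denominator is nonzero, the representation of \<open>h\<close> is
  valid and \<open>h\<close> does not vanish, so \<open>f\<close> and \<open>g\<close> agree
  there.\<close>

lemma reg_cong_where_nonzero:
  assumes "reg n a g" "reg n a h" "h a \<noteq> 0" "\<And>x. h x \<noteq> 0 \<Longrightarrow> f x = g x"
  shows "reg n a f"
proof -
  from assms obtain P Q P' Q' where *: "polynomial_fun n P" "polynomial_fun n Q" "Q a \<noteq> 0"
    "\<And>x. Q x \<noteq> 0 \<Longrightarrow> g x = P x / Q x" "polynomial_fun n P'" "polynomial_fun n Q'" "Q' a \<noteq> 0"
    "\<And>x. Q' x \<noteq> 0 \<Longrightarrow> h x = P' x / Q' x"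
    unfolding reg_def by blast
  then have "P' a \<noteq> 0" using assms by force
  show ?thesis
    by (rule regI[of n "\<lambda>x. P x * (P' x * Q' x)" "\<lambda>x. Q x * (P' x * Q' x)"])
      (use * assms(4) \<open>P' a \<noteq> 0\<close> in \<open>auto intro!: polynomial_fun.intros\<close>)
qed

lemma eventually_reg:
  assumes "reg n a f" shows "\<forall>\<^sub>F x in gen n. reg n x f"
proof -
  from assms obtain P Q where *: "polynomial_fun n P" "polynomial_fun n Q" "Q a \<noteq> 0"
    "\<And>x. Q x \<noteq> 0 \<Longrightarrow> f x = P x / Q x"
    unfolding reg_def by blast
  show ?thesis
    by (rule eventually_mono[OF eventually_gen_nonzero[of n Q a]]) (use * in \<open>auto intro: regI\<close>)
qed

lemma reg_eventually_nonzero: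
  assumes "reg n a f" "f a \<noteq> 0" shows "\<forall>\<^sub>F x in gen n. f x \<noteq> 0"
proof -
  from assms obtain P Q where *: "polynomial_fun n P" "polynomial_fun n Q" "Q a \<noteq> 0"
    "\<And>x. Q x \<noteq> 0 \<Longrightarrow> f x = P x / Q x"
    unfolding reg_def by blast
  then have "P a * Q a \<noteq> 0" using assms by force
  show ?thesis
    by (rule eventually_mono[OF eventually_gen_nonzero[of n "\<lambda>x. P x * Q x", OF _ \<open>P a * Q a \<noteq> 0\<close>]])
      (use * in \<open>auto intro: polynomial_fun.mult\<close>)
qed

lemma reg_rational_fun:
  assumes "reg n a f"
  obtains g where "rational_fun n g" "\<forall>\<^sub>F x in gen n. f x = g x"
proof -
  from assms obtain P Q where *: "polynomial_fun n P" "polynomial_fun n Q" "Q a \<noteq> 0"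
    "\<And>x. Q x \<noteq> 0 \<Longrightarrow> f x = P x / Q x"
    unfolding reg_def by blast
  show ?thesis
  proof
    show "rational_fun n (\<lambda>x. P x / Q x)" unfolding rational_fun_def using * by blast
    show "\<forall>\<^sub>F x in gen n. f x = P x / Q x"
      by (rule eventually_mono[OF eventually_gen_nonzero[of n Q a]]) (use * in auto)
  qed
qed

section \<open>Partial derivatives\<close>

lemma polynomial_fun_has_derivative:
  assumes "polynomial_fun n f"
  shows "\<exists>f'. polynomial_fun n f' \<and>
    (\<forall>x. ((\<lambda>t. f (x(k := t))) has_field_derivative f' x) (at (x k)))"
  using assms
proof induction
  case (const c)
  show ?case by (rule exI[of _ "\<lambda>_. 0"]) (auto intro: polynomial_fun.const)
next
  case (coord i)
  show ?case
    by (rule exI[of _ "\<lambda>_. if i = k then 1 else 0"]) (auto intro: polynomial_fun.const)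
next
  case (add f g)
  then obtain f' g' where *:
    "polynomial_fun n f'" "\<And>x. ((\<lambda>t. f (x(k := t))) has_field_derivative f' x) (at (x k))"
    "polynomial_fun n g'" "\<And>x. ((\<lambda>t. g (x(k := t))) has_field_derivative g' x) (at (x k))"
    by blast
  then show ?case
    by (intro exI[of _ "\<lambda>x. f' x + g' x"] conjI allI polynomial_fun.add DERIV_add) (rule *)+
next
  case (mult f g)
  then obtain f' g' where *:
    "polynomial_fun n f'" "\<And>x. ((\<lambda>t. f (x(k := t))) has_field_derivative f' x) (at (x k))"
    "polynomial_fun n g'" "\<And>x. ((\<lambda>t. g (x(k := t))) has_field_derivative g' x) (at (x k))"
    by blast
  have "((\<lambda>t. f (x(k := t)) * g (x(k := t))) has_field_derivative f' x * g x + g' x * f x) (at (x k))" for x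
    using DERIV_mult[OF *(2)[of x] *(4)[of x]] by simp
  then show ?case
    by (intro exI[of _ "\<lambda>x. f' x * g x + g' x * f x"] conjI allI polynomial_fun.add polynomial_fun.mult)
      (rule * mult)+
qed

lemma eventually_polynomial_nonzero_on_line:
  assumes "polynomial_fun n Q" "Q a \<noteq> 0"
  shows "\<forall>\<^sub>F t in nhds (a k). Q (a(k := t)) \<noteq> (0::complex)"
proof -
  obtain Q' where "((\<lambda>t. Q (a(k := t))) has_field_derivative Q' a) (at (a k))"
    using polynomial_fun_has_derivative[OF assms(1)] by blast
  then have "isCont (\<lambda>t. Q (a(k := t))) (a k)" by (rule DERIV_isCont)
  then have "((\<lambda>t. Q (a(k := t))) \<longlongrightarrow> Q a) (nhds (a k))"
    using tendsto_at_iff_tendsto_nhds[of "\<lambda>t. Q (a(k := t))" "a k"] by (simp add: continuous_at)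
  then show ?thesis using assms(2) by (rule tendsto_imp_eventually_ne)
qed

text \<open>The numerator \<open>D\<close> is a single polynomial valid at all points with
  \<open>Q\<close> nonzero; this uniformity is what makes a partial derivative regular again. Near
  such a point \<open>Q\<close> stays nonzero on the coordinate line, so \<open>f\<close> may be
  replaced by \<open>P / Q\<close>.\<close>

lemma reg_has_partial_deriv_aux:
  assumes "polynomial_fun n P" "polynomial_fun n Q" "\<And>x. Q x \<noteq> 0 \<Longrightarrow> f x = P x / Q x"
  shows "\<exists>D. polynomial_fun n D \<and> (\<forall>a. Q a \<noteq> 0 \<longrightarrow>
    ((\<lambda>t. f (a(k := t))) has_field_derivative D a / (Q a * Q a)) (at (a k)))"
proof -
  obtain P' Q' where *:
    "polynomial_fun n P'" "\<And>x. ((\<lambda>t. P (x(k := t))) has_field_derivative P' x) (at (x k))"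
    "polynomial_fun n Q'" "\<And>x. ((\<lambda>t. Q (x(k := t))) has_field_derivative Q' x) (at (x k))"
    using polynomial_fun_has_derivative assms by meson
  have "((\<lambda>t. f (a(k := t))) has_field_derivative (P' a * Q a - P a * Q' a) / (Q a * Q a)) (at (a k))"
    if "Q a \<noteq> 0" for a
  proof -
    have "((\<lambda>t. P (a(k := t)) / Q (a(k := t))) has_field_derivative (P' a * Q a - P a * Q' a) / (Q a * Q a)) (at (a k))"
      using DERIV_divide[OF *(2)[of a] *(4)[of a]] that by simp
    moreover have "\<forall>\<^sub>F t in nhds (a k). P (a(k := t)) / Q (a(k := t)) = f (a(k := t))"
      by (rule eventually_mono[OF eventually_polynomial_nonzero_on_line[OF assms(2) that]])
        (rule assms(3)[symmetric])
    ultimately show ?thesis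
      by (subst (asm) DERIV_cong_ev) auto
  qed
  then show ?thesis
    using * assms by (intro exI[of _ "\<lambda>a. P' a * Q a - P a * Q' a"]) (auto intro!: polynomial_fun.mult polynomial_fun_diff)
qed

lemma reg_has_partial_deriv:
  assumes "reg n a f"
  shows "((\<lambda>t. f (a(k := t))) has_field_derivative partial_deriv k f a) (at (a k))"
proof -
  from assms obtain P Q where "polynomial_fun n P" "polynomial_fun n Q" "Q a \<noteq> 0"
    "\<And>x. Q x \<noteq> 0 \<Longrightarrow> f x = P x / Q x"
    unfolding reg_def by blast
  then obtain D where "((\<lambda>t. f (a(k := t))) has_field_derivative D) (at (a k))"
    using reg_has_partial_deriv_aux by blast
  then show ?thesis by (metis DERIV_imp_deriv partial_deriv_def)
qed

lemma partial_deriv_eqI: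
  "((\<lambda>t. f (a(k := t))) has_field_derivative D) (at (a k)) \<Longrightarrow> partial_deriv k f a = D"
  unfolding partial_deriv_def by (rule DERIV_imp_deriv)

lemma reg_partial_deriv [intro]:
  assumes "reg n a f" shows "reg n a (partial_deriv k f)"
proof -
  from assms obtain P Q where *: "polynomial_fun n P" "polynomial_fun n Q" "Q a \<noteq> 0"
    "\<And>x. Q x \<noteq> 0 \<Longrightarrow> f x = P x / Q x"
    unfolding reg_def by blast
  obtain D where "polynomial_fun n D"
    "\<And>a. Q a \<noteq> 0 \<Longrightarrow> ((\<lambda>t. f (a(k := t))) has_field_derivative D a / (Q a * Q a)) (at (a k))"
    using reg_has_partial_deriv_aux[OF *(1,2,4)] by blast
  then show ?thesis using *
    by (intro regI[of n D "\<lambda>x. Q x * Q x"]) (auto intro!: partial_deriv_eqI polynomial_fun.mult)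
qed

lemma partial_deriv_const [simp]: "partial_deriv k (\<lambda>x. c) a = 0"
  by (rule partial_deriv_eqI) simp

lemma partial_deriv_coord [simp]: "partial_deriv k (\<lambda>x. x i) a = (if i = k then 1 else 0)"
  by (rule partial_deriv_eqI) auto

lemma partial_deriv_add:
  "reg n a f \<Longrightarrow> reg n a g \<Longrightarrow> partial_deriv k (\<lambda>x. f x + g x) a = partial_deriv k f a + partial_deriv k g a"
  by (rule partial_deriv_eqI) (intro DERIV_add reg_has_partial_deriv)

lemma partial_deriv_mult:
  assumes "reg n a f" "reg n a g"
  shows "partial_deriv k (\<lambda>x. f x * g x) a = partial_deriv k f a * g a + f a * partial_deriv k g a"
  by (rule partial_deriv_eqI)
    (use DERIV_mult[OF assms[THEN reg_has_partial_deriv[where k = k]]] in \<open>simp add: mult.commute\<close>)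

lemma partial_deriv_divide:
  assumes "reg n a f" "reg n a g" "g a \<noteq> 0"
  shows "partial_deriv k (\<lambda>x. f x / g x) a = (partial_deriv k f a * g a - f a * partial_deriv k g a) / (g a * g a)"
  by (rule partial_deriv_eqI)
    (use DERIV_divide[OF assms(1,2)[THEN reg_has_partial_deriv[where k = k]]] assms in simp)

lemma partial_deriv_power:
  assumes "reg n a f"
  shows "partial_deriv k (\<lambda>x. f x ^ j) a = of_nat j * f a ^ (j - 1) * partial_deriv k f a"
  by (rule partial_deriv_eqI)
    (use DERIV_power[OF reg_has_partial_deriv[OF assms, of k], of j] in \<open>simp add: mult_ac\<close>)

lemma partial_deriv_cong:
  assumes "polynomial_fun n R" "R a \<noteq> 0" "\<And>x. R x \<noteq> 0 \<Longrightarrow> f x = g x"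
  shows "partial_deriv k f a = partial_deriv k g a"
  unfolding partial_deriv_def
  by (rule deriv_cong_ev, rule eventually_mono[OF eventually_polynomial_nonzero_on_line[OF assms(1,2)]])
    (rule assms(3), assumption, rule refl)

lemma eventually_partial_deriv_cong:
  assumes "\<forall>\<^sub>F x in gen n. f x = g x"
  shows "\<forall>\<^sub>F x in gen n. \<forall>k. partial_deriv k f x = partial_deriv k g x"
proof -
  obtain R where R: "polynomial_fun n R" "\<exists>x. R x \<noteq> 0" "\<And>x. R x \<noteq> 0 \<Longrightarrow> f x = g x"
    using assms unfolding eventually_gen generically_def by blast
  then obtain b where "R b \<noteq> 0" by blast
  show ?thesis
    by (rule eventually_mono[OF eventually_gen_nonzero[OF R(1) \<open>R b \<noteq> 0\<close>]])
      (intro allI partial_deriv_cong[OF R(1) _ R(3)])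
qed

lemma partial_deriv_cong_nonzero:
  assumes "reg n a h" "h a \<noteq> 0" "\<And>x. h x \<noteq> 0 \<Longrightarrow> f x = g x"
  shows "partial_deriv k f a = partial_deriv k g a"
proof -
  from assms(1) obtain P Q where *: "polynomial_fun n P" "polynomial_fun n Q" "Q a \<noteq> 0"
    "\<And>x. Q x \<noteq> 0 \<Longrightarrow> h x = P x / Q x"
    unfolding reg_def by blast
  then have "P a \<noteq> 0" using assms by force
  show ?thesis
    by (rule partial_deriv_cong[of n "\<lambda>x. P x * Q x"])
      (use * assms(3) \<open>P a \<noteq> 0\<close> in \<open>auto intro: polynomial_fun.mult\<close>)
qed

text \<open>\<open>partial_deriv\<close> only sees coordinate lines, so the chain rule is obtained
  by induction on the construction of \<open>f\<close> instead of from total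
  differentiability.\<close>

lemma chain_polynomial:
  assumes "polynomial_fun r f" "\<And>i. i \<in> {1..r} \<Longrightarrow> reg n a (\<lambda>x. \<Phi> x i)"
  shows "reg n a (\<lambda>x. f (\<Phi> x)) \<and> partial_deriv k (\<lambda>x. f (\<Phi> x)) a =
    (\<Sum>i=1..r. partial_deriv i f (\<Phi> a) * partial_deriv k (\<lambda>x. \<Phi> x i) a)"
  using assms(1)
proof induction
  case (const c)
  then show ?case by simp
next
  case (coord j)
  have "(\<Sum>i=1..r. partial_deriv i (\<lambda>x. x j) (\<Phi> a) * partial_deriv k (\<lambda>x. \<Phi> x i) a) =
    (\<Sum>i=1..r. if j = i then partial_deriv k (\<lambda>x. \<Phi> x i) a else 0)"
    by (rule sum.cong) auto
  then show ?case using coord assms(2) by simp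
next
  case (add f g)
  then have "reg r (\<Phi> a) f" "reg r (\<Phi> a) g" by (auto intro: reg_polynomial)
  then show ?case using add
    by (auto simp: partial_deriv_add[where n = n] partial_deriv_add[where n = r] algebra_simps sum.distrib)
next
  case (mult f g)
  then have "reg r (\<Phi> a) f" "reg r (\<Phi> a) g" by (auto intro: reg_polynomial)
  then show ?case using mult
    by (auto simp: partial_deriv_mult[where n = n] partial_deriv_mult[where n = r] algebra_simps
        sum.distrib sum_distrib_left)
qed

lemma chain_reg:
  assumes "reg r (\<Phi> a) f" "\<And>i. i \<in> {1..r} \<Longrightarrow> reg n a (\<lambda>x. \<Phi> x i)"
  shows reg_compose: "reg n a (\<lambda>x. f (\<Phi> x))"
    and partial_deriv_compose: "partial_deriv k (\<lambda>x. f (\<Phi> x)) a =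
      (\<Sum>i=1..r. partial_deriv i f (\<Phi> a) * partial_deriv k (\<lambda>x. \<Phi> x i) a)"
proof -
  from assms(1) obtain P Q where *: "polynomial_fun r P" "polynomial_fun r Q" "Q (\<Phi> a) \<noteq> 0"
    "\<And>x. Q x \<noteq> 0 \<Longrightarrow> f x = P x / Q x"
    unfolding reg_def by blast
  note P = chain_polynomial[OF *(1) assms(2)] and Q = chain_polynomial[OF *(2) assms(2)]
  have reg: "reg n a (\<lambda>x. P (\<Phi> x) / Q (\<Phi> x))" using P Q * by auto
  show "reg n a (\<lambda>x. f (\<Phi> x))"
    by (rule reg_cong_where_nonzero[OF reg, of "\<lambda>x. Q (\<Phi> x)"]) (use Q * in auto)
  have "partial_deriv k (\<lambda>x. f (\<Phi> x)) a = partial_deriv k (\<lambda>x. P (\<Phi> x) / Q (\<Phi> x)) a"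
    by (rule partial_deriv_cong_nonzero[of n a "\<lambda>x. Q (\<Phi> x)"]) (use Q * in auto)
  also have "\<dots> = (\<Sum>i=1..r. (partial_deriv i P (\<Phi> a) * Q (\<Phi> a) - P (\<Phi> a) * partial_deriv i Q (\<Phi> a)) /
      (Q (\<Phi> a) * Q (\<Phi> a)) * partial_deriv k (\<lambda>x. \<Phi> x i) a)"
    using P Q * by (subst partial_deriv_divide[where n = n])
      (auto simp: sum_divide_distrib sum_distrib_left sum_distrib_right sum_subtractf[symmetric] algebra_simps
        diff_divide_distrib)
  also have "\<dots> = (\<Sum>i=1..r. partial_deriv i f (\<Phi> a) * partial_deriv k (\<lambda>x. \<Phi> x i) a)"
  proof (rule sum.cong)
    fix i
    have "partial_deriv i f (\<Phi> a) = partial_deriv i (\<lambda>x. P x / Q x) (\<Phi> a)"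
      by (rule partial_deriv_cong[OF *(2,3,4)])
    then show "(partial_deriv i P (\<Phi> a) * Q (\<Phi> a) - P (\<Phi> a) * partial_deriv i Q (\<Phi> a)) /
      (Q (\<Phi> a) * Q (\<Phi> a)) * partial_deriv k (\<lambda>x. \<Phi> x i) a =
      partial_deriv i f (\<Phi> a) * partial_deriv k (\<lambda>x. \<Phi> x i) a"
      using * by (simp add: partial_deriv_divide[where n = r] reg_polynomial)
  qed simp
  finally show "partial_deriv k (\<lambda>x. f (\<Phi> x)) a =
      (\<Sum>i=1..r. partial_deriv i f (\<Phi> a) * partial_deriv k (\<lambda>x. \<Phi> x i) a)" .
qed

section \<open>Poisson brackets and Poisson maps\<close>

lemma poisson_bracket_compose:
  assumes "reg r (\<Phi> a) f" "\<And>i. i \<in> {1..r} \<Longrightarrow> reg n a (\<lambda>x. \<Phi> x i)"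
    and "reg s (\<Psi> a) g" "\<And>i. i \<in> {1..s} \<Longrightarrow> reg n a (\<lambda>x. \<Psi> x i)"
  shows "poisson_bracket n C (\<lambda>x. f (\<Phi> x)) (\<lambda>x. g (\<Psi> x)) a =
    (\<Sum>i=1..r. \<Sum>j=1..s. partial_deriv i f (\<Phi> a) * partial_deriv j g (\<Psi> a) *
       poisson_bracket n C (\<lambda>x. \<Phi> x i) (\<lambda>x. \<Psi> x j) a)"
proof -
  let ?F = "\<lambda>i. partial_deriv i f (\<Phi> a)" and ?G = "\<lambda>j. partial_deriv j g (\<Psi> a)"
  let ?P = "\<lambda>i p. partial_deriv p (\<lambda>x. \<Phi> x i) a" and ?Q = "\<lambda>j q. partial_deriv q (\<lambda>x. \<Psi> x j) a"
  have "poisson_bracket n C (\<lambda>x. f (\<Phi> x)) (\<lambda>x. g (\<Psi> x)) a =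
    (\<Sum>p=1..n. \<Sum>q=1..n. \<Sum>i=1..r. \<Sum>j=1..s. ?F i * ?G j * (C p q * a p * a q * ?P i p * ?Q j q))"
    unfolding poisson_bracket_def partial_deriv_compose[of r \<Phi> a f n, OF assms(1,2), simplified]
      partial_deriv_compose[of s \<Psi> a g n, OF assms(3,4), simplified]
    by (simp add: sum_distrib_left sum_distrib_right mult_ac)
  also have "\<dots> = (\<Sum>i=1..r. \<Sum>p=1..n. \<Sum>q=1..n. \<Sum>j=1..s. ?F i * ?G j * (C p q * a p * a q * ?P i p * ?Q j q))"
    by (subst (2) sum.swap, subst sum.swap) simp
  also have "\<dots> = (\<Sum>i=1..r. \<Sum>j=1..s. \<Sum>p=1..n. \<Sum>q=1..n. ?F i * ?G j * (C p q * a p * a q * ?P i p * ?Q j q))"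
    by (subst (3) sum.swap, subst (2) sum.swap) simp
  also have "\<dots> = (\<Sum>i=1..r. \<Sum>j=1..s. ?F i * ?G j * poisson_bracket n C (\<lambda>x. \<Phi> x i) (\<lambda>x. \<Psi> x j) a)"
    unfolding poisson_bracket_def by (simp add: sum_distrib_left)
  finally show ?thesis .
qed

text \<open>The factor \<open>c\<close> is -1 for a half step and 1 for the full map, and it
  multiplies under composition. The \<open>filterlim\<close> clause expresses dominance: preimages
  of generic sets are generic, so that generic identities can be pulled back along
  \<open>\<Phi>\<close>.\<close>

definition poisson_map ::
  "nat \<Rightarrow> (nat \<Rightarrow> nat \<Rightarrow> complex) \<Rightarrow> complex \<Rightarrow> ((nat \<Rightarrow> complex) \<Rightarrow> nat \<Rightarrow> complex) \<Rightarrow> bool" where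
  "poisson_map n C c \<Phi> \<longleftrightarrow> filterlim \<Phi> (gen n) (gen n) \<and>
     (\<forall>\<^sub>F x in gen n. \<forall>i\<in>{1..n}. reg n x (\<lambda>y. \<Phi> y i)) \<and>
     (\<forall>\<^sub>F x in gen n. \<forall>i\<in>{1..n}. \<forall>j\<in>{1..n}.
        poisson_bracket n C (\<lambda>y. \<Phi> y i) (\<lambda>y. \<Phi> y j) x = c * C i j * \<Phi> x i * \<Phi> x j)"

lemma poisson_map_filterlim: "poisson_map n C c \<Phi> \<Longrightarrow> filterlim \<Phi> (gen n) (gen n)"
  by (simp add: poisson_map_def)

lemma eventually_poisson_map:
  "poisson_map n C c \<Phi> \<Longrightarrow> \<forall>\<^sub>F x in gen n. P x \<Longrightarrow> \<forall>\<^sub>F x in gen n. P (\<Phi> x)"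
  unfolding poisson_map_def filterlim_iff by blast

lemma poisson_map_reg:
  assumes "poisson_map n C c \<Phi>" "reg n a f"
  shows "\<forall>\<^sub>F x in gen n. reg n x (\<lambda>y. f (\<Phi> y))"
proof -
  have "\<forall>\<^sub>F x in gen n. reg n (\<Phi> x) f"
    by (rule eventually_poisson_map[OF assms(1) eventually_reg[OF assms(2)]])
  moreover have "\<forall>\<^sub>F x in gen n. \<forall>i\<in>{1..n}. reg n x (\<lambda>y. \<Phi> y i)"
    using assms(1) by (simp add: poisson_map_def)
  ultimately show ?thesis
    by eventually_elim (rule reg_compose, auto)
qed

lemma poisson_map_bracket:
  assumes "poisson_map n C c \<Phi>" "reg n a f" "reg n b g"
  shows "\<forall>\<^sub>F x in gen n. poisson_bracket n C (\<lambda>y. f (\<Phi> y)) (\<lambda>y. g (\<Phi> y)) x = c * poisson_bracket n C f g (\<Phi> x)"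
proof -
  have "\<forall>\<^sub>F x in gen n. reg n (\<Phi> x) f" "\<forall>\<^sub>F x in gen n. reg n (\<Phi> x) g"
    using eventually_poisson_map[OF assms(1) eventually_reg] assms(2,3) by blast+
  moreover have "\<forall>\<^sub>F x in gen n. \<forall>i\<in>{1..n}. reg n x (\<lambda>y. \<Phi> y i)"
    "\<forall>\<^sub>F x in gen n. \<forall>i\<in>{1..n}. \<forall>j\<in>{1..n}.
        poisson_bracket n C (\<lambda>y. \<Phi> y i) (\<lambda>y. \<Phi> y j) x = c * C i j * \<Phi> x i * \<Phi> x j"
    using assms(1) by (simp_all add: poisson_map_def)
  ultimately show ?thesis
  proof eventually_elim
    case (elim x)
    have "poisson_bracket n C (\<lambda>y. f (\<Phi> y)) (\<lambda>y. g (\<Phi> y)) x =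
      (\<Sum>i=1..n. \<Sum>j=1..n. partial_deriv i f (\<Phi> x) * partial_deriv j g (\<Phi> x) * (c * C i j * \<Phi> x i * \<Phi> x j))"
      using elim by (subst poisson_bracket_compose[where r = n and s = n]) auto
    then show ?case
      unfolding poisson_bracket_def by (simp add: sum_distrib_left mult_ac)
  qed
qed

lemma poisson_map_compose:
  assumes "poisson_map n C c \<Phi>" "poisson_map n C d \<Psi>"
  shows "poisson_map n C (c * d) (\<lambda>x. \<Psi> (\<Phi> x))"
  unfolding poisson_map_def
proof (intro conjI)
  show "filterlim (\<lambda>x. \<Psi> (\<Phi> x)) (gen n) (gen n)"
    using filterlim_compose[OF poisson_map_filterlim poisson_map_filterlim] assms by blast
  have reg: "\<forall>\<^sub>F x in gen n. \<forall>i\<in>{1..n}. reg n x (\<lambda>y. \<Psi> y i)"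
    using assms(2) by (simp add: poisson_map_def)
  then obtain a where a: "\<And>i. i \<in> {1..n} \<Longrightarrow> reg n a (\<lambda>y. \<Psi> y i)"
    using eventually_gen_ex[OF reg] by blast
  show "\<forall>\<^sub>F x in gen n. \<forall>i\<in>{1..n}. reg n x (\<lambda>y. \<Psi> (\<Phi> y) i)"
    using poisson_map_reg[OF assms(1) a] by (intro eventually_ball_finite) auto
  have "\<forall>\<^sub>F x in gen n. \<forall>i\<in>{1..n}. \<forall>j\<in>{1..n}.
      poisson_bracket n C (\<lambda>y. \<Psi> (\<Phi> y) i) (\<lambda>y. \<Psi> (\<Phi> y) j) x =
      c * poisson_bracket n C (\<lambda>y. \<Psi> y i) (\<lambda>y. \<Psi> y j) (\<Phi> x)"
    using poisson_map_bracket[OF assms(1) a a] by (intro eventually_ball_finite ballI) auto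
  moreover have "\<forall>\<^sub>F x in gen n. \<forall>i\<in>{1..n}. \<forall>j\<in>{1..n}.
      poisson_bracket n C (\<lambda>y. \<Psi> y i) (\<lambda>y. \<Psi> y j) (\<Phi> x) = d * C i j * \<Psi> (\<Phi> x) i * \<Psi> (\<Phi> x) j"
    by (rule eventually_poisson_map[OF assms(1)]) (use assms(2) in \<open>simp add: poisson_map_def\<close>)
  ultimately show "\<forall>\<^sub>F x in gen n. \<forall>i\<in>{1..n}. \<forall>j\<in>{1..n}.
      poisson_bracket n C (\<lambda>y. \<Psi> (\<Phi> y) i) (\<lambda>y. \<Psi> (\<Phi> y) j) x =
      c * d * C i j * \<Psi> (\<Phi> x) i * \<Psi> (\<Phi> x) j"
    by eventually_elim simp
qed

text \<open>If the polynomial \<open>R\<close> is nonzero at a good point \<open>x\<close>, then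
  \<open>R\<close> composed with \<open>\<Phi>\<close> takes the nonzero value \<open>R x\<close> at
  the point \<open>\<Phi> x\<close>. Being regular there, it is nonzero generically.\<close>

lemma filterlim_gen_involution:
  assumes "\<forall>\<^sub>F x in gen n. (\<forall>i\<in>{1..n}. reg n (\<Phi> x) (\<lambda>y. \<Phi> y i)) \<and> (\<forall>i\<in>{1..n}. \<Phi> (\<Phi> x) i = x i)"
  shows "filterlim \<Phi> (gen n) (gen n)"
  unfolding filterlim_iff
proof (intro allI impI)
  fix P assume "eventually P (gen n)"
  then obtain R b where R: "polynomial_fun n R" "R b \<noteq> 0" "\<And>x. R x \<noteq> 0 \<Longrightarrow> P x"
    unfolding eventually_gen generically_def by blast
  obtain x where x: "\<And>i. i \<in> {1..n} \<Longrightarrow> reg n (\<Phi> x) (\<lambda>y. \<Phi> y i)"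
    "\<And>i. i \<in> {1..n} \<Longrightarrow> \<Phi> (\<Phi> x) i = x i" "R x \<noteq> 0"
    using eventually_gen_ex[OF eventually_conj[OF assms eventually_gen_nonzero[OF R(1,2)]]] by blast
  have "reg n (\<Phi> x) (\<lambda>y. R (\<Phi> y))"
    by (rule reg_compose[OF reg_polynomial[OF R(1)] x(1)])
  moreover have "R (\<Phi> (\<Phi> x)) \<noteq> 0"
    using polynomial_fun_cong[OF R(1), of "\<Phi> (\<Phi> x)" x] x by simp
  ultimately have "\<forall>\<^sub>F y in gen n. R (\<Phi> y) \<noteq> 0" by (rule reg_eventually_nonzero)
  then show "\<forall>\<^sub>F y in gen n. P (\<Phi> y)" by (rule eventually_mono) (rule R(3))
qed

lemma eventually_coords_nonzero: "\<forall>\<^sub>F x in gen n. \<forall>i\<in>{1..n}. x i \<noteq> 0"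
  using eventually_gen_nonzero[OF polynomial_fun.coord, of _ n "\<lambda>_. 1"]
  by (intro eventually_ball_finite) auto

text \<open>The bilinear sum vanishes on pairs of indices of the same kind, so that only the first-order
  change of each exchange polynomial along the frozen coordinates enters the bracket of two mutated
  coordinates.\<close>

lemma poisson_map_half_step:
  assumes S: "S \<subseteq> {1..n}"
    and \<Phi>: "\<And>x i. i \<in> {1..n} \<Longrightarrow> \<Phi> x i = (if i \<in> S then F i x / x i else x i)"
    and poly: "\<And>i. i \<in> S \<Longrightarrow> polynomial_fun n (F i)"
    and nz: "\<And>i. i \<in> S \<Longrightarrow> \<exists>x. F i x \<noteq> 0"
    and frozen: "\<And>i x y. i \<in> S \<Longrightarrow> (\<And>j. j \<in> {1..n} - S \<Longrightarrow> x j = y j) \<Longrightarrow> F i x = F i y"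
    and skew: "\<And>i j. i \<in> {1..n} \<Longrightarrow> j \<in> {1..n} \<Longrightarrow> C j i = - C i j"
    and C0: "\<And>i j. i \<in> {1..n} \<Longrightarrow> j \<in> {1..n} \<Longrightarrow> (i \<in> S \<longleftrightarrow> j \<in> S) \<Longrightarrow> C i j = 0"
    and sym: "\<And>i j x. i \<in> S \<Longrightarrow> j \<in> S \<Longrightarrow>
      F i x * (\<Sum>b=1..n. C i b * x b * partial_deriv b (F j) x) =
      F j x * (\<Sum>b=1..n. C j b * x b * partial_deriv b (F i) x)"
  shows "poisson_map n C (- 1) \<Phi>"
proof -
  have regF: "reg n x (F i)" if "i \<in> S" for i x using poly[OF that] by (rule reg_polynomial)
  have reg: "reg n x (\<lambda>y. \<Phi> y i)" if "\<forall>i\<in>{1..n}. x i \<noteq> 0" "i \<in> {1..n}" for x i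
    using that regF S by (cases "i \<in> S") (auto simp: \<Phi> intro!: reg_divide reg_coord)
  have Fnz: "\<forall>\<^sub>F x in gen n. \<forall>i\<in>S. F i x \<noteq> 0"
    using nz eventually_gen_nonzero[OF poly] finite_subset[OF S] by (intro eventually_ball_finite) blast+
  have "\<forall>\<^sub>F x in gen n. (\<forall>i\<in>{1..n}. reg n (\<Phi> x) (\<lambda>y. \<Phi> y i)) \<and> (\<forall>i\<in>{1..n}. \<Phi> (\<Phi> x) i = x i)"
    using Fnz eventually_coords_nonzero
  proof eventually_elim
    case (elim x)
    have "\<forall>i\<in>{1..n}. \<Phi> x i \<noteq> 0" using elim by (auto simp: \<Phi>)
    moreover have "\<Phi> (\<Phi> x) i = x i" if "i \<in> {1..n}" for i
    proof (cases "i \<in> S")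
      case True
      have "F i (\<Phi> x) = F i x" by (rule frozen[OF True]) (simp add: \<Phi>)
      then show ?thesis using True that elim by (simp add: \<Phi>)
    qed (simp add: \<Phi>[OF that])
    ultimately show ?case using reg by blast
  qed
  then have lim: "filterlim \<Phi> (gen n) (gen n)" by (rule filterlim_gen_involution)
  have pF0: "partial_deriv a (F i) x = 0" if "i \<in> S" "a \<in> S" for i a x
  proof (rule partial_deriv_eqI)
    have "(\<lambda>t. F i (x(a := t))) = (\<lambda>t. F i x)"
      using that by (intro ext frozen) auto
    then show "((\<lambda>t. F i (x(a := t))) has_field_derivative 0) (at (x a))" by simp
  qed
  have br: "poisson_bracket n C (\<lambda>y. \<Phi> y i) (\<lambda>y. \<Phi> y j) x = - 1 * C i j * \<Phi> x i * \<Phi> x j"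
    if x: "\<forall>i\<in>{1..n}. x i \<noteq> 0" and ij: "i \<in> {1..n}" "j \<in> {1..n}" for x i j
  proof -
    \<comment> \<open>The bracket is the bilinear form \<open>C\<close> applied to the rows of
      \<open>T\<close>. The row of a frozen index is supported at that index. The row of a mutated
      \<open>i\<close> splits into \<open>u i / x i\<close>, supported on frozen indices, and the
      entry \<open>- \<Phi> x i\<close> at \<open>i\<close> itself.\<close>
    define u where "u i a = x a * partial_deriv a (F i) x" for i a
    define T where "T i a = x a * partial_deriv a (\<lambda>y. \<Phi> y i) x" for i a
    have T0: "T i a = (if a = i then x i else 0)" if "i \<in> {1..n} - S" for i a
      using that by (auto simp: T_def \<Phi>)
    have T1: "T i a = u i a / x i - (if a = i then \<Phi> x i else 0)" if "i \<in> S" "a \<in> {1..n}" for i a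
    proof -
      have "i \<in> {1..n}" using that S by auto
      then have eq: "T i a = x a * ((partial_deriv a (F i) x * x i - F i x * (if i = a then 1 else 0)) / (x i * x i))"
        using that x by (simp add: T_def \<Phi> partial_deriv_divide[where n = n] regF reg_coord)
      have "x i \<noteq> 0" using x \<open>i \<in> {1..n}\<close> by blast
      then show ?thesis
        unfolding eq using that \<open>i \<in> {1..n}\<close> by (cases "a = i") (simp_all add: u_def \<Phi> field_simps)
    qed
    have u0: "u i a = 0" if "i \<in> S" "a \<in> S" for i a
      by (simp add: u_def pF0 that)
    have "poisson_bracket n C (\<lambda>y. \<Phi> y i) (\<lambda>y. \<Phi> y j) x = (\<Sum>a=1..n. \<Sum>b=1..n. C a b * T i a * T j b)"
      unfolding poisson_bracket_def T_def by (simp add: mult_ac)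
    also have "\<dots> = - 1 * C i j * \<Phi> x i * \<Phi> x j"
    proof -
      consider "i \<notin> S" "j \<notin> S" | "i \<in> S" "j \<notin> S" | "i \<notin> S" "j \<in> S" | "i \<in> S" "j \<in> S" by blast
      then show ?thesis
      proof cases
        case 1
        then show ?thesis using ij C0[of i j] by (simp add: T0 if_distrib[of "(*) _"] sum.delta cong: if_cong)
      next
        case 2
        have "(\<Sum>a=1..n. \<Sum>b=1..n. C a b * T i a * T j b) = (\<Sum>a=1..n. C a j * T i a * x j)"
          using 2 ij by (simp add: T0 if_distrib[of "(*) _"] sum.delta cong: if_cong)
        also have "\<dots> = (\<Sum>a=1..n. if a = i then - C i j * \<Phi> x i * x j else 0)"
        proof (rule sum.cong)
          fix a assume a: "a \<in> {1..n}"
          show "C a j * T i a * x j = (if a = i then - C i j * \<Phi> x i * x j else 0)"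
            using 2 a ij C0[of a j] by (cases "a \<in> S") (auto simp: T1 u0)
        qed simp
        also have "\<dots> = - 1 * C i j * \<Phi> x i * \<Phi> x j" using ij 2 by (simp add: \<Phi>)
        finally show ?thesis .
      next
        case 3
        have "(\<Sum>a=1..n. \<Sum>b=1..n. C a b * T i a * T j b) = (\<Sum>b=1..n. \<Sum>a=1..n. C a b * T i a * T j b)"
          by (rule sum.swap)
        also have "\<dots> = (\<Sum>b=1..n. C i b * x i * T j b)"
          using 3 ij by (simp add: T0 if_distrib[of "(*) _"] if_distrib[of "\<lambda>z. z * _"] sum.delta cong: if_cong)
        also have "\<dots> = (\<Sum>b=1..n. if b = j then - C i j * x i * \<Phi> x j else 0)"
        proof (rule sum.cong)
          fix b assume b: "b \<in> {1..n}"
          show "C i b * x i * T j b = (if b = j then - C i j * x i * \<Phi> x j else 0)"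
            using 3 b ij C0[of i b] by (cases "b \<in> S") (auto simp: T1 u0)
        qed simp
        also have "\<dots> = - 1 * C i j * \<Phi> x i * \<Phi> x j" using ij 3 by (simp add: \<Phi>)
        finally show ?thesis .
      next
        \<comment> \<open>Since \<open>C\<close> pairs only mutated with frozen indices, just the
          two cross terms survive. Over the common denominator \<open>x i * x j\<close> they are the
          difference of the two sides of \<open>sym\<close>.\<close>
        case 4
        have xn: "x i \<noteq> 0" "x j \<noteq> 0" using x ij by auto
        have "(\<Sum>a=1..n. \<Sum>b=1..n. C a b * T i a * T j b) =
          (\<Sum>a=1..n. \<Sum>b=1..n. (if a = i then - C i b * \<Phi> x i * u j b / x j else 0) +
             (if b = j then - C a j * \<Phi> x j * u i a / x i else 0))"
        proof (intro sum.cong refl)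
          fix a b assume ab: "a \<in> {1..n}" "b \<in> {1..n}"
          show "C a b * T i a * T j b = (if a = i then - C i b * \<Phi> x i * u j b / x j else 0) +
             (if b = j then - C a j * \<Phi> x j * u i a / x i else 0)"
            using 4 ab C0[of a b] u0[of i a] u0[of j b]
            by (cases "a \<in> S"; cases "b \<in> S") (auto simp: T1)
        qed
        also have "\<dots> = (\<Sum>b=1..n. - C i b * \<Phi> x i * u j b / x j) + (\<Sum>a=1..n. - C a j * \<Phi> x j * u i a / x i)"
        proof -
          have "(\<Sum>a=1..n. \<Sum>b=1..n. if a = i then - C i b * \<Phi> x i * u j b / x j else 0) =
            (\<Sum>b=1..n. \<Sum>a=1..n. if a = i then - C i b * \<Phi> x i * u j b / x j else 0)"
            by (rule sum.swap)
          also have "\<dots> = (\<Sum>b=1..n. - C i b * \<Phi> x i * u j b / x j)" using ij by simp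
          finally have e1: "(\<Sum>a=1..n. \<Sum>b=1..n. if a = i then - C i b * \<Phi> x i * u j b / x j else 0) =
            (\<Sum>b=1..n. - C i b * \<Phi> x i * u j b / x j)" .
          have e2: "(\<Sum>a=1..n. \<Sum>b=1..n. if b = j then - C a j * \<Phi> x j * u i a / x i else 0) =
            (\<Sum>a=1..n. - C a j * \<Phi> x j * u i a / x i)" using ij by simp
          show ?thesis by (simp only: sum.distrib e1 e2)
        qed
        also have "(\<Sum>a=1..n. - C a j * \<Phi> x j * u i a / x i) = (\<Sum>a=1..n. C j a * \<Phi> x j * u i a / x i)"
        proof (rule sum.cong)
          fix a assume "a \<in> {1..n}"
          then have "C j a = - C a j" using ij skew by blast
          then show "- C a j * \<Phi> x j * u i a / x i = C j a * \<Phi> x j * u i a / x i" by simp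
        qed simp
        also have "(\<Sum>b=1..n. - C i b * \<Phi> x i * u j b / x j) + (\<Sum>a=1..n. C j a * \<Phi> x j * u i a / x i) =
          (F j x * (\<Sum>b=1..n. C j b * x b * partial_deriv b (F i) x) -
           F i x * (\<Sum>b=1..n. C i b * x b * partial_deriv b (F j) x)) / (x i * x j)"
          using 4 ij xn by (simp add: \<Phi> u_def sum_distrib_left sum_subtractf[symmetric] sum_divide_distrib
              sum.distrib[symmetric] field_simps)
        also have "\<dots> = 0" using sym[of i j x] 4 by simp
        finally show ?thesis using C0[of i j] 4 ij by simp
      qed
    qed
    finally show ?thesis .
  qed
  show ?thesis
    unfolding poisson_map_def
    using lim reg br by (auto intro!: eventually_mono[OF eventually_coords_nonzero])
qed

text \<open>With M the logarithmic Jacobian, preservation of the bracket reads M C M^T = C.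
  Multiplying by B, the inverse of C, exhibits C M^T B as a right inverse of M, hence as a left
  inverse because M is square; multiplying C M^T B M = 1 by B from the left gives M^T B M =
  B.\<close>

lemma poisson_map_symplectic:
  assumes pm: "poisson_map n C 1 \<Phi>" and inv: "inverse_on n B C"
  shows "symplectic_map n B \<Phi>"
proof -
  have "\<forall>\<^sub>F x in gen n. \<forall>i\<in>{1..n}. \<forall>j\<in>{1..n}.
      poisson_bracket n C (\<lambda>y. \<Phi> y i) (\<lambda>y. \<Phi> y j) x = C i j * \<Phi> x i * \<Phi> x j"
    using pm by (simp add: poisson_map_def)
  moreover note eventually_coords_nonzero[of n] eventually_poisson_map[OF pm eventually_coords_nonzero]
  ultimately have "\<forall>\<^sub>F x in gen n. \<forall>k\<in>{1..n}. \<forall>l\<in>{1..n}.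
       (\<Sum>i=1..n. \<Sum>j=1..n. B i j / (\<Phi> x i * \<Phi> x j) *
          partial_deriv k (\<lambda>y. \<Phi> y i) x * partial_deriv l (\<lambda>y. \<Phi> y j) x)
       = B k l / (x k * x l)"
  proof eventually_elim
    case (elim x)
    \<comment> \<open>In logarithmic coordinates the log-canonical bracket and form have the
      constant matrices \<open>C\<close> and \<open>B\<close>, so the claim becomes matrix algebra
      at the single point \<open>x\<close>.\<close>
    define M where "M i k = x k * partial_deriv k (\<lambda>y. \<Phi> y i) x / \<Phi> x i" for i k
    define M' B' C' where "M' = mat n n (\<lambda>(i, k). M (Suc i) (Suc k))"
      and "B' = mat n n (\<lambda>(i, k). B (Suc i) (Suc k))" and "C' = mat n n (\<lambda>(i, k). C (Suc i) (Suc k))"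
    have [simp]: "M' \<in> carrier_mat n n" "B' \<in> carrier_mat n n" "C' \<in> carrier_mat n n"
      by (simp_all add: M'_def B'_def C'_def)
    have shift: "(\<Sum>k=1..n. f k) = (\<Sum>k=0..<n. f (Suc k))" for f :: "nat \<Rightarrow> complex"
      by (simp add: sum.atLeast1_atMost_eq lessThan_atLeast0)
    have BC: "B' * C' = 1\<^sub>m n" "C' * B' = 1\<^sub>m n"
      using inv unfolding inverse_on_def shift
      by (auto intro!: eq_matI simp: B'_def C'_def scalar_prod_def)
    have MCM: "(\<Sum>a=1..n. \<Sum>b=1..n. C a b * M i a * M j b) = C i j" if "i \<in> {1..n}" "j \<in> {1..n}" for i j
    proof -
      have "\<Phi> x i \<noteq> 0" "\<Phi> x j \<noteq> 0" using elim that by blast+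
      moreover have "(\<Sum>a=1..n. \<Sum>b=1..n. C a b * M i a * M j b) =
          poisson_bracket n C (\<lambda>y. \<Phi> y i) (\<lambda>y. \<Phi> y j) x / (\<Phi> x i * \<Phi> x j)"
        unfolding poisson_bracket_def M_def by (simp add: sum_divide_distrib mult_ac)
      ultimately show ?thesis using elim that by simp
    qed
    have "M' * (C' * transpose_mat M') = C'"
    proof (rule eq_matI)
      fix i j assume "i < dim_row C'" "j < dim_col C'"
      then have ij: "i < n" "j < n" by (auto simp: C'_def)
      then have "(M' * (C' * transpose_mat M')) $$ (i, j) =
        (\<Sum>a=0..<n. \<Sum>b=0..<n. C (Suc a) (Suc b) * M (Suc i) (Suc a) * M (Suc j) (Suc b))"
        by (simp add: M'_def C'_def scalar_prod_def sum_distrib_left sum_distrib_right mult_ac)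
      also have "\<dots> = C (Suc i) (Suc j)" using MCM[of "Suc i" "Suc j", unfolded shift] ij by simp
      finally show "(M' * (C' * transpose_mat M')) $$ (i, j) = C' $$ (i, j)" using ij by (simp add: C'_def)
    qed (simp_all add: M'_def C'_def)
    moreover have "M' * (C' * transpose_mat M' * B') = M' * (C' * transpose_mat M') * B'"
      by (rule assoc_mult_mat[symmetric, of _ n n _ n _ n]) (auto intro!: mult_carrier_mat[of _ n n])
    ultimately have "M' * (C' * transpose_mat M' * B') = 1\<^sub>m n" using BC by simp
    then have "(C' * transpose_mat M' * B') * M' = 1\<^sub>m n"
      by (rule mat_mult_left_right_inverse[of M' n, rotated 2]) (auto intro!: mult_carrier_mat[of _ n n])
    then have "B' * ((C' * transpose_mat M' * B') * M') = B'" by (simp add: right_mult_one_mat[of B' n n])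
    moreover have "B' * ((C' * transpose_mat M' * B') * M') = (B' * C') * (transpose_mat M' * (B' * M'))"
      by (simp add: assoc_mult_mat[of _ n n _ n _ n] mult_carrier_mat[of _ n n _ n])
    ultimately have MBM: "transpose_mat M' * (B' * M') = B'"
      using BC left_mult_one_mat[of "transpose_mat M' * (B' * M')" n n]
      by (simp add: mult_carrier_mat[of _ n n _ n])
    show ?case
    proof (intro ballI)
      fix k l assume kl: "k \<in> {1..n}" "l \<in> {1..n}"
      define k' l' where "k' = k - 1" and "l' = l - 1"
      have k': "k = Suc k'" "l = Suc l'" "k' < n" "l' < n" using kl by (auto simp: k'_def l'_def)
      have xn: "x k \<noteq> 0" "x l \<noteq> 0" using elim kl by blast+
      have "(transpose_mat M' * (B' * M')) $$ (k', l') = (\<Sum>i=1..n. \<Sum>j=1..n. B i j * M i k * M j l)"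
        using k' unfolding shift by (simp add: M'_def B'_def scalar_prod_def sum_distrib_left sum_distrib_right mult_ac)
      then have "(\<Sum>i=1..n. \<Sum>j=1..n. B i j * M i k * M j l) = B k l"
        unfolding MBM using k' by (simp add: B'_def)
      moreover have "(\<Sum>i=1..n. \<Sum>j=1..n. B i j * M i k * M j l) = x k * x l *
          (\<Sum>i=1..n. \<Sum>j=1..n. B i j / (\<Phi> x i * \<Phi> x j) *
          partial_deriv k (\<lambda>y. \<Phi> y i) x * partial_deriv l (\<lambda>y. \<Phi> y j) x)"
        unfolding M_def by (simp add: sum_distrib_left mult_ac)
      ultimately show "(\<Sum>i=1..n. \<Sum>j=1..n. B i j / (\<Phi> x i * \<Phi> x j) *
          partial_deriv k (\<lambda>y. \<Phi> y i) x * partial_deriv l (\<lambda>y. \<Phi> y j) x) = B k l / (x k * x l)"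
        using xn by (simp add: field_simps)
    qed
  qed
  then show ?thesis unfolding symplectic_map_def eventually_gen[symmetric] .
qed

section \<open>Integrability criteria\<close>

lemma reg_det:
  assumes "\<And>i j. i < m \<Longrightarrow> j < m \<Longrightarrow> reg n a (A i j)"
  shows "reg n a (\<lambda>x. det (mat m m (\<lambda>(i, j). A i j x)))"
proof -
  have "det (mat m m (\<lambda>(i, j). A i j x)) =
    (\<Sum>p\<in>{p. p permutes {0..<m}}. signof p * (\<Prod>i=0..<m. A i (p i) x))" for x
    by (subst det_def'[of _ m]) (auto intro!: sum.cong prod.cong simp: permutes_in_image)
  moreover have "reg n a (\<lambda>x. \<Sum>p\<in>{p. p permutes {0..<m}}. signof p * (\<Prod>i=0..<m. A i (p i) x))"
    using assms by (intro reg_sum reg_mult reg_const reg_prod) (auto simp: permutes_in_image dest: permutes_in_image)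
  ultimately show ?thesis by simp
qed

lemma det_nonzero_iff_injective:
  fixes A :: "nat \<Rightarrow> nat \<Rightarrow> complex"
  shows "det (mat m m (\<lambda>(l, i). A (Suc l) (Suc i))) \<noteq> 0 \<longleftrightarrow>
    (\<forall>c. (\<forall>l\<in>{1..m}. (\<Sum>i=1..m. c i * A l i) = 0) \<longrightarrow> (\<forall>i\<in>{1..m}. c i = 0))"
proof -
  let ?M = "mat m m (\<lambda>(l, i). A (Suc l) (Suc i))"
  have shift: "(\<Sum>k=1..m. f k) = (\<Sum>k=0..<m. f (Suc k))" for f :: "nat \<Rightarrow> complex"
    by (simp add: sum.atLeast1_atMost_eq lessThan_atLeast0)
  have all: "(\<forall>l\<in>{1..m}. P l) \<longleftrightarrow> (\<forall>l<m. P (Suc l))" for P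
  proof -
    have "{1..m} = Suc ` {..<m}" by (simp only: One_nat_def image_Suc_lessThan)
    then show ?thesis by (simp only: ball_simps) blast
  qed
  have mv: "?M *\<^sub>v vec m v = 0\<^sub>v m \<longleftrightarrow> (\<forall>l\<in>{1..m}. (\<Sum>i=1..m. v (i - 1) * A l i) = 0)" for v
  proof -
    have "?M *\<^sub>v vec m v = 0\<^sub>v m \<longleftrightarrow> (\<forall>l<m. (\<Sum>i=0..<m. A (Suc l) (Suc i) * v i) = 0)"
      by (auto simp: vec_eq_iff scalar_prod_def)
    also have "\<dots> \<longleftrightarrow> (\<forall>l\<in>{1..m}. (\<Sum>i=1..m. v (i - 1) * A l i) = 0)"
      unfolding all shift by (simp add: mult.commute)
    finally show ?thesis .
  qed
  have "det ?M = 0 \<longleftrightarrow> (\<exists>v. v \<in> carrier_vec m \<and> v \<noteq> 0\<^sub>v m \<and> ?M *\<^sub>v v = 0\<^sub>v m)"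
    by (rule det_0_iff_vec_prod_zero_field) simp
  also have "\<dots> \<longleftrightarrow> (\<exists>v. vec m v \<noteq> 0\<^sub>v m \<and> ?M *\<^sub>v vec m v = 0\<^sub>v m)"
  proof (intro iffI; elim exE conjE)
    fix v :: "complex vec" assume "v \<in> carrier_vec m" "v \<noteq> 0\<^sub>v m" "?M *\<^sub>v v = 0\<^sub>v m"
    moreover from this have "v = vec m (($) v)" by auto
    ultimately show "\<exists>v. vec m v \<noteq> 0\<^sub>v m \<and> ?M *\<^sub>v vec m v = 0\<^sub>v m" by metis
  qed (use vec_carrier in blast)
  also have "\<dots> \<longleftrightarrow> (\<exists>v. (\<exists>i<m. v i \<noteq> 0) \<and> (\<forall>l\<in>{1..m}. (\<Sum>i=1..m. v (i - 1) * A l i) = 0))"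
    unfolding mv by (auto simp: vec_eq_iff)
  also have "\<dots> \<longleftrightarrow> (\<exists>c. (\<exists>i\<in>{1..m}. c i \<noteq> 0) \<and> (\<forall>l\<in>{1..m}. (\<Sum>i=1..m. c i * A l i) = 0))"
  proof (intro iffI; elim exE conjE bexE)
    fix v i assume "i < m" "v i \<noteq> 0" "\<forall>l\<in>{1..m}. (\<Sum>i=1..m. v (i - 1) * A l i) = 0"
    then show "\<exists>c. (\<exists>i\<in>{1..m}. c i \<noteq> 0) \<and> (\<forall>l\<in>{1..m}. (\<Sum>i=1..m. c i * A l i) = 0)"
      by (intro exI[of _ "\<lambda>i. v (i - 1)"] conjI bexI[of _ "Suc i"]) auto
  next
    fix c i assume "i \<in> {1..m}" "c i \<noteq> 0" "\<forall>l\<in>{1..m}. (\<Sum>i=1..m. c i * A l i) = 0"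
    moreover from this have "i - 1 < m" "c (Suc (i - 1)) \<noteq> 0" by auto
    ultimately show "\<exists>v. (\<exists>i<m. v i \<noteq> 0) \<and> (\<forall>l\<in>{1..m}. (\<Sum>i=1..m. v (i - 1) * A l i) = 0)"
      by (intro exI[of _ "\<lambda>i. c (Suc i)"]) (auto cong: sum.cong_simp)
  qed
  finally show ?thesis by blast
qed

text \<open>An m by m minor of the Jacobian, with rows selected by \<open>\<kappa>\<close>, is a
  regular function. Injectivity at the one point \<open>a\<close> says that it is nonzero there,
  hence generically.\<close>

lemma functionally_independentI:
  assumes reg: "\<And>i. i \<in> {1..m} \<Longrightarrow> reg n a (F i)" and \<kappa>: "\<And>l. l \<in> {1..m} \<Longrightarrow> \<kappa> l \<in> {1..n}"
    and inj: "\<And>c. (\<And>l. l \<in> {1..m} \<Longrightarrow> (\<Sum>i=1..m. c i * partial_deriv (\<kappa> l) (F i) a) = 0) \<Longrightarrow>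
      (\<forall>i\<in>{1..m}. c i = 0)"
  shows "functionally_independent n m F"
proof -
  define A where "A x l i = partial_deriv (\<kappa> l) (F i) x" for x l i
  have "reg n a (\<lambda>x. det (mat m m (\<lambda>(l, i). A x (Suc l) (Suc i))))"
    unfolding A_def using reg by (intro reg_det reg_partial_deriv) auto
  moreover have "det (mat m m (\<lambda>(l, i). A a (Suc l) (Suc i))) \<noteq> 0"
    unfolding det_nonzero_iff_injective using inj unfolding A_def by blast
  ultimately have "\<forall>\<^sub>F x in gen n. det (mat m m (\<lambda>(l, i). A x (Suc l) (Suc i))) \<noteq> 0"
    by (rule reg_eventually_nonzero)
  then have "\<forall>\<^sub>F x in gen n. \<forall>c. (\<forall>k\<in>{1..n}. (\<Sum>i=1..m. c i * partial_deriv k (F i) x) = 0) \<longrightarrow>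
    (\<forall>i\<in>{1..m}. c i = 0)"
  proof (rule eventually_mono)
    fix x assume "det (mat m m (\<lambda>(l, i). A x (Suc l) (Suc i))) \<noteq> 0"
    then show "\<forall>c. (\<forall>k\<in>{1..n}. (\<Sum>i=1..m. c i * partial_deriv k (F i) x) = 0) \<longrightarrow> (\<forall>i\<in>{1..m}. c i = 0)"
      unfolding det_nonzero_iff_injective using \<kappa> by (simp only: A_def) blast
  qed
  then show ?thesis unfolding functionally_independent_def eventually_gen[symmetric] .
qed

text \<open>The functions \<open>I i\<close> are only regular near a point, because a sum of
  quotients need not be a quotient at its poles; they are replaced by genuine quotients
  \<open>J i\<close> that agree generically, and so do the derivatives. Nonconstancy follows from
  independence, since a generically constant function has zero differential.\<close>

lemma completely_integrableI:
  assumes sk: "skew_on (2 * m) B" and inv: "inverse_on (2 * m) B C"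
    and pm: "poisson_map (2 * m) C 1 \<Phi>"
    and reg: "\<And>i. i \<in> {1..m} \<Longrightarrow> reg (2 * m) a (I i)"
    and invariant: "\<And>i. i \<in> {1..m} \<Longrightarrow> \<forall>\<^sub>F x in gen (2 * m). I i (\<Phi> x) = I i x"
    and indep: "functionally_independent (2 * m) m I"
    and invol: "\<And>i j. i \<in> {1..m} \<Longrightarrow> j \<in> {1..m} \<Longrightarrow>
      \<forall>\<^sub>F x in gen (2 * m). poisson_bracket (2 * m) C (I i) (I j) x = 0"
  shows "completely_integrable m B \<Phi>"
proof -
  let ?n = "2 * m"
  have "\<forall>i\<in>{1..m}. \<exists>g. rational_fun ?n g \<and> (\<forall>\<^sub>F x in gen ?n. I i x = g x)"
    using reg reg_rational_fun by metis
  then obtain J where J: "\<And>i. i \<in> {1..m} \<Longrightarrow> rational_fun ?n (J i)"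
    "\<And>i. i \<in> {1..m} \<Longrightarrow> \<forall>\<^sub>F x in gen ?n. I i x = J i x"
    by metis
  have D: "\<forall>\<^sub>F x in gen ?n. \<forall>i\<in>{1..m}. \<forall>k. partial_deriv k (I i) x = partial_deriv k (J i) x"
    using eventually_partial_deriv_cong[OF J(2)] by (intro eventually_ball_finite) auto
  have ind: "\<forall>\<^sub>F x in gen ?n. \<forall>c. (\<forall>k\<in>{1..?n}. (\<Sum>i=1..m. c i * partial_deriv k (J i) x) = 0) \<longrightarrow>
      (\<forall>i\<in>{1..m}. c i = 0)"
    using D indep[unfolded functionally_independent_def eventually_gen[symmetric]]
    by eventually_elim simp
  have fi: "first_integral ?n \<Phi> (J i)" if i: "i \<in> {1..m}" for i
    unfolding first_integral_def eventually_gen[symmetric]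
  proof (intro conjI notI)
    show "\<forall>\<^sub>F x in gen ?n. J i (\<Phi> x) = J i x"
      using J(2)[OF i] eventually_poisson_map[OF pm J(2)[OF i]] invariant[OF i]
      by eventually_elim simp
    assume "\<exists>c. \<forall>\<^sub>F x in gen ?n. J i x = c"
    then obtain c where "\<forall>\<^sub>F x in gen ?n. J i x = c" by blast
    from eventually_partial_deriv_cong[OF this] ind
    have "\<forall>\<^sub>F x in gen ?n. False"
    proof eventually_elim
      case (elim x)
      have "\<forall>k\<in>{1..?n}. (\<Sum>j=1..m. (if j = i then 1 else 0) * partial_deriv k (J j) x) = 0"
        using elim i by (auto intro!: sum.neutral)
      then have "\<forall>j\<in>{1..m}. (if j = i then 1 else 0) = (0 :: complex)"
        using elim(2)[rule_format, of "\<lambda>j. if j = i then 1 else 0"] by blast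
      then show False using i by force
    qed
    then show False using eventually_gen_ex by blast
  qed (rule J(1)[OF i])
  have br: "\<forall>\<^sub>F x in gen ?n. poisson_bracket ?n C (J i) (J j) x = 0"
    if "i \<in> {1..m}" "j \<in> {1..m}" for i j
    using D invol[OF that] by eventually_elim (use that in \<open>simp add: poisson_bracket_def\<close>)
  show ?thesis
    unfolding completely_integrable_def functionally_independent_def eventually_gen[symmetric]
    by (intro conjI exI[of _ C] exI[of _ J] ballI sk inv poisson_map_symplectic[OF pm inv] ind fi br)
qed

section \<open>The Poisson algebra of a tube\<close>

text \<open>The model is an odd cycle with edge set \<open>E\<close>. As \<open>j\<close> runs round
  the cycle starting next to \<open>i\<close>, the sign \<open>s i j\<close> alternates, beginning
  with 1 at the neighbour \<open>q\<close> and ending with -1 at the neighbour \<open>p\<close>.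
  Thus every edge away from \<open>i\<close> has sign sum zero, and so has the whole cycle, because
  the number of other vertices is even.\<close>

locale tube =
  fixes V :: "nat set" and E :: "nat set set" and s :: "nat \<Rightarrow> nat \<Rightarrow> complex"
  assumes finite_V: "finite V"
    and edge: "e \<in> E \<Longrightarrow> \<exists>i\<in>V. \<exists>j\<in>V. i \<noteq> j \<and> e = {i, j}"
    and skew: "i \<in> V \<Longrightarrow> j \<in> V \<Longrightarrow> s j i = - s i j"
    and cancel: "{j, k} \<in> E \<Longrightarrow> i \<in> V \<Longrightarrow> i \<notin> {j, k} \<Longrightarrow> j \<noteq> k \<Longrightarrow> s i j + s i k = 0"
    and total: "i \<in> V \<Longrightarrow> (\<Sum>j\<in>V. s i j) = 0"
    and neighbours: "i \<in> V \<Longrightarrow> \<exists>p\<in>V. \<exists>q\<in>V. p \<noteq> q \<and> p \<noteq> i \<and> q \<noteq> i \<and>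
      (\<forall>j. {i, j} \<in> E \<longleftrightarrow> j = p \<or> j = q) \<and> s i p = - 1 \<and> s i q = 1"
begin

definition matchings :: "nat \<Rightarrow> nat set set set" where
  "matchings k = {S. S \<subseteq> E \<and> card S = k \<and> pairwise disjnt S}"

text \<open>On a cycle this is, up to the sign \<open>(-1)^k\<close>, the part of degree
  \<open>card V - 2 * k\<close> of the trace of the product around the cycle of the matrices with
  rows (J i, -1) and (1, 0).\<close>

definition matching_sum :: "nat \<Rightarrow> (nat \<Rightarrow> complex) \<Rightarrow> complex" where
  "matching_sum k J = (\<Sum>S\<in>matchings k. \<Prod>j\<in>V - \<Union>S. J j)"

text \<open>The derivative of \<open>matching_sum k\<close> by \<open>J j\<close>, written
  combinatorially so that the recursion becomes an identity between sums over matchings;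
  \<open>partial_deriv_matching_sum\<close> makes the identification.\<close>

definition d_matching_sum :: "nat \<Rightarrow> nat \<Rightarrow> (nat \<Rightarrow> complex) \<Rightarrow> complex" where
  "d_matching_sum k j J = (\<Sum>S\<in>{S \<in> matchings k. j \<notin> \<Union>S}. \<Prod>i\<in>V - \<Union>S - {j}. J i)"

lemma edge_subset: "e \<in> E \<Longrightarrow> e \<subseteq> V"
  using edge by blast

lemma finite_E: "finite E"
  by (rule finite_subset[of _ "Set.Pow V"]) (use edge_subset finite_V in auto)

lemma finite_matchings [simp]: "finite (matchings k)"
  by (rule finite_subset[of _ "Set.Pow E"]) (auto simp: matchings_def finite_E)

lemma sign_refl: "i \<in> V \<Longrightarrow> s i i = 0"
  using skew[of i i] by simp

text \<open>Each monomial is an eigenvector of the logarithmic operator, with eigenvalue the sum of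
  \<open>s i j\<close> over the vertices left uncovered. By \<open>total\<close> this is minus the
  sum over covered vertices, where every edge not containing \<open>i\<close> cancels. An edge at
  \<open>i\<close> leaves 1 for \<open>p\<close> and -1 for \<open>q\<close>.\<close>

lemma log_part:
  assumes i: "i \<in> V" and p: "p \<noteq> i" "{i, p} \<in> E" "s i p = - 1" and q: "q \<noteq> i" "{i, q} \<in> E" "s i q = 1"
    and pq: "\<forall>j. {i, j} \<in> E \<longrightarrow> j = p \<or> j = q"
  shows "(\<Sum>j\<in>V. s i j * J j * d_matching_sum k j J) =
    (\<Sum>S\<in>{S \<in> matchings k. {i, p} \<in> S}. \<Prod>j\<in>V - \<Union>S. J j) -
    (\<Sum>S\<in>{S \<in> matchings k. {i, q} \<in> S}. \<Prod>j\<in>V - \<Union>S. J j)"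
proof -
  let ?w = "\<lambda>S. \<Prod>j\<in>V - \<Union>S. J j"
  have "(\<Sum>j\<in>V. s i j * J j * d_matching_sum k j J) =
    (\<Sum>j\<in>V. \<Sum>S\<in>matchings k. if j \<notin> \<Union>S then s i j * ?w S else 0)"
  proof (rule sum.cong)
    fix j assume j: "j \<in> V"
    have "s i j * J j * d_matching_sum k j J = (\<Sum>S\<in>{S \<in> matchings k. j \<notin> \<Union>S}. s i j * ?w S)"
      unfolding d_matching_sum_def sum_distrib_left
    proof (rule sum.cong)
      fix S assume "S \<in> {S \<in> matchings k. j \<notin> \<Union>S}"
      then have "?w S = J j * (\<Prod>i\<in>V - \<Union>S - {j}. J i)"
        using j finite_V by (intro prod.remove) auto
      then show "s i j * J j * (\<Prod>i\<in>V - \<Union>S - {j}. J i) = s i j * ?w S" by simp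
    qed simp
    then show "s i j * J j * d_matching_sum k j J = (\<Sum>S\<in>matchings k. if j \<notin> \<Union>S then s i j * ?w S else 0)"
      by (simp only: sum.inter_filter[OF finite_matchings])
  qed simp
  also have "\<dots> = (\<Sum>S\<in>matchings k. \<Sum>j\<in>V. if j \<notin> \<Union>S then s i j * ?w S else 0)"
    by (rule sum.swap)
  also have "\<dots> = (\<Sum>S\<in>matchings k. (if {i, p} \<in> S then ?w S else 0) - (if {i, q} \<in> S then ?w S else 0))"
  proof (rule sum.cong)
    fix S assume S: "S \<in> matchings k"
    then have SE: "S \<subseteq> E" and dis: "pairwise disjnt S" by (auto simp: matchings_def)
    have finS: "finite S" using SE finite_E finite_subset by blast
    have sub: "\<Union>S \<subseteq> V" using SE edge_subset by blast
    have "(\<Sum>j\<in>\<Union>S. s i j) = (\<Sum>e\<in>S. \<Sum>j\<in>e. s i j)"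
    proof (subst sum.Union_disjoint)
      show "\<forall>e\<in>S. finite e" using SE edge_subset finite_V finite_subset by blast
      show "\<forall>e\<in>S. \<forall>f\<in>S. e \<noteq> f \<longrightarrow> e \<inter> f = {}" using dis by (simp add: pairwise_def disjnt_def)
    qed simp
    also have "\<dots> = (\<Sum>e\<in>S. (if e = {i, q} then 1 else 0) - (if e = {i, p} then 1 else 0))"
    proof (rule sum.cong)
      fix e assume "e \<in> S"
      then have "e \<in> E" using SE by blast
      then obtain j l where e: "e = {j, l}" "j \<noteq> l" "j \<in> V" "l \<in> V" using edge by blast
      have ne: "{i, p} \<noteq> {i, q}" using p q by (auto simp: doubleton_eq_iff)
      show "(\<Sum>j\<in>e. s i j) = (if e = {i, q} then 1 else 0) - (if e = {i, p} then 1 else 0)"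
      proof (cases "i \<in> e")
        case False
        then have "s i j + s i l = 0" using cancel[of j l i] \<open>e \<in> E\<close> e i by auto
        then show ?thesis using False e by auto
      next
        case True
        then obtain r where "e = {i, r}" "r \<noteq> i" using e by auto
        moreover from this have "r = p \<or> r = q" using pq \<open>e \<in> E\<close> by blast
        ultimately show ?thesis using p q ne sign_refl[OF i] by auto
      qed
    qed simp
    also have "\<dots> = (if {i, q} \<in> S then 1 else 0) - (if {i, p} \<in> S then 1 else 0)"
      using finS by (simp add: sum_subtractf)
    finally have 1: "(\<Sum>j\<in>\<Union>S. s i j) = (if {i, q} \<in> S then 1 else 0) - (if {i, p} \<in> S then 1 else 0)" .
    have "(\<Sum>j\<in>V - \<Union>S. s i j) = (\<Sum>j\<in>V. s i j) - (\<Sum>j\<in>\<Union>S. s i j)"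
      by (rule sum_diff) (use finite_V sub in auto)
    then have 2: "(\<Sum>j\<in>V - \<Union>S. s i j) = (if {i, p} \<in> S then 1 else 0) - (if {i, q} \<in> S then 1 else 0)"
      using 1 total[OF i] by simp
    have "(\<Sum>j\<in>V. if j \<notin> \<Union>S then s i j * ?w S else 0) = (\<Sum>j\<in>{j \<in> V. j \<notin> \<Union>S}. s i j * ?w S)"
      by (rule sum.inter_filter[symmetric, OF finite_V])
    also have "{j \<in> V. j \<notin> \<Union>S} = V - \<Union>S" by blast
    also have "(\<Sum>j\<in>V - \<Union>S. s i j * ?w S) = (\<Sum>j\<in>V - \<Union>S. s i j) * ?w S"
      by (rule sum_distrib_right[symmetric])
    finally show "(\<Sum>j\<in>V. if j \<notin> \<Union>S then s i j * ?w S else 0) =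
      (if {i, p} \<in> S then ?w S else 0) - (if {i, q} \<in> S then ?w S else 0)"
      unfolding 2 by simp
  qed simp
  also have "\<dots> = (\<Sum>S\<in>{S \<in> matchings k. {i, p} \<in> S}. ?w S) - (\<Sum>S\<in>{S \<in> matchings k. {i, q} \<in> S}. ?w S)"
    by (simp only: sum_subtractf sum.inter_filter[OF finite_matchings])
  finally show ?thesis .
qed

text \<open>The empty matching uses no edge at \<open>i\<close>, so nothing is left: the product of
  all \<open>J i\<close> is a Casimir function of the logarithmic bracket. This starts the Lenard
  recursion.\<close>

lemma log_part_0: 
  assumes "i \<in> V" shows "(\<Sum>j\<in>V. s i j * J j * d_matching_sum 0 j J) = 0"
proof -
  obtain p q where *: "p \<in> V" "q \<in> V" "p \<noteq> q" "p \<noteq> i" "q \<noteq> i" "\<And>j. {i, j} \<in> E \<longleftrightarrow> j = p \<or> j = q"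
    "s i p = - 1" "s i q = 1"
    using neighbours[OF assms] by blast
  have "S = {}" if "S \<in> matchings 0" for S
    using that finite_subset[OF _ finite_E] by (auto simp: matchings_def)
  then have "{S \<in> matchings 0. e \<in> S} = {}" for e by blast
  then show ?thesis
    using log_part[of i p q J 0] * assms by (simp only: sum.empty diff_self) blast
qed

text \<open>Matchings avoiding \<open>q\<close> are sorted by whether \<open>i\<close> is covered.
  If \<open>i\<close> is free, the edge \<open>{i, q}\<close> can be added, and the uncovered
  \<open>i\<close> contributes the factor \<open>J i\<close>; otherwise \<open>i\<close> is matched
  to its other neighbour \<open>p\<close>.\<close>

lemma d_matching_sum_split:
  assumes i: "i \<in> V" and q: "q \<in> V" "q \<noteq> i" "{i, q} \<in> E"
    and pq: "p \<noteq> q" "\<forall>j. {i, j} \<in> E \<longrightarrow> j = p \<or> j = q"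
  shows "d_matching_sum k q J = J i * (\<Sum>S\<in>{S \<in> matchings (Suc k). {i, q} \<in> S}. \<Prod>j\<in>V - \<Union>S. J j) +
    (\<Sum>S\<in>{S \<in> matchings k. {i, p} \<in> S \<and> q \<notin> \<Union>S}. \<Prod>j\<in>V - \<Union>S - {q}. J j)"
proof -
  let ?A = "{S \<in> matchings k. i \<notin> \<Union>S \<and> q \<notin> \<Union>S}" and ?B = "{S \<in> matchings k. {i, p} \<in> S \<and> q \<notin> \<Union>S}"
  let ?f = "\<lambda>S. \<Prod>j\<in>V - \<Union>S - {q}. J j"
  have fin: "finite S" if "S \<in> matchings j" for S j
    using that finite_subset[OF _ finite_E] by (auto simp: matchings_def)
  have "{S \<in> matchings k. q \<notin> \<Union>S} = ?A \<union> ?B"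
  proof (intro equalityI subsetI)
    fix S assume S: "S \<in> {S \<in> matchings k. q \<notin> \<Union>S}"
    show "S \<in> ?A \<union> ?B"
    proof (cases "i \<in> \<Union>S")
      case True
      then obtain e where e: "e \<in> S" "i \<in> e" by blast
      then have "e \<in> E" using S by (auto simp: matchings_def)
      then obtain r where "e = {i, r}" using edge e by (metis insertE insert_commute singletonD)
      moreover from this have "r = p \<or> r = q" using pq \<open>e \<in> E\<close> by blast
      ultimately have "{i, p} \<in> S" using e S by blast
      then show ?thesis using S by blast
    qed (use S in blast)
  qed blast
  moreover have "?A \<inter> ?B = {}" by blast
  ultimately have "d_matching_sum k q J = (\<Sum>S\<in>?A. ?f S) + (\<Sum>S\<in>?B. ?f S)"
    unfolding d_matching_sum_def by (simp add: sum.union_disjoint)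
  also have "(\<Sum>S\<in>?A. ?f S) = (\<Sum>S\<in>?A. J i * (\<Prod>j\<in>V - \<Union>(insert {i, q} S). J j))"
  proof (rule sum.cong)
    fix S assume S: "S \<in> ?A"
    have "?f S = J i * (\<Prod>j\<in>V - \<Union>S - {q} - {i}. J j)"
      by (rule prod.remove) (use S finite_V i q in auto)
    also have "V - \<Union>S - {q} - {i} = V - \<Union>(insert {i, q} S)" by auto
    finally show "?f S = J i * (\<Prod>j\<in>V - \<Union>(insert {i, q} S). J j)" .
  qed simp
  also have "\<dots> = J i * (\<Sum>S\<in>{S \<in> matchings (Suc k). {i, q} \<in> S}. \<Prod>j\<in>V - \<Union>S. J j)"
    unfolding sum_distrib_left[symmetric]
  proof (rule arg_cong[where f = "(*) (J i)"], rule sum.reindex_bij_witness[of _ "\<lambda>T. T - {{i, q}}" "insert {i, q}"])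
    fix S assume S: "S \<in> ?A"
    then have "{i, q} \<notin> S" by blast
    then show "insert {i, q} S - {{i, q}} = S" by blast
    show "insert {i, q} S \<in> {S \<in> matchings (Suc k). {i, q} \<in> S}"
      using S \<open>{i, q} \<notin> S\<close> q fin[of S k] by (auto simp: matchings_def pairwise_insert disjnt_def)
  next
    fix T assume T: "T \<in> {S \<in> matchings (Suc k). {i, q} \<in> S}"
    then show "insert {i, q} (T - {{i, q}}) = T" by blast
    have "disjnt {i, q} e" if "e \<in> T - {{i, q}}" for e
      using pairwiseD[of disjnt T "{i, q}" e] T that by (simp add: matchings_def) blast
    then have "i \<notin> \<Union>(T - {{i, q}})" "q \<notin> \<Union>(T - {{i, q}})" by (auto simp: disjnt_def)
    then show "T - {{i, q}} \<in> ?A"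
      using T fin[of T "Suc k"] by (auto simp: matchings_def intro: pairwise_subset)
  qed simp
  finally show ?thesis .
qed

text \<open>Turning the edge at \<open>i\<close> from \<open>p\<close> to \<open>q\<close> is a
  bijection of matchings. Covered vertices together with the excluded one form the same set before
  and after, so the monomials agree. In the Lenard recursion these terms cancel.\<close>

lemma swap_edge:
  assumes i: "i \<in> V" and p: "p \<noteq> i" "{i, p} \<in> E" and q: "q \<noteq> i" "{i, q} \<in> E" and pq: "p \<noteq> q"
  shows "(\<Sum>S\<in>{S \<in> matchings k. {i, p} \<in> S \<and> q \<notin> \<Union>S}. \<Prod>j\<in>V - \<Union>S - {q}. J j) =
    (\<Sum>S\<in>{S \<in> matchings k. {i, q} \<in> S \<and> p \<notin> \<Union>S}. \<Prod>j\<in>V - \<Union>S - {p}. J j)"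
proof -
  define W where "W p q S = insert {i, q} (S - {{i, p}})" for p q S
  have fin: "finite S" if "S \<in> matchings j" for S j
    using that finite_subset[OF _ finite_E] by (auto simp: matchings_def)
  have *: "W p q S \<in> {S \<in> matchings k. {i, q} \<in> S \<and> p \<notin> \<Union>S} \<and> W q p (W p q S) = S \<and>
      \<Union>(W p q S) \<union> {p} = \<Union>S \<union> {q}"
    if S: "S \<in> {S \<in> matchings k. {i, p} \<in> S \<and> q \<notin> \<Union>S}" and pq: "p \<noteq> q" "p \<noteq> i" "q \<noteq> i" "{i, q} \<in> E" for p q S
  proof -
    have ne: "{i, p} \<noteq> {i, q}" using pq by (auto simp: doubleton_eq_iff)
    have nin: "{i, q} \<notin> S" using S by blast
    have dis: "disjnt {i, p} e" if "e \<in> S - {{i, p}}" for e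
      using pairwiseD[of disjnt S "{i, p}" e] S that by (simp add: matchings_def) blast
    then have ip: "i \<notin> \<Union>(S - {{i, p}})" "p \<notin> \<Union>(S - {{i, p}})" by (auto simp: disjnt_def)
    have "card (W p q S) = k"
      using S nin fin[of S k] card_Suc_Diff1[of S "{i, p}"] by (auto simp: W_def matchings_def)
    moreover have "pairwise disjnt (W p q S)"
      using S ip unfolding W_def pairwise_insert
      by (auto simp: matchings_def disjnt_def intro: pairwise_subset)
    moreover have "W p q S \<subseteq> E" "p \<notin> \<Union>(W p q S)" "{i, q} \<in> W p q S"
      using S ip pq by (auto simp: matchings_def W_def)
    ultimately have "W p q S \<in> {S \<in> matchings k. {i, q} \<in> S \<and> p \<notin> \<Union>S}"
      by (simp add: matchings_def)
    moreover have "W q p (W p q S) = S" using S ne nin by (auto simp: W_def)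
    moreover have "\<Union>(W p q S) \<union> {p} = \<Union>S \<union> {q}"
    proof -
      have "\<Union>S = {i, p} \<union> \<Union>(S - {{i, p}})" using S by blast
      then show ?thesis unfolding W_def by auto
    qed
    ultimately show ?thesis by blast
  qed
  show ?thesis
  proof (rule sum.reindex_bij_witness[of _ "W q p" "W p q"])
    fix S assume S: "S \<in> {S \<in> matchings k. {i, p} \<in> S \<and> q \<notin> \<Union>S}"
    note *[OF S pq p(1) q]
    then show "W q p (W p q S) = S" "W p q S \<in> {S \<in> matchings k. {i, q} \<in> S \<and> p \<notin> \<Union>S}" by blast+
    have "V - \<Union>(W p q S) - {p} = V - \<Union>S - {q}" using *[OF S pq p(1) q] by blast
    then show "(\<Prod>j\<in>V - \<Union>(W p q S) - {p}. J j) = (\<Prod>j\<in>V - \<Union>S - {q}. J j)" by simp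
  next
    fix S assume S: "S \<in> {S \<in> matchings k. {i, q} \<in> S \<and> p \<notin> \<Union>S}"
    show "W p q (W q p S) = S" "W q p S \<in> {S \<in> matchings k. {i, p} \<in> S \<and> q \<notin> \<Union>S}"
      using *[OF S pq[symmetric] q(1) p] by blast+
  qed
qed

text \<open>The Lenard recursion between the two compatible brackets: the logarithmic bracket of
  \<open>matching_sum (Suc k)\<close> is minus the constant bracket of \<open>matching_sum k\<close>.\<close>

lemma lenard:
  assumes i: "i \<in> V"
  shows "(\<Sum>j\<in>V. s i j * J i * J j * d_matching_sum (Suc k) j J) =
    - (\<Sum>j\<in>V. if {i, j} \<in> E then s i j * d_matching_sum k j J else 0)"
proof -
  obtain p q where *: "p \<in> V" "q \<in> V" "p \<noteq> q" "p \<noteq> i" "q \<noteq> i" "\<And>j. {i, j} \<in> E \<longleftrightarrow> j = p \<or> j = q"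
    "s i p = - 1" "s i q = 1"
    using neighbours[OF i] by blast
  have "(\<Sum>j\<in>V. if {i, j} \<in> E then s i j * d_matching_sum k j J else 0) =
    (\<Sum>j\<in>{p, q}. s i j * d_matching_sum k j J)"
    using * by (intro sum.mono_neutral_cong_right) (auto simp: finite_V)
  also have "\<dots> = d_matching_sum k q J - d_matching_sum k p J" using * by simp
  also have "\<dots> = - (J i * (\<Sum>j\<in>V. s i j * J j * d_matching_sum (Suc k) j J))"
  proof -
    have ip: "{i, p} \<in> E" "{i, q} \<in> E" and nb: "\<forall>j. {i, j} \<in> E \<longrightarrow> j = p \<or> j = q"
      "\<forall>j. {i, j} \<in> E \<longrightarrow> j = q \<or> j = p"
      using * by auto
    note L = log_part[OF i *(4) ip(1) *(7) *(5) ip(2) *(8) nb(1), of J "Suc k"]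
    note Q = d_matching_sum_split[OF i *(2,5) ip(2) *(3) nb(1), of k J]
    note P = d_matching_sum_split[OF i *(1,4) ip(1) *(3)[symmetric] nb(2), of k J]
    show ?thesis
      unfolding L Q P swap_edge[OF i *(4) ip(1) *(5) ip(2) *(3)] by (simp add: algebra_simps)
  qed
  finally show ?thesis by (simp add: sum_distrib_left mult_ac)
qed

text \<open>The Lenard-Magri argument. With \<open>a\<close> and \<open>b\<close> the constant and
  logarithmic brackets of two matching sums, the recursion reads
  \<open>b k (Suc l) = - a k l\<close>. Skewness of both gives
  \<open>a (Suc k) l = a k (Suc l)\<close>, which moves the first index down to 0, and there the
  Casimir property \<open>b k 0 = 0\<close> finishes.\<close>

lemma involution:
  "(\<Sum>i\<in>V. \<Sum>j\<in>V. d_matching_sum k i J * d_matching_sum l j J *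
      (s i j * (J i * J j - (if {i, j} \<in> E then 1 else 0)))) = 0"
proof -
  define a where "a k l = (\<Sum>i\<in>V. \<Sum>j\<in>V. d_matching_sum k i J * d_matching_sum l j J *
      (if {i, j} \<in> E then s i j else 0))" for k l
  define b where "b k l = (\<Sum>i\<in>V. \<Sum>j\<in>V. d_matching_sum k i J * d_matching_sum l j J *
      (s i j * J i * J j))" for k l
  have a_skew: "a k l = - a l k" for k l
  proof -
    have "a k l = (\<Sum>j\<in>V. \<Sum>i\<in>V. d_matching_sum k i J * d_matching_sum l j J * (if {i, j} \<in> E then s i j else 0))"
      unfolding a_def by (rule sum.swap)
    also have "\<dots> = (\<Sum>j\<in>V. \<Sum>i\<in>V. - (d_matching_sum l j J * d_matching_sum k i J * (if {j, i} \<in> E then s j i else 0)))"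
    proof (intro sum.cong refl)
      fix i j assume "i \<in> V" "j \<in> V"
      then have "(if {i, j} \<in> E then s i j else 0) = - (if {j, i} \<in> E then s j i else 0)"
        using skew[of j i] by (simp add: insert_commute[of i j])
      then show "d_matching_sum k i J * d_matching_sum l j J * (if {i, j} \<in> E then s i j else 0) =
        - (d_matching_sum l j J * d_matching_sum k i J * (if {j, i} \<in> E then s j i else 0))"
        by (simp only: mult_minus_right mult.commute)
    qed
    also have "\<dots> = - a l k" unfolding a_def by (simp add: sum_negf)
    finally show ?thesis .
  qed
  have b_skew: "b k l = - b l k" for k l
  proof -
    have "b k l = (\<Sum>j\<in>V. \<Sum>i\<in>V. d_matching_sum k i J * d_matching_sum l j J * (s i j * J i * J j))"
      unfolding b_def by (rule sum.swap)
    also have "\<dots> = (\<Sum>j\<in>V. \<Sum>i\<in>V. - (d_matching_sum l j J * d_matching_sum k i J * (s j i * J j * J i)))"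
    proof (intro sum.cong refl)
      fix i j assume "i \<in> V" "j \<in> V"
      then have "s i j = - s j i" using skew by blast
      then show "d_matching_sum k i J * d_matching_sum l j J * (s i j * J i * J j) =
        - (d_matching_sum l j J * d_matching_sum k i J * (s j i * J j * J i))" by (simp add: mult_ac)
    qed
    also have "\<dots> = - b l k" unfolding b_def by (simp add: sum_negf)
    finally show ?thesis .
  qed
  have b_0: "b k 0 = 0" for k
  proof -
    have "b k 0 = (\<Sum>i\<in>V. d_matching_sum k i J * J i * (\<Sum>j\<in>V. s i j * J j * d_matching_sum 0 j J))"
      unfolding b_def by (simp add: sum_distrib_left mult_ac)
    then show ?thesis by (simp add: log_part_0)
  qed
  have b_Suc: "b k (Suc l) = - a k l" for k l
  proof -
    have "b k (Suc l) = (\<Sum>i\<in>V. d_matching_sum k i J * (\<Sum>j\<in>V. s i j * J i * J j * d_matching_sum (Suc l) j J))"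
      unfolding b_def by (simp add: sum_distrib_left mult_ac)
    also have "\<dots> = (\<Sum>i\<in>V. d_matching_sum k i J * - (\<Sum>j\<in>V. if {i, j} \<in> E then s i j * d_matching_sum l j J else 0))"
      by (intro sum.cong refl) (simp only: lenard)
    also have "\<dots> = - a k l"
      unfolding a_def by (simp add: sum_negf sum_distrib_left mult_ac if_distrib[of "(*) _"] cong: if_cong)
    finally show ?thesis .
  qed
  have "a k l = 0" for k l
  proof (induction k arbitrary: l)
    case 0
    show ?case using b_Suc[of 0 l] b_skew[of 0 "Suc l"] b_0 by simp
  next
    case (Suc k)
    have "a (Suc k) l = a k (Suc l)"
      using b_Suc[of "Suc k" l] b_Suc[of "Suc l" k] b_skew[of "Suc k" "Suc l"] a_skew[of k "Suc l"] by simp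
    then show ?case using Suc by simp
  qed
  moreover from this have "b k l = 0" for k l
    using b_0 b_Suc by (cases l) auto
  moreover have "(\<Sum>i\<in>V. \<Sum>j\<in>V. d_matching_sum k i J * d_matching_sum l j J *
      (s i j * (J i * J j - (if {i, j} \<in> E then 1 else 0)))) = b k l - a k l"
    unfolding a_def b_def sum_subtractf[symmetric] by (intro sum.cong refl) (simp add: algebra_simps)
  ultimately show ?thesis by simp
qed

lemma partial_deriv_matching_sum:
  assumes "j \<in> V"
  shows "partial_deriv j (matching_sum k) J = d_matching_sum k j J"
proof -
  have "((\<lambda>t. \<Prod>i\<in>V - \<Union>S. (J(j := t)) i) has_field_derivative
      (if j \<notin> \<Union>S then \<Prod>i\<in>V - \<Union>S - {j}. J i else 0)) (at (J j))" for S
  proof (cases "j \<in> \<Union>S")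
    case True
    then have "(\<lambda>t. \<Prod>i\<in>V - \<Union>S. (J(j := t)) i) = (\<lambda>t. \<Prod>i\<in>V - \<Union>S. J i)"
      by (intro ext prod.cong) auto
    then show ?thesis using True by simp
  next
    case False
    have "(\<Prod>i\<in>V - \<Union>S. (J(j := t)) i) = t * (\<Prod>i\<in>V - \<Union>S - {j}. J i)" for t
    proof -
      have "(\<Prod>i\<in>V - \<Union>S. (J(j := t)) i) = (J(j := t)) j * (\<Prod>i\<in>V - \<Union>S - {j}. (J(j := t)) i)"
        by (rule prod.remove) (use assms False finite_V in auto)
      also have "(\<Prod>i\<in>V - \<Union>S - {j}. (J(j := t)) i) = (\<Prod>i\<in>V - \<Union>S - {j}. J i)"
        by (rule prod.cong) auto
      finally show ?thesis by simp
    qed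
    then have "(\<lambda>t. \<Prod>i\<in>V - \<Union>S. (J(j := t)) i) = (\<lambda>t. t * (\<Prod>i\<in>V - \<Union>S - {j}. J i))" by blast
    then show ?thesis using False DERIV_cmult_right[OF DERIV_ident] by force
  qed
  then have "((\<lambda>t. matching_sum k (J(j := t))) has_field_derivative
      (\<Sum>S\<in>matchings k. if j \<notin> \<Union>S then \<Prod>i\<in>V - \<Union>S - {j}. J i else 0)) (at (J j))"
    unfolding matching_sum_def by (rule DERIV_sum)
  then show ?thesis
    unfolding d_matching_sum_def sum.inter_filter[OF finite_matchings] by (rule partial_deriv_eqI)
qed

text \<open>A graph automorphism permutes the matchings of each size and carries uncovered sets to
  uncovered sets. It is applied to the reflections of the cycle induced by the half steps.\<close>

lemma matching_sum_automorphism: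
  assumes bij: "bij_betw \<pi> V V" and edges: "\<And>e. e \<in> E \<Longrightarrow> \<pi> ` e \<in> E"
  shows "matching_sum k (\<lambda>i. J (\<pi> i)) = matching_sum k J"
proof -
  let ?h = "\<lambda>S. (`) \<pi> ` S"
  have injV: "inj_on \<pi> V" using bij by (simp add: bij_betw_def)
  have injE: "inj_on ((`) \<pi>) E"
    by (rule inj_onI) (use injV edge_subset in \<open>metis inj_on_image_eq_iff\<close>)
  have inj: "inj_on ?h (matchings k)"
    by (rule inj_onI) (use injE in \<open>auto simp: matchings_def inj_on_image_eq_iff\<close>)
  have into: "?h S \<in> matchings k" if S: "S \<in> matchings k" for S
  proof -
    have SE: "S \<subseteq> E" using S by (simp add: matchings_def)
    have "card (?h S) = k" using S inj_on_subset[OF injE SE] by (simp add: matchings_def card_image)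
    moreover have "pairwise disjnt (?h S)"
    proof (rule pairwise_imageI)
      fix e f assume ef: "e \<in> S" "f \<in> S" "e \<noteq> f"
      then have "disjnt e f" using S pairwiseD[of disjnt S e f] by (simp add: matchings_def)
      then show "disjnt (\<pi> ` e) (\<pi> ` f)"
        using injV edge_subset SE ef unfolding disjnt_def by (metis inj_on_image_Int subsetD image_empty)
    qed
    ultimately show ?thesis using SE edges by (auto simp: matchings_def)
  qed
  have "bij_betw ?h (matchings k) (matchings k)"
    unfolding bij_betw_def using inj into endo_inj_surj[OF finite_matchings _ inj] by blast
  then have "matching_sum k J = (\<Sum>S\<in>matchings k. \<Prod>j\<in>V - \<Union>(?h S). J j)"
    unfolding matching_sum_def by (rule sum.reindex_bij_betw[symmetric])
  also have "\<dots> = matching_sum k (\<lambda>i. J (\<pi> i))"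
    unfolding matching_sum_def
  proof (rule sum.cong)
    fix S assume S: "S \<in> matchings k"
    have "\<Union>S \<subseteq> V" using S edge_subset by (auto simp: matchings_def)
    then have "V - \<Union>(?h S) = \<pi> ` (V - \<Union>S)"
      using bij inj_on_image_set_diff[OF injV, of V "\<Union>S"] by (auto simp: bij_betw_def)
    moreover have "inj_on \<pi> (V - \<Union>S)" using injV by (rule inj_on_subset) blast
    ultimately show "(\<Prod>j\<in>V - \<Union>(?h S). J j) = (\<Prod>j\<in>V - \<Union>S. J (\<pi> j))"
      by (simp add: prod.reindex)
  qed simp
  finally show ?thesis ..
qed

end

text \<open>The cycle of odd length \<open>n\<close> is labelled in zigzag order: odd labels increase along one side,
  even labels along the other, and the two sides are joined by the edges \<open>{1, 2}\<close> and
  \<open>{n - 1, n}\<close>.\<close>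

definition zigzag_edges :: "nat \<Rightarrow> nat set set" where
  "zigzag_edges n = {{1, 2}, {n - 1, n}} \<union> {{j, j + 2} | j. 1 \<le> j \<and> j + 2 \<le> n}"

text \<open>The alternating sign of the cycle expressed in zigzag labels. The exponents are dictated
  by the bracket of the monomials \<open>1 / (x j * x (j + 1))\<close>; see
  \<open>D_bracket_zigzag_sign\<close>.\<close>

definition zigzag_sign :: "nat \<Rightarrow> nat \<Rightarrow> complex" where
  "zigzag_sign i j = (if i < j then (- 1) ^ ((j + 1) div 2 + i div 2)
     else if j < i then - ((- 1) ^ ((i + 1) div 2 + j div 2)) else 0)"

lemma mem_zigzag_edges:
  assumes "i \<in> {1..n}" "j \<in> {1..n}" "3 \<le> n"
  shows "{i, j} \<in> zigzag_edges n \<longleftrightarrow>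
    j = i + 2 \<or> i = j + 2 \<or> i = 1 \<and> j = 2 \<or> i = 2 \<and> j = 1 \<or> i = n - 1 \<and> j = n \<or> i = n \<and> j = n - 1"
  using assms by (auto simp: zigzag_edges_def doubleton_eq_iff)

lemma zigzag_sign_skew: "zigzag_sign j i = - zigzag_sign i j"
  by (simp add: zigzag_sign_def)

lemma zigzag_sign_add_2: "i \<noteq> j \<Longrightarrow> i \<noteq> j + 2 \<Longrightarrow> zigzag_sign i j + zigzag_sign i (j + 2) = 0"
proof -
  assume ij: "i \<noteq> j" "i \<noteq> j + 2"
  have 1: "(j + 2 + 1) div 2 = (j + 1) div 2 + 1" "(j + 2) div 2 = j div 2 + 1" by simp_all
  consider "i < j" | "i = j + 1" | "j + 2 < i" using ij by linarith
  then show ?thesis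
  proof cases
    case 2
    have "zigzag_sign i (j + 2) = (- 1) ^ ((j + 1) div 2 + 1 + (j + 1) div 2)"
      unfolding zigzag_sign_def 1 using 2 by simp
    moreover have "zigzag_sign i j = - ((- 1) ^ ((j + 2) div 2 + j div 2))"
      using 2 by (simp add: zigzag_sign_def)
    ultimately show ?thesis
      unfolding 1 by (simp add: power_add mult_2[symmetric] power_mult_distrib[symmetric])
  qed (unfold zigzag_sign_def 1, simp_all)
qed

text \<open>Round the cycle the even number \<open>n - 1\<close> of other vertices carries
  alternating signs. In terms of labels, the parts below and above \<open>i\<close> are partial sums
  \<open>S\<close> and \<open>R\<close> of sign sequences of period four.\<close>

lemma zigzag_sign_total:
  assumes "odd n" "i \<in> {1..n}"
  shows "(\<Sum>j=1..n. zigzag_sign i j) = 0"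
proof -
  have S: "(\<Sum>j=1..k. (- 1 :: complex) ^ (j div 2)) = (if odd k then (- 1) ^ (k div 2) else 0)" for k
    by (induction k) (auto elim!: evenE oddE)
  have R: "(\<Sum>j=1..k. (- 1 :: complex) ^ ((j + 1) div 2)) = (if odd k then - 1 else (- 1) ^ (k div 2) - 1)" for k
    by (induction k) (auto elim!: evenE oddE)
  have split: "{1..n} - {i} = {1..i - 1} \<union> {i + 1..n}" using assms by auto
  have "(\<Sum>j=1..n. zigzag_sign i j) =
    (\<Sum>j=1..i - 1. zigzag_sign i j) + (\<Sum>j=i + 1..n. zigzag_sign i j)"
    using sum.remove[of "{1..n}" i "zigzag_sign i"] assms(2) unfolding split
    by (simp add: sum.union_disjoint zigzag_sign_def)
  also have "(\<Sum>j=1..i - 1. zigzag_sign i j) = - ((- 1) ^ ((i + 1) div 2)) * (\<Sum>j=1..i - 1. (- 1) ^ (j div 2))"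
    unfolding sum_distrib_left using assms by (intro sum.cong refl) (auto simp: zigzag_sign_def power_add)
  also have "(\<Sum>j=i + 1..n. zigzag_sign i j) = (- 1) ^ (i div 2) * (\<Sum>j=i + 1..n. (- 1) ^ ((j + 1) div 2))"
    unfolding sum_distrib_left by (intro sum.cong refl) (auto simp: zigzag_sign_def power_add)
  also have "(\<Sum>j=i + 1..n. (- 1 :: complex) ^ ((j + 1) div 2)) =
    (\<Sum>j=1..n. (- 1) ^ ((j + 1) div 2)) - (\<Sum>j=1..i. (- 1) ^ ((j + 1) div 2))"
  proof -
    have "{1..n} = {1..i} \<union> {i + 1..n}" using assms by auto
    then have "(\<Sum>j=1..n. (- 1 :: complex) ^ ((j + 1) div 2)) =
      (\<Sum>j=1..i. (- 1) ^ ((j + 1) div 2)) + (\<Sum>j=i + 1..n. (- 1) ^ ((j + 1) div 2))"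
      by (simp add: sum.union_disjoint)
    then show ?thesis by simp
  qed
  finally have T: "(\<Sum>j=1..n. zigzag_sign i j) =
    - ((- 1) ^ ((i + 1) div 2)) * (\<Sum>j=1..i - 1. (- 1) ^ (j div 2)) +
    (- 1) ^ (i div 2) * ((\<Sum>j=1..n. (- 1) ^ ((j + 1) div 2)) - (\<Sum>j=1..i. (- 1) ^ ((j + 1) div 2)))" .
  show ?thesis
  proof (cases "even i")
    case True
    then obtain b where "i = 2 * b" by (elim evenE)
    moreover from this obtain c where "b = Suc c" using assms by (cases b) auto
    ultimately have i: "i div 2 = c + 1" "(i + 1) div 2 = c + 1" "(i - 1) div 2 = c" "odd (i - 1)" by auto
    have "(- 1 :: complex) ^ c * (- 1) ^ c = 1" by (simp add: power_mult_distrib[symmetric])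
    then show ?thesis unfolding T S R using assms True i by (simp add: algebra_simps)
  next
    case False
    then show ?thesis unfolding T S R using assms by simp
  qed
qed

lemma zigzag_neighbours:
  assumes "odd n" "3 \<le> n" "i \<in> {1..n}"
  shows "\<exists>p\<in>{1..n}. \<exists>q\<in>{1..n}. p \<noteq> q \<and> p \<noteq> i \<and> q \<noteq> i \<and>
    (\<forall>j. {i, j} \<in> zigzag_edges n \<longleftrightarrow> j = p \<or> j = q) \<and> zigzag_sign i p = - 1 \<and> zigzag_sign i q = 1"
proof -
  \<comment> \<open>\<open>p\<close> is the successor and \<open>q\<close> the predecessor of
    \<open>i\<close> for one orientation: down the odd labels, across the edge
    \<open>{1, 2}\<close>, up the even labels, and across the edge
    \<open>{n - 1, n}\<close>.\<close>
  define p where "p = (if odd i then (if i = 1 then 2 else i - 2) else (if i = n - 1 then n else i + 2))"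
  define q where "q = (if even i then (if i = 2 then 1 else i - 2) else (if i = n then n - 1 else i + 2))"
  obtain h where h: "n = 2 * h + 1" "h \<ge> 1" using assms by (auto elim: oddE)
  have mem: "p \<in> {1..n}" "q \<in> {1..n}" "p \<noteq> q" "p \<noteq> i" "q \<noteq> i"
    using assms h by (auto simp: p_def q_def elim!: evenE oddE)
  have "zigzag_sign i p = - 1"
  proof (cases "odd i")
    case True
    then obtain b where b: "i = 2 * b + 1" by (elim oddE)
    show ?thesis
    proof (cases b)
      case (Suc c)
      then have "p = 2 * c + 1" "i = 2 * c + 3" using b by (auto simp: p_def)
      then show ?thesis by (simp add: zigzag_sign_def power_add[symmetric] mult_2[symmetric])
    qed (simp add: b p_def zigzag_sign_def)
  next
    case False
    then show ?thesis using assms h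
      by (auto simp: p_def zigzag_sign_def power_add[symmetric] mult_2[symmetric] elim!: evenE)
  qed
  moreover have "zigzag_sign i q = 1"
  proof (cases "odd i")
    case True
    then show ?thesis using assms h
      by (auto simp: q_def zigzag_sign_def power_add[symmetric] mult_2[symmetric] elim!: oddE)
  next
    case False
    then obtain b where "i = 2 * b" by (auto elim: evenE)
    moreover from this obtain c where "b = Suc c" using assms by (cases b) auto
    ultimately have i: "i = 2 * c + 2" by simp
    show ?thesis
    proof (cases c)
      case (Suc d)
      then have "q = 2 * d + 2" "i = 2 * d + 4" using i by (auto simp: q_def)
      then show ?thesis by (simp add: zigzag_sign_def power_add[symmetric] mult_2[symmetric])
    qed (simp add: i q_def zigzag_sign_def)
  qed
  moreover have "{i, j} \<in> zigzag_edges n \<longleftrightarrow> j = p \<or> j = q" for j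
  proof (cases "j \<in> {1..n}")
    case True
    then show ?thesis
      unfolding mem_zigzag_edges[OF assms(3) True assms(2)] using assms h
      by (cases "odd i"; elim oddE evenE) (auto simp: p_def q_def)
  next
    case False
    then have "{i, j} \<notin> zigzag_edges n"
      using assms by (auto simp: zigzag_edges_def doubleton_eq_iff)
    then show ?thesis using False mem by blast
  qed
  ultimately show ?thesis using mem by blast
qed

lemma tube_zigzag:
  assumes n: "odd n" "3 \<le> n"
  shows "tube {1..n} (zigzag_edges n) zigzag_sign"
proof
  fix e assume "e \<in> zigzag_edges n"
  then consider "e = {1, 2}" | "e = {n - 1, n}" | j where "e = {j, j + 2}" "1 \<le> j" "j + 2 \<le> n"
    by (auto simp: zigzag_edges_def)
  then show "\<exists>i\<in>{1..n}. \<exists>j\<in>{1..n}. i \<noteq> j \<and> e = {i, j}"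
  proof cases
    case 1
    then show ?thesis using n by (intro bexI[of _ 1] bexI[of _ 2]) auto
  next
    case 2
    then show ?thesis using n by (intro bexI[of _ "n - 1"] bexI[of _ n]) auto
  next
    case (3 j)
    then show ?thesis by (intro bexI[of _ j] bexI[of _ "j + 2"]) auto
  qed
next
  fix j k i assume e: "{j, k} \<in> zigzag_edges n" and i: "i \<in> {1..n}" "i \<notin> {j, k}" and jk: "j \<noteq> k"
  have "j \<in> {1..n} \<and> k \<in> {1..n}"
    using e n by (auto simp: zigzag_edges_def doubleton_eq_iff)
  then have jk': "j \<in> {1..n}" "k \<in> {1..n}" by auto
  have one: "zigzag_sign i 1 + zigzag_sign i 2 = 0" if "i \<noteq> 1" "i \<noteq> 2"
    using that i by (auto simp: zigzag_sign_def)
  have last: "zigzag_sign i (n - 1) + zigzag_sign i n = 0" if "i \<noteq> n - 1" "i \<noteq> n"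
    using that i n by (auto simp: zigzag_sign_def elim!: oddE)
  show "zigzag_sign i j + zigzag_sign i k = 0"
    using e i one last zigzag_sign_add_2[of i j] zigzag_sign_add_2[of i k]
    unfolding mem_zigzag_edges[OF jk' n(2)] by (auto simp: add.commute)
next
  show "finite {1..n}" by simp
next
  fix i j show "zigzag_sign j i = - zigzag_sign i j" by (rule zigzag_sign_skew)
next
  fix i assume i: "i \<in> {1..n}"
  show "(\<Sum>j\<in>{1..n}. zigzag_sign i j) = 0" by (rule zigzag_sign_total[OF n(1) i])
  show "\<exists>p\<in>{1..n}. \<exists>q\<in>{1..n}. p \<noteq> q \<and> p \<noteq> i \<and> q \<noteq> i \<and>
    (\<forall>j. {i, j} \<in> zigzag_edges n \<longleftrightarrow> j = p \<or> j = q) \<and> zigzag_sign i p = - 1 \<and> zigzag_sign i q = 1"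
    by (rule zigzag_neighbours[OF n i])
qed

section \<open>Matching sums of functions whose brackets follow the tube law\<close>

lemma (in tube) polynomial_matching_sum:
  assumes "V \<subseteq> {1..n}" shows "polynomial_fun n (matching_sum k)"
  unfolding matching_sum_def[abs_def] using assms
  by (intro polynomial_fun_sum polynomial_fun_prod polynomial_fun.coord) auto

text \<open>By the chain rule the bracket of two matching sums is, at each good point, the double
  sum that \<open>involution\<close> evaluates to zero.\<close>

lemma (in tube) matching_sums_commute:
  assumes V: "V = {1..n}" and reg: "\<And>i. i \<in> {1..n} \<Longrightarrow> reg N a (J i)"
    and br: "\<And>i j. i \<in> {1..n} \<Longrightarrow> j \<in> {1..n} \<Longrightarrow> \<forall>\<^sub>F x in gen N. poisson_bracket N C (J i) (J j) x =
      s i j * (J i x * J j x - (if {i, j} \<in> E then 1 else 0))"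
  shows "\<forall>\<^sub>F x in gen N. poisson_bracket N C (\<lambda>x. matching_sum k (\<lambda>i. J i x))
    (\<lambda>x. matching_sum l (\<lambda>i. J i x)) x = 0"
proof -
  have "\<forall>\<^sub>F x in gen N. \<forall>i\<in>{1..n}. reg N x (J i)"
    using eventually_reg[OF reg] by (intro eventually_ball_finite) auto
  moreover have "\<forall>\<^sub>F x in gen N. \<forall>i\<in>{1..n}. \<forall>j\<in>{1..n}. poisson_bracket N C (J i) (J j) x =
      s i j * (J i x * J j x - (if {i, j} \<in> E then 1 else 0))"
    using br by (intro eventually_ball_finite ballI) auto
  ultimately show ?thesis
  proof eventually_elim
    case (elim x)
    let ?J = "\<lambda>i. J i x"
    have M: "reg n ?J (matching_sum k)" for k
      by (intro reg_polynomial polynomial_matching_sum) (simp add: V)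
    have "poisson_bracket N C (\<lambda>x. matching_sum k (\<lambda>i. J i x)) (\<lambda>x. matching_sum l (\<lambda>i. J i x)) x =
      (\<Sum>i=1..n. \<Sum>j=1..n. partial_deriv i (matching_sum k) ?J * partial_deriv j (matching_sum l) ?J *
        poisson_bracket N C (\<lambda>x. J i x) (\<lambda>x. J j x) x)"
      using elim M by (intro poisson_bracket_compose) auto
    also have "\<dots> = (\<Sum>i\<in>V. \<Sum>j\<in>V. d_matching_sum k i ?J * d_matching_sum l j ?J *
      (s i j * (J i x * J j x - (if {i, j} \<in> E then 1 else 0))))"
      using elim(2)[folded V] unfolding V[symmetric]
      by (intro sum.cong refl) (simp add: partial_deriv_matching_sum)
    also have "\<dots> = 0" by (rule involution)
    finally show ?case .
  qed
qed

lemma poisson_bracket_skew: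
  assumes "\<And>i j. i \<in> {1..n} \<Longrightarrow> j \<in> {1..n} \<Longrightarrow> C j i = - C i j"
  shows "poisson_bracket n C g f x = - poisson_bracket n C f g x"
proof -
  have "poisson_bracket n C g f x =
    (\<Sum>j=1..n. \<Sum>i=1..n. C i j * x i * x j * partial_deriv i g x * partial_deriv j f x)"
    unfolding poisson_bracket_def by (rule sum.swap)
  also have "\<dots> = (\<Sum>j=1..n. \<Sum>i=1..n. - (C j i * x j * x i * partial_deriv j f x * partial_deriv i g x))"
  proof (intro sum.cong refl)
    fix i j assume "j \<in> {1..n}" "i \<in> {1..n}"
    then have "C i j = - C j i" using assms by blast
    then show "C i j * x i * x j * partial_deriv i g x * partial_deriv j f x =
      - (C j i * x j * x i * partial_deriv j f x * partial_deriv i g x)" by (simp add: mult_ac)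
  qed
  also have "\<dots> = - poisson_bracket n C f g x"
    unfolding poisson_bracket_def by (simp add: sum_negf)
  finally show ?thesis .
qed

section \<open>Type D\<close>

text \<open>The inverse of the tridiagonal matrix \<open>D_form\<close>. Solving the two-step
  recurrence of its rows with value zero at the index 0 gives entries that do not depend on
  \<open>m\<close>; they vanish at the index \<open>2 * m + 1\<close> as well.\<close>

definition D_bracket :: "nat \<Rightarrow> nat \<Rightarrow> complex" where
  "D_bracket i j = (if odd i \<and> even j \<and> i < j then - ((- 1) ^ ((j - i - 1) div 2))
     else if even i \<and> odd j \<and> j < i then (- 1) ^ ((i - j - 1) div 2) else 0)"

lemma D_bracket_skew: "D_bracket j i = - D_bracket i j"
  by (auto simp: D_bracket_def)

lemma D_bracket_same_parity: "even i = even j \<Longrightarrow> D_bracket i j = 0"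
  by (auto simp: D_bracket_def)

lemma D_bracket_neighbour_sum:
  assumes "1 \<le> i"
  shows "D_bracket (i + 1) j + D_bracket (i - 1) j = (if i = j then (- 1) ^ (i + 1) else 0)"
proof (cases "even i = even j")
  case False
  then have "even (i + 1) = even j" "even (i - 1) = even j" using assms by auto
  then show ?thesis using False by (auto simp: D_bracket_same_parity)
next
  case True
  consider "i = j" | "i < j" | "j < i" by linarith
  then show ?thesis
  proof cases
    case 1
    then show ?thesis using assms by (auto simp: D_bracket_def)
  next
    case 2
    then obtain d where d: "j = i + 2 * d + 2"
    proof -
      have "even (j - i)" using True 2 by simp
      then obtain e where e: "j - i = 2 * e" by (elim evenE)
      then have "j = i + 2 * (e - 1) + 2" using 2 by (cases e) auto
      then show ?thesis by (rule that)
    qed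
    have "(j - (i + 1) - 1) div 2 = d" "(j - (i - 1) - 1) div 2 = Suc d" using d assms by auto
    then show ?thesis using d True assms unfolding D_bracket_def by auto
  next
    case 3
    then obtain d where d: "i = j + 2 * d + 2"
    proof -
      have "even (i - j)" using True 3 by simp
      then obtain e where e: "i - j = 2 * e" by (elim evenE)
      then have "i = j + 2 * (e - 1) + 2" using 3 by (cases e) auto
      then show ?thesis by (rule that)
    qed
    have "(i + 1 - j - 1) div 2 = Suc d" "(i - 1 - j - 1) div 2 = d" using d by auto
    then show ?thesis using d True unfolding D_bracket_def by auto
  qed
qed

lemma D_form_skew: "D_form j i = - D_form i j"
  by (auto simp: D_form_def)

lemma D_bracket_outside:
  "D_bracket i 0 = 0" "D_bracket 0 i = 0"
  "i \<le> 2 * m \<Longrightarrow> D_bracket i (2 * m + 1) = 0" "i \<le> 2 * m \<Longrightarrow> D_bracket (2 * m + 1) i = 0"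
  by (auto simp: D_bracket_def)

lemma D_form_inverse: "inverse_on (2 * m) D_form D_bracket"
proof -
  have BC: "(\<Sum>k=1..2 * m. D_form i k * D_bracket k j) = (if i = j then 1 else 0)"
    if i: "i \<in> {1..2 * m}" and j: "j \<in> {1..2 * m}" for i j
  proof -
    \<comment> \<open>Padding with the indices 0 and \<open>2 * m + 1\<close>, where the bracket
      vanishes, gives also the first and the last row two neighbours.\<close>
    have "(\<Sum>k=1..2 * m. D_form i k * D_bracket k j) = (\<Sum>k=0..2 * m + 1. D_form i k * D_bracket k j)"
      using D_bracket_outside(2)[of j] D_bracket_outside(4)[of j m] j by (intro sum.mono_neutral_left) (auto simp: not_le Suc_le_eq elim!: le_SucE)
    also have "\<dots> = (\<Sum>k\<in>{i - 1, i + 1}. D_form i k * D_bracket k j)"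
      using i by (intro sum.mono_neutral_right) (auto simp: D_form_def)
    also have "\<dots> = (- 1) ^ (i + 1) * (D_bracket (i + 1) j + D_bracket (i - 1) j)"
      using i by (cases i) (auto simp: D_form_def algebra_simps)
    also have "\<dots> = (if i = j then 1 else 0)"
      using D_bracket_neighbour_sum[of i j] i by (simp add: power_mult_distrib[symmetric])
    finally show ?thesis .
  qed
  moreover have "(\<Sum>k=1..2 * m. D_bracket i k * D_form k j) = (if i = j then 1 else 0)"
    if "i \<in> {1..2 * m}" "j \<in> {1..2 * m}" for i j
  proof -
    have "(\<Sum>k=1..2 * m. D_bracket i k * D_form k j) = (\<Sum>k=1..2 * m. D_form j k * D_bracket k i)"
      by (intro sum.cong refl) (simp add: D_bracket_skew[of i] D_form_skew[of _ j] mult.commute)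
    then show ?thesis using BC[OF that(2,1)] by auto
  qed
  ultimately show ?thesis unfolding inverse_on_def by blast
qed

text \<open>The compatibility of the bracket with the exchange polynomials: the logarithmic gradient
  of the \<open>j\<close>-th one is a multiple of the indicator of the neighbours of
  \<open>j\<close>, so only the coordinate \<open>x j\<close> has a nonzero bracket with it.\<close>

lemma D_bracket_column_sum:
  assumes "i \<in> {1..2 * m}" "j \<in> {1..2 * m}"
  shows "(\<Sum>b=1..2 * m. D_bracket i b * (if b + 1 = j \<or> b = j + 1 then 1 else 0)) =
    (if i = j then (- 1) ^ j else 0)"
proof -
  have "(\<Sum>b=1..2 * m. D_bracket i b * (if b + 1 = j \<or> b = j + 1 then 1 else 0)) =
    (\<Sum>b=0..2 * m + 1. D_bracket i b * (if b + 1 = j \<or> b = j + 1 then 1 else 0))"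
    using D_bracket_outside(1)[of i] D_bracket_outside(3)[of i m] assms by (intro sum.mono_neutral_left) (auto simp: not_le Suc_le_eq elim!: le_SucE)
  also have "\<dots> = (\<Sum>b\<in>{j - 1, j + 1}. D_bracket i b)"
    using assms by (intro sum.mono_neutral_cong_right) auto
  also have "\<dots> = - (D_bracket (j + 1) i + D_bracket (j - 1) i)"
    using assms by (simp add: D_bracket_skew[of _ i])
  also have "\<dots> = (if i = j then (- 1) ^ j else 0)"
    by (subst D_bracket_neighbour_sum) (use assms in auto)
  finally show ?thesis .
qed

section \<open>Type D: the half steps are anti-Poisson\<close>

definition D_exchange :: "nat \<Rightarrow> nat \<Rightarrow> (nat \<Rightarrow> complex) \<Rightarrow> complex" where
  "D_exchange m i x = (if i = 1 then (1 + x 2)\<^sup>2 else if i = 2 * m then (1 + x (2 * m - 1))\<^sup>2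
     else 1 + x (i - 1) * x (i + 1))"

lemma polynomial_D_exchange: "i \<in> {1..2 * m} \<Longrightarrow> 2 \<le> m \<Longrightarrow> polynomial_fun (2 * m) (D_exchange m i)"
  unfolding D_exchange_def[abs_def]
  by (cases "i = 1"; cases "i = 2 * m") (auto intro!: polynomial_fun.intros polynomial_fun_power)

lemma partial_deriv_D_exchange:
  assumes i: "i \<in> {1..2 * m}" and m: "2 \<le> m"
  obtains c where "\<And>b. b \<in> {1..2 * m} \<Longrightarrow>
    x b * partial_deriv b (D_exchange m i) x = c * (if b + 1 = i \<or> b = i + 1 then 1 else 0)"
proof -
  let ?n = "2 * m"
  have r: "reg ?n x (\<lambda>x. x j)" if "j \<in> {1..?n}" for j using that by (rule reg_coord)
  consider "i = 1" | "i = 2 * m" | "i \<noteq> 1" "i \<noteq> 2 * m" by blast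
  then show ?thesis
  proof cases
    case 1
    then have "D_exchange m i = (\<lambda>x. (1 + x 2)\<^sup>2)" by (auto simp: D_exchange_def)
    then show ?thesis
      using 1 m by (intro that[of "x 2 * (2 * (1 + x 2))"])
        (auto simp: partial_deriv_power[where n = ?n] partial_deriv_add[where n = ?n] reg_add r numeral_2_eq_2[symmetric])
  next
    case 2
    then have "D_exchange m i = (\<lambda>x. (1 + x (2 * m - 1))\<^sup>2)" using m by (auto simp: D_exchange_def)
    then show ?thesis
      using 2 m by (intro that[of "x (2 * m - 1) * (2 * (1 + x (2 * m - 1)))"])
        (auto simp: partial_deriv_power[where n = ?n] partial_deriv_add[where n = ?n] reg_add r numeral_2_eq_2[symmetric])
  next
    case 3
    then have "D_exchange m i = (\<lambda>x. 1 + x (i - 1) * x (i + 1))" by (auto simp: D_exchange_def)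
    moreover have rr: "reg ?n x (\<lambda>x. x (i - 1))" "reg ?n x (\<lambda>x. x (i + 1))"
      using 3 i by (auto intro!: r)
    ultimately have "partial_deriv b (D_exchange m i) x =
      (if i - 1 = b then 1 else 0) * x (i + 1) + x (i - 1) * (if i + 1 = b then 1 else 0)" for b
      by (simp only: partial_deriv_add[OF reg_const reg_mult[OF rr]] partial_deriv_mult[OF rr]
          partial_deriv_const partial_deriv_coord add_0)
    then show ?thesis
      using 3 i by (intro that[of "x (i - 1) * x (i + 1)"]) auto
  qed
qed

text \<open>By compatibility \<open>x i\<close> commutes with the exchange polynomial of every
  \<open>j\<close> different from \<open>i\<close>. The required symmetry then has both sides zero,
  and for \<open>i = j\<close> it is trivial.\<close>

lemma poisson_map_D_half:
  assumes m: "2 \<le> m" and \<Phi>: "\<And>x i. i \<in> {1..2 * m} \<Longrightarrow> \<Phi> x i = (if even i = e then D_exchange m i x / x i else x i)"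
  shows "poisson_map (2 * m) D_bracket (- 1) \<Phi>"
proof (rule poisson_map_half_step[where S = "{i \<in> {1..2 * m}. even i = e}" and F = "D_exchange m"])
  fix i j x assume ij: "i \<in> {i \<in> {1..2 * m}. even i = e}" "j \<in> {i \<in> {1..2 * m}. even i = e}"
  have zero: "(\<Sum>b=1..2 * m. D_bracket i b * x b * partial_deriv b (D_exchange m j) x) = 0"
    if ij: "i \<in> {1..2 * m}" "j \<in> {1..2 * m}" "i \<noteq> j" for i j
  proof -
    obtain c where c: "\<And>b. b \<in> {1..2 * m} \<Longrightarrow>
      x b * partial_deriv b (D_exchange m j) x = c * (if b + 1 = j \<or> b = j + 1 then 1 else 0)"
      using partial_deriv_D_exchange[OF ij(2) m] by blast
    have "(\<Sum>b=1..2 * m. D_bracket i b * x b * partial_deriv b (D_exchange m j) x) =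
      (\<Sum>b=1..2 * m. c * (D_bracket i b * (if b + 1 = j \<or> b = j + 1 then 1 else 0)))"
      by (intro sum.cong refl) (simp add: mult.assoc c)
    also have "\<dots> = c * (if i = j then (- 1) ^ j else 0)"
      unfolding sum_distrib_left[symmetric] D_bracket_column_sum[OF ij(1,2)] ..
    finally show ?thesis using ij by simp
  qed
  show "D_exchange m i x * (\<Sum>b=1..2 * m. D_bracket i b * x b * partial_deriv b (D_exchange m j) x) =
    D_exchange m j x * (\<Sum>b=1..2 * m. D_bracket j b * x b * partial_deriv b (D_exchange m i) x)"
    using ij zero[of i j] zero[of j i] by (cases "i = j") auto
next
  fix i and x y :: "nat \<Rightarrow> complex" assume i: "i \<in> {i \<in> {1..2 * m}. even i = e}"
    and eq: "\<And>j. j \<in> {1..2 * m} - {i \<in> {1..2 * m}. even i = e} \<Longrightarrow> x j = y j"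
  have E: "x j = y j" if "j \<in> {1..2 * m}" "j + 1 = i \<or> j = i + 1" for j
    using that i by (intro eq) auto
  have "x (i - 1) = y (i - 1)" if "i \<noteq> 1"
    by (rule E) (use that i in auto)
  moreover have "x (i + 1) = y (i + 1)" if "i \<noteq> 2 * m"
    by (rule E) (use that i in auto)
  ultimately show "D_exchange m i x = D_exchange m i y"
    unfolding D_exchange_def using i m by (auto simp: numeral_2_eq_2)
next
  fix i assume "i \<in> {i \<in> {1..2 * m}. even i = e}"
  show "\<exists>x. D_exchange m i x \<noteq> 0" by (rule exI[of _ "\<lambda>_. 0"]) (auto simp: D_exchange_def)
qed (use m \<Phi> in \<open>auto intro: polynomial_D_exchange D_bracket_skew D_bracket_same_parity\<close>)

lemma D_even_step_exchange:
  "2 \<le> m \<Longrightarrow> i \<in> {1..2 * m} \<Longrightarrow> D_even_step (2 * m + 1) x i = (if even i then D_exchange m i x / x i else x i)"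
  by (auto simp: D_even_step_def D_exchange_def)

lemma D_odd_step_exchange:
  "2 \<le> m \<Longrightarrow> i \<in> {1..2 * m} \<Longrightarrow> D_odd_step (2 * m + 1) x i = (if odd i then D_exchange m i x / x i else x i)"
  by (cases "i = 2") (auto simp: D_odd_step_def D_exchange_def)

lemma poisson_map_D_even_step: "2 \<le> m \<Longrightarrow> poisson_map (2 * m) D_bracket (- 1) (D_even_step (2 * m + 1))"
  by (rule poisson_map_D_half[where e = True]) (simp, subst D_even_step_exchange, simp_all)

lemma poisson_map_D_odd_step: "2 \<le> m \<Longrightarrow> poisson_map (2 * m) D_bracket (- 1) (D_odd_step (2 * m + 1))"
  by (rule poisson_map_D_half[where e = False]) (simp, subst D_odd_step_exchange, simp_all)

lemma poisson_map_D_map: "2 \<le> m \<Longrightarrow> poisson_map (2 * m) D_bracket 1 (D_map (2 * m + 1))"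
  using poisson_map_compose[OF poisson_map_D_even_step poisson_map_D_odd_step]
  by (simp add: D_map_def[abs_def])

text \<open>With \<open>x 0 = x 2 + 2\<close> and \<open>x (2 m + 1) = x (2 m - 1) + 2\<close> the exchange relations at the two
  ends take the same form \<open>x i' * x i = 1 + x (i - 1) * x (i + 1)\<close> as the others.\<close>

definition D_ext :: "nat \<Rightarrow> (nat \<Rightarrow> complex) \<Rightarrow> nat \<Rightarrow> complex" where
  "D_ext m x i = (if i = 0 then x 2 + 2 else if i = 2 * m + 1 then x (2 * m - 1) + 2 else x i)"

text \<open>The coefficient of a linear relation between coordinates: times \<open>x (j + 1)\<close>
  it is the mutated \<open>x j\<close> plus the next coordinate, and times \<open>x j\<close> it is
  the mutated \<open>x (j + 1)\<close> plus the previous coordinate. The two readings are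
  \<open>D_quantity_left\<close> and \<open>D_quantity_right\<close>.\<close>

definition D_quantity :: "nat \<Rightarrow> nat \<Rightarrow> (nat \<Rightarrow> complex) \<Rightarrow> complex" where
  "D_quantity m j x = (1 + D_ext m x (j - 1) * x (j + 1) + x j * D_ext m x (j + 2)) / (x j * x (j + 1))"

lemma D_exchange_ext:
  "2 \<le> m \<Longrightarrow> i \<in> {1..2 * m} \<Longrightarrow> D_exchange m i x = 1 + D_ext m x (i - 1) * D_ext m x (i + 1)"
  by (auto simp: D_exchange_def D_ext_def power2_eq_square algebra_simps numeral_2_eq_2)

lemma D_quantity_left:
  assumes "2 \<le> m" "j \<in> {1..2 * m - 1}" "\<forall>i\<in>{1..2 * m}. x i \<noteq> 0" 
  shows "D_quantity m j x = (D_exchange m j x / x j + D_ext m x (j + 2)) / x (j + 1)"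
proof -
  have "x j \<noteq> 0" "x (j + 1) \<noteq> 0" "D_ext m x (j + 1) = x (j + 1)" using assms by (auto simp: D_ext_def)
  moreover have "D_exchange m j x = 1 + D_ext m x (j - 1) * D_ext m x (j + 1)"
    using assms by (intro D_exchange_ext) auto
  ultimately show ?thesis by (simp add: D_quantity_def field_simps)
qed

lemma D_quantity_right:
  assumes "2 \<le> m" "j \<in> {1..2 * m - 1}" "\<forall>i\<in>{1..2 * m}. x i \<noteq> 0" 
  shows "D_quantity m j x = (D_exchange m (j + 1) x / x (j + 1) + D_ext m x (j - 1)) / x j"
proof -
  have "x j \<noteq> 0" "x (j + 1) \<noteq> 0" "D_ext m x j = x j" using assms by (auto simp: D_ext_def)
  moreover have "D_exchange m (j + 1) x = 1 + D_ext m x j * D_ext m x (j + 2)"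
    using assms D_exchange_ext[of m "j + 1" x] by (auto simp: numeral_2_eq_2)
  ultimately show ?thesis by (simp add: D_quantity_def field_simps)
qed

lemma D_exchange_cong:
  assumes "2 \<le> m" "i \<in> {1..2 * m}" "\<And>j. j \<in> {1..2 * m} \<Longrightarrow> even j \<noteq> even i \<Longrightarrow> x j = y j"
  shows "D_exchange m i x = D_exchange m i y"
proof -
  have "x (i - 1) = y (i - 1)" if "i \<noteq> 1"
    by (rule assms(3)) (use that assms(2) in auto)
  moreover have "x (i + 1) = y (i + 1)" if "i \<noteq> 2 * m"
    by (rule assms(3)) (use that assms(2) in auto)
  ultimately show ?thesis
    unfolding D_exchange_def using assms by (auto simp: numeral_2_eq_2)
qed

text \<open>Each half step interchanges adjacent quantities: the pair \<open>j, j + 1\<close> is expressed through the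
  mutated coordinates next to the common frozen coordinate \<open>x (j + 1)\<close>.\<close>

lemma D_quantity_half:
  assumes m: "2 \<le> m" and x: "\<forall>i\<in>{1..2 * m}. x i \<noteq> 0" and y0: "\<forall>i\<in>{1..2 * m}. y i \<noteq> 0"
    and y': "\<forall>i\<in>{1..2 * m}. y i = (if even i = e then D_exchange m i x / x i else x i)"
  shows "j \<in> {1..2 * m - 2} \<Longrightarrow> even j = e \<Longrightarrow> D_quantity m j y = D_quantity m (j + 1) x"
    and "j \<in> {1..2 * m - 2} \<Longrightarrow> even j = e \<Longrightarrow> D_quantity m (j + 1) y = D_quantity m j x"
    and "e \<Longrightarrow> D_quantity m 1 y = D_quantity m 1 x"
    and "\<not> e \<Longrightarrow> D_quantity m (2 * m - 1) y = D_quantity m (2 * m - 1) x"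
proof -
  have y: "y i = (if even i = e then D_exchange m i x / x i else x i)" if "i \<in> {1..2 * m}" for i
    using y' that by blast
  have F: "D_exchange m i y = D_exchange m i x" if "i \<in> {1..2 * m}" "even i = e" for i
    using that by (intro D_exchange_cong m) (auto simp: y)
  have undo: "D_exchange m i y / y i = x i" if "i \<in> {1..2 * m}" "even i = e" for i
  proof -
    have "y i \<noteq> 0" "x i \<noteq> 0" using that x y0 by blast+
    moreover have "y i = D_exchange m i x / x i" using that y by simp
    ultimately show ?thesis using F[OF that] by auto
  qed
  show "D_quantity m j y = D_quantity m (j + 1) x" if j: "j \<in> {1..2 * m - 2}" "even j = e"
  proof -
    have "D_quantity m j y = (D_exchange m j y / y j + D_ext m y (j + 2)) / y (j + 1)"
      using j by (intro D_quantity_left m y0) auto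
    also have "D_exchange m j y / y j = x j" using j by (intro undo) auto
    also have "D_ext m y (j + 2) = D_exchange m (j + 2) x / x (j + 2)" using j y[of "j + 2"] by (auto simp: D_ext_def)
    also have "y (j + 1) = x (j + 1)" using j y[of "j + 1"] by auto
    also have "(x j + D_exchange m (j + 2) x / x (j + 2)) / x (j + 1) = D_quantity m (j + 1) x"
      using j by (subst D_quantity_right[OF m _ x]) (auto simp: D_ext_def add.commute numeral_2_eq_2)
    finally show ?thesis .
  qed
  show "D_quantity m (j + 1) y = D_quantity m j x" if j: "j \<in> {1..2 * m - 2}" "even j = e"
  proof -
    have "D_quantity m (j + 1) y = (D_exchange m (j + 2) y / y (j + 2) + D_ext m y j) / y (j + 1)"
      using j by (subst D_quantity_right[OF m _ y0]) (auto simp: numeral_2_eq_2)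
    also have "D_exchange m (j + 2) y / y (j + 2) = x (j + 2)" using j by (intro undo) auto
    also have "D_ext m y j = D_exchange m j x / x j" using j y[of j] by (auto simp: D_ext_def)
    also have "y (j + 1) = x (j + 1)" using j y[of "j + 1"] by auto
    also have "(x (j + 2) + D_exchange m j x / x j) / x (j + 1) = D_quantity m j x"
      using j by (subst D_quantity_left[OF m _ x]) (auto simp: D_ext_def add.commute)
    finally show ?thesis .
  qed
  show "D_quantity m 1 y = D_quantity m 1 x" if e
  proof -
    have "D_quantity m 1 y = (D_exchange m 2 y / y 2 + (y 2 + 2)) / y 1"
      using m by (subst D_quantity_right[OF m _ y0]) (auto simp: D_ext_def numeral_2_eq_2)
    also have "D_exchange m 2 y / y 2 = x 2" using m that by (intro undo) auto
    also have "y 2 = D_exchange m 2 x / x 2" using m that y[of 2] by auto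
    also have "y 1 = x 1" using m that y[of 1] by auto
    also have "(x 2 + (D_exchange m 2 x / x 2 + 2)) / x 1 = D_quantity m 1 x"
      using m by (subst D_quantity_right[OF m _ x]) (auto simp: D_ext_def numeral_2_eq_2)
    finally show ?thesis .
  qed
  show "D_quantity m (2 * m - 1) y = D_quantity m (2 * m - 1) x" if "\<not> e"
  proof -
    define k where "k = 2 * m - 1"
    have k: "k + 1 = 2 * m" "k \<in> {1..2 * m - 1}" "k \<in> {1..2 * m}" "odd k" using m by (auto simp: k_def)
    have k2: "D_ext m z (k + 2) = z k + 2" for z using k by (simp add: D_ext_def k_def)
    have "D_quantity m k y = (D_exchange m k y / y k + (y k + 2)) / y (k + 1)"
      unfolding k2[symmetric] by (rule D_quantity_left[OF m k(2) y0])
    also have "D_exchange m k y / y k = x k" using k that by (intro undo) auto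
    also have "y k = D_exchange m k x / x k" using k that y[of k] by auto
    also have "y (k + 1) = x (k + 1)" using k that y[of "k + 1"] by auto
    also have "(x k + (D_exchange m k x / x k + 2)) / x (k + 1) = (D_exchange m k x / x k + (x k + 2)) / x (k + 1)"
      by (simp add: algebra_simps)
    also have "\<dots> = D_quantity m k x"
      unfolding k2[symmetric] by (rule D_quantity_left[OF m k(2) x, symmetric])
    finally show ?thesis unfolding k_def .
  qed
qed

context
  fixes m :: nat
  assumes m: "2 \<le> m"
begin

interpretation tube "{1..2 * m - 1}" "zigzag_edges (2 * m - 1)" zigzag_sign
  using m by (intro tube_zigzag) auto

definition D_integral :: "nat \<Rightarrow> (nat \<Rightarrow> complex) \<Rightarrow> complex" where
  "D_integral k x = matching_sum k (\<lambda>j. D_quantity m j x)"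

lemma D_integral_half:
  assumes x: "\<forall>i\<in>{1..2 * m}. x i \<noteq> 0" and y0: "\<forall>i\<in>{1..2 * m}. y i \<noteq> 0"
    and y': "\<forall>i\<in>{1..2 * m}. y i = (if even i = e then D_exchange m i x / x i else x i)"
  shows "D_integral k y = D_integral k x"
proof -
  \<comment> \<open>\<open>\<pi>\<close> is a reflection of the zigzag cycle, fixing the label 1 for
    the even step and \<open>2 * m - 1\<close> for the odd step and exchanging consecutive labels
    otherwise. The product of the two reflections is the rotation of the cycle by one
    vertex.\<close>
  define \<pi> where "\<pi> j = (if e \<and> j = 1 \<or> \<not> e \<and> j = 2 * m - 1 then j else if even j = e then j + 1 else j - 1)" for j
  have V: "\<pi> j \<in> {1..2 * m - 1}" "\<pi> (\<pi> j) = j" if "j \<in> {1..2 * m - 1}" for j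
  proof -
    have "j \<noteq> 2 * m - 1" if "even j" using that m by auto
    moreover have "j \<noteq> 1" if "even j" using that by auto
    moreover have "2 \<le> j" if "odd j" "j \<noteq> 1" using that \<open>j \<in> {1..2 * m - 1}\<close> by auto
    ultimately show "\<pi> j \<in> {1..2 * m - 1}" "\<pi> (\<pi> j) = j"
      using that m by (auto simp: \<pi>_def elim!: evenE oddE) presburger+
  qed
  have "D_quantity m j y = D_quantity m (\<pi> j) x" if j: "j \<in> {1..2 * m - 1}" for j
  proof -
    note H = D_quantity_half[OF m x y0 y']
    have "e \<and> j = 1 \<or> \<not> e \<and> j = 2 * m - 1 \<or> even j = e \<and> 1 \<le> j \<and> j \<le> 2 * m - 2 \<or>
      even j \<noteq> e \<and> 1 \<le> j - 1 \<and> j - 1 \<le> 2 * m - 2 \<and> even (j - 1) = e"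
      using j m by (cases e; simp; presburger)
    then consider "e" "j = 1" | "\<not> e" "j = 2 * m - 1" | "even j = e" "j \<in> {1..2 * m - 2}"
      | "even j \<noteq> e" "j - 1 \<in> {1..2 * m - 2}" "even (j - 1) = e"
      by auto
    then show ?thesis
    proof cases
      case 1
      then show ?thesis using H(3) by (simp add: \<pi>_def)
    next
      case 2
      then show ?thesis using H(4) by (simp add: \<pi>_def)
    next
      case 3
      then have "\<pi> j = j + 1" using m by (auto simp: \<pi>_def)
      then show ?thesis using H(1)[OF 3(2,1)] by simp
    next
      case 4
      then have "j = (j - 1) + 1" "\<pi> j = j - 1" using j m by (auto simp: \<pi>_def)
      then show ?thesis using H(2)[OF 4(2,3)] by simp
    qed
  qed
  then have "D_integral k y = matching_sum k (\<lambda>j. D_quantity m (\<pi> j) x)"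
    unfolding D_integral_def matching_sum_def by (intro sum.cong prod.cong refl) auto
  also have "\<dots> = D_integral k x"
    unfolding D_integral_def
  proof (rule matching_sum_automorphism)
    show "bij_betw \<pi> {1..2 * m - 1} {1..2 * m - 1}"
      by (rule bij_betw_byWitness[of _ \<pi>]) (use V in auto)
    fix a assume a: "a \<in> zigzag_edges (2 * m - 1)"
    obtain k where k: "2 * m - 1 = 2 * k + 1" "1 \<le> k"
      using m by (intro that[of "m - 1"]) auto
    let ?Z = "zigzag_edges (2 * k + 1)"
    have Z: "{1, 2} \<in> ?Z" "{2 * k, 2 * k + 1} \<in> ?Z"
      "\<And>j. 1 \<le> j \<Longrightarrow> j + 2 \<le> 2 * k + 1 \<Longrightarrow> {j, j + 2} \<in> ?Z"
      by (auto simp: zigzag_edges_def)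
    have even: "\<pi> (2 * b) = (if e then 2 * b + 1 else 2 * b - 1)" for b
      unfolding \<pi>_def k(1) by auto presburger
    have odd: "\<pi> (2 * b + 1) = (if e then if b = 0 then 1 else 2 * b else if b = k then 2 * k + 1 else 2 * b + 2)" for b
      unfolding \<pi>_def k(1) using k(2) by auto
    consider "a = {1, 2}" | "a = {2 * k, 2 * k + 1}" | j where "a = {j, j + 2}" "1 \<le> j" "j + 2 \<le> 2 * k + 1"
      using a[unfolded k(1)] by (auto simp: zigzag_edges_def)
    then have "\<pi> ` a \<in> ?Z"
    proof cases
      case 1
      then have "\<pi> ` a = (if e then {1, 1 + 2} else {1, 2})"
        using k even[of 1] odd[of 0] by auto
      then show ?thesis using Z(1) Z(3)[of 1] k by auto
    next
      case 2
      then have "\<pi> ` a = (if e then {2 * k, 2 * k + 1} else {2 * k - 1, 2 * k - 1 + 2})"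
        using k even[of k] odd[of k] by auto
      then show ?thesis using Z(2) Z(3)[of "2 * k - 1"] k by auto
    next
      case (3 j)
      show ?thesis
      proof (cases "even j")
        case True
        then obtain b where b: "j = 2 * b" by (elim evenE)
        have "\<pi> j = (if e then 2 * b + 1 else 2 * b - 1)" "\<pi> (j + 2) = (if e then 2 * b + 1 + 2 else 2 * b - 1 + 2)"
          using even[of b] even[of "b + 1"] b 3(2) by (simp_all add: algebra_simps)
        then have "\<pi> ` a = (if e then {2 * b + 1, 2 * b + 1 + 2} else {2 * b - 1, 2 * b - 1 + 2})"
          by (simp add: 3(1))
        moreover have "{2 * b + 1, 2 * b + 1 + 2} \<in> ?Z" "{2 * b - 1, 2 * b - 1 + 2} \<in> ?Z"
          using b 3 by (intro Z(3); presburger)+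
        ultimately show ?thesis by simp
      next
        case False
        then obtain b where b: "j = 2 * b + 1" by (elim oddE)
        have "\<pi> j = (if e then if b = 0 then 1 else 2 * b else 2 * b + 2)"
          "\<pi> (j + 2) = (if e then 2 * b + 2 else if b + 1 = k then 2 * b + 2 + 1 else 2 * b + 2 + 2)"
          using odd[of b] odd[of "b + 1"] b 3(3) by (simp_all add: algebra_simps)
        then have "\<pi> ` a = (if e then if b = 0 then {1, 2} else {2 * b, 2 * b + 2}
          else if b + 1 = k then {2 * k, 2 * k + 1} else {2 * b + 2, 2 * b + 2 + 2})"
          by (auto simp: 3(1))
        moreover have "b \<noteq> 0 \<Longrightarrow> {2 * b, 2 * b + 2} \<in> ?Z" "b + 1 \<noteq> k \<Longrightarrow> {2 * b + 2, 2 * b + 2 + 2} \<in> ?Z"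
          using b 3 by (intro Z(3); presburger)+
        ultimately show ?thesis using Z(1,2) by simp
      qed
    qed
    then show "\<pi> ` a \<in> zigzag_edges (2 * m - 1)" unfolding k(1) .
  qed
  finally show ?thesis .
qed

end

section \<open>Type D: brackets of the quantities\<close>

definition D_left :: "nat \<Rightarrow> (nat \<Rightarrow> complex) \<Rightarrow> complex" where
  "D_left j x = (if j = 1 then x 2 * (2 * (1 + x 2)) else x (j - 1) * x (j + 1))"

text \<open>\<open>D_left\<close> and \<open>D_right\<close> are the nonzero values of
  \<open>x a\<close> times the derivative by \<open>x a\<close> of the two products in the numerator
  of \<open>D_quantity\<close>. At the ends the products are \<open>(x 2 + 2) * x 2\<close> and
  \<open>x j * (x j + 2)\<close>, which explains the separate cases.\<close>

definition D_right :: "nat \<Rightarrow> nat \<Rightarrow> (nat \<Rightarrow> complex) \<Rightarrow> complex" where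
  "D_right m j x = (if j = 2 * m - 1 then x j * (2 * (1 + x j)) else x j * x (j + 2))"

abbreviation ind :: "bool \<Rightarrow> complex" where
  "ind P \<equiv> (if P then 1 else 0)"

context
  fixes m j :: nat and x :: "nat \<Rightarrow> complex"
  assumes m: "2 \<le> m" and j: "j \<in> {1..2 * m - 1}"
begin

lemma reg_D_ext: "i \<le> 2 * m + 1 \<Longrightarrow> reg (2 * m) x (\<lambda>y. D_ext m y i)"
  unfolding D_ext_def using m by (cases "i = 0"; cases "i = 2 * m + 1") (auto intro!: reg_add reg_coord)

lemma partial_deriv_D_ext:
  assumes "i \<le> 2 * m + 1"
  shows "partial_deriv a (\<lambda>y. D_ext m y i) x =
    ind (a = (if i = 0 then 2 else if i = 2 * m + 1 then 2 * m - 1 else i))"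
proof -
  have *: "reg (2 * m) x (\<lambda>y. y 2)" "reg (2 * m) x (\<lambda>y. y (2 * m - 1))"
    using m by (auto intro!: reg_coord)
  consider "i = 0" | "i = 2 * m + 1" | "i \<noteq> 0" "i \<noteq> 2 * m + 1" by blast
  then show ?thesis
    by cases (auto simp: D_ext_def partial_deriv_add[OF *(1) reg_const] partial_deriv_add[OF *(2)[simplified] reg_const])
qed

lemma reg_D_quantity:
  assumes "x j \<noteq> 0" "x (j + 1) \<noteq> 0" shows "reg (2 * m) x (D_quantity m j)"
  unfolding D_quantity_def[abs_def] using assms j
  by (intro reg_divide reg_add reg_mult reg_const reg_D_ext reg_coord) auto

text \<open>The operator \<open>x a\<close> times the derivative by \<open>x a\<close> multiplies a
  monomial by its exponent. The denominator thus contributes minus the quantity itself at the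
  indices \<open>j\<close> and \<open>j + 1\<close>, and each numerator product contributes at its
  own two indices, of which only one remains at an end of the chain.\<close>

lemma theta_D_quantity:
  assumes nz: "x j \<noteq> 0" "x (j + 1) \<noteq> 0" and a: "a \<in> {1..2 * m}"
  shows "x a * partial_deriv a (D_quantity m j) x = (1 / (x j * x (j + 1))) *
    (- (D_quantity m j x * x j * x (j + 1)) * (ind (a = j) + ind (a = j + 1)) +
     D_left j x * ind (a + 1 = j \<or> a = j + 1) + D_right m j x * ind (a = j \<or> a = j + 2))"
proof -
  let ?n = "2 * m"
  have r: "reg ?n x (\<lambda>y. y j)" "reg ?n x (\<lambda>y. y (j + 1))" "reg ?n x (\<lambda>y. D_ext m y (j - 1))"
    "reg ?n x (\<lambda>y. D_ext m y (j + 2))"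
    using j by (auto intro!: reg_coord reg_D_ext)
  note r' = r reg_mult[OF r(1,2)] reg_mult[OF r(3,2)] reg_mult[OF r(1,4)]
    reg_add[OF reg_const reg_mult[OF r(3,2)]] reg_add[OF reg_add[OF reg_const reg_mult[OF r(3,2)]] reg_mult[OF r(1,4)]]
  define E0 E2 where "E0 = partial_deriv a (\<lambda>y. D_ext m y (j - 1)) x"
    and "E2 = partial_deriv a (\<lambda>y. D_ext m y (j + 2)) x"
  let ?N = "1 + D_ext m x (j - 1) * x (j + 1) + x j * D_ext m x (j + 2)"
  have N: "?N = D_quantity m j x * x j * x (j + 1)" using nz by (simp add: D_quantity_def)
  have "partial_deriv a (D_quantity m j) x =
    ((E0 * x (j + 1) + D_ext m x (j - 1) * ind (j + 1 = a) + (ind (j = a) * D_ext m x (j + 2) + x j * E2)) *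
      (x j * x (j + 1)) - ?N * (ind (j = a) * x (j + 1) + x j * ind (j + 1 = a))) /
      (x j * x (j + 1) * (x j * x (j + 1)))"
    unfolding D_quantity_def[abs_def] E0_def E2_def using nz
    by (simp only: partial_deriv_divide[OF r'(9) r'(5)] partial_deriv_add[OF r'(8) r'(7)]
        partial_deriv_add[OF reg_const r'(6)] partial_deriv_mult[OF r(1,2)] partial_deriv_mult[OF r(3,2)]
        partial_deriv_mult[OF r(1,4)] partial_deriv_const partial_deriv_coord add_0 mult_eq_0_iff simp_thms)
  then have eq: "partial_deriv a (D_quantity m j) x = (E0 * x (j + 1) + D_ext m x (j - 1) * ind (j + 1 = a) +
      (ind (j = a) * D_ext m x (j + 2) + x j * E2)) / (x j * x (j + 1)) -
      ?N * (ind (j = a) * x (j + 1) + x j * ind (j + 1 = a)) / (x j * x (j + 1) * (x j * x (j + 1)))"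
    using nz by (simp add: diff_divide_distrib)
  have "x a * partial_deriv a (D_quantity m j) x = (1 / (x j * x (j + 1))) *
    (x a * (E0 * x (j + 1) + D_ext m x (j - 1) * ind (j + 1 = a)) + x a * (ind (j = a) * D_ext m x (j + 2) + x j * E2) -
      ?N * (ind (a = j) + ind (a = j + 1)))"
  proof -
    have "x a * (?N * (ind (j = a) * x (j + 1) + x j * ind (j + 1 = a)) / (x j * x (j + 1) * (x j * x (j + 1)))) =
      ?N * (ind (a = j) + ind (a = j + 1)) / (x j * x (j + 1))"
      using nz by (cases "a = j"; cases "a = j + 1") auto
    then show ?thesis
      unfolding eq right_diff_distrib by (simp add: algebra_simps add_divide_distrib diff_divide_distrib)
  qed
  also have "x a * (E0 * x (j + 1) + D_ext m x (j - 1) * ind (j + 1 = a)) = D_left j x * ind (a + 1 = j \<or> a = j + 1)"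
  proof (cases "j = 1")
    case True
    then show ?thesis using m j a unfolding E0_def
      by (subst partial_deriv_D_ext) (auto simp: D_left_def D_ext_def numeral_2_eq_2 algebra_simps)
  next
    case False
    then show ?thesis using m j a unfolding E0_def
      by (subst partial_deriv_D_ext) (auto simp: D_left_def D_ext_def)
  qed
  also have "x a * (ind (j = a) * D_ext m x (j + 2) + x j * E2) = D_right m j x * ind (a = j \<or> a = j + 2)"
  proof (cases "j = 2 * m - 1")
    case True
    then have "j + 2 = 2 * m + 1" using m by auto
    then show ?thesis using m j a True unfolding E2_def
      by (subst partial_deriv_D_ext) (auto simp: D_right_def D_ext_def algebra_simps)
  next
    case False
    then show ?thesis using m j a unfolding E2_def
      by (subst partial_deriv_D_ext) (auto simp: D_right_def D_ext_def numeral_2_eq_2)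
  qed
  finally show ?thesis unfolding N by (simp add: algebra_simps)
qed

end

text \<open>\<open>D_ham m j x a\<close> is \<open>{x a, J j} / x a\<close> for the \<open>j\<close>-th quantity \<open>J j\<close>.\<close>

definition D_ham :: "nat \<Rightarrow> nat \<Rightarrow> (nat \<Rightarrow> complex) \<Rightarrow> nat \<Rightarrow> complex" where
  "D_ham m j x a = (\<Sum>b=1..2 * m. D_bracket a b * (x b * partial_deriv b (D_quantity m j) x))"

text \<open>The exponents in \<open>D_left\<close> sit at the neighbours of \<open>j\<close>, those
  in \<open>D_right\<close> at the neighbours of \<open>j + 1\<close>, so
  \<open>D_bracket_column_sum\<close> concentrates them at a single index. Apart from
  \<open>x j\<close> and \<open>x (j + 1)\<close>, each coordinate is acted on as if the quantity
  were the monomial \<open>1 / (x j * x (j + 1))\<close>.\<close>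

lemma D_ham:
  assumes m: "2 \<le> m" and j: "j \<in> {1..2 * m - 1}" and nz: "x j \<noteq> 0" "x (j + 1) \<noteq> 0" and a: "a \<in> {1..2 * m}"
  shows "D_ham m j x a = - D_quantity m j x * (D_bracket a j + D_bracket a (j + 1)) +
    (- 1) ^ j / (x j * x (j + 1)) * (D_left j x * ind (a = j) - D_right m j x * ind (a = j + 1))"
proof -
  have cs: "(\<Sum>b=1..2 * m. D_bracket a b * ind (b = k)) = D_bracket a k" if "k \<in> {1..2 * m}" for k
    using that by (simp add: if_distrib[of "(*) _"] cong: if_cong)
  have "D_ham m j x a = (\<Sum>b=1..2 * m. (1 / (x j * x (j + 1))) *
    (- (D_quantity m j x * x j * x (j + 1)) * (D_bracket a b * ind (b = j) + D_bracket a b * ind (b = j + 1)) +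
     D_left j x * (D_bracket a b * ind (b + 1 = j \<or> b = j + 1)) +
     D_right m j x * (D_bracket a b * ind (b + 1 = j + 1 \<or> b = j + 1 + 1))))"
    unfolding D_ham_def by (intro sum.cong refl) (simp add: theta_D_quantity[OF m j nz] algebra_simps)
  also have "\<dots> = (1 / (x j * x (j + 1))) *
    (- (D_quantity m j x * x j * x (j + 1)) * (D_bracket a j + D_bracket a (j + 1)) +
     D_left j x * ind (a = j) * (- 1) ^ j + D_right m j x * ind (a = j + 1) * (- 1) ^ (j + 1))"
  proof -
    have jm: "j \<in> {1..2 * m}" "j + 1 \<in> {1..2 * m}" using j by auto
    show ?thesis
      unfolding sum_distrib_left[symmetric] sum.distrib D_bracket_column_sum[OF a jm(1)]
        D_bracket_column_sum[OF a jm(2)] cs[OF jm(1)] cs[OF jm(2)] by simp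
  qed
  also have "\<dots> = - D_quantity m j x * (D_bracket a j + D_bracket a (j + 1)) +
    (- 1) ^ j / (x j * x (j + 1)) * (D_left j x * ind (a = j) - D_right m j x * ind (a = j + 1))"
    using nz by (simp add: field_simps)
  finally show ?thesis .
qed

text \<open>The left-hand side is the coefficient in the bracket of the leading monomials
  \<open>1 / (x i * x (i + 1))\<close> and \<open>1 / (x j * x (j + 1))\<close>.\<close>

lemma D_bracket_zigzag_sign:
  assumes "i < j"
  shows "D_bracket i j + D_bracket i (j + 1) + D_bracket (i + 1) j + D_bracket (i + 1) (j + 1) = zigzag_sign i j"
proof -
  have odd_even: "D_bracket a b = (- 1) ^ (b div 2 + a div 2)" if P: "odd a" "even b" "a < b" for a b
  proof -
    obtain c where c: "a = 2 * c + 1" using \<open>odd a\<close> by (elim oddE)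
    obtain d where d: "b = 2 * d" using \<open>even b\<close> by (elim evenE)
    obtain f where f: "d = c + 1 + f" using P(3) c d by (intro that[of "d - c - 1"]) auto
    have "(- 1 :: complex) ^ c * (- 1) ^ c = 1" by (simp add: power_mult_distrib[symmetric])
    then show ?thesis using c d f by (simp add: D_bracket_def power_add)
  qed
  have even_odd: "D_bracket a b = 0" if "even a" "odd b" "a < b" for a b
    using that by (simp add: D_bracket_def)
  have "i + 1 < j" if "even i = even j" using that assms by presburger
  then show ?thesis
    using assms by (cases "even i"; cases "even j")
      (simp_all add: zigzag_sign_def D_bracket_same_parity odd_even even_odd)
qed

text \<open>The leading monomials account for \<open>zigzag_sign i j\<close> times the product. The
  corrections come from the coordinates \<open>x j\<close> and \<open>x (j + 1)\<close>, and from
  \<open>x (i + 1)\<close> when \<open>j = i + 1\<close>; they add up to a constant, nonzero exactly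
  for adjacent labels. Skewness reduces everything to \<open>i < j\<close>.\<close>

lemma D_quantity_bracket:
  assumes m: "2 \<le> m" and i: "i \<in> {1..2 * m - 1}" and j: "j \<in> {1..2 * m - 1}" and nz: "\<forall>a\<in>{1..2 * m}. x a \<noteq> 0"
  shows "poisson_bracket (2 * m) D_bracket (D_quantity m i) (D_quantity m j) x =
    zigzag_sign i j * (D_quantity m i x * D_quantity m j x - ind ({i, j} \<in> zigzag_edges (2 * m - 1)))"
proof -
  let ?Q = "\<lambda>j. D_quantity m j x"
  have less: "poisson_bracket (2 * m) D_bracket (D_quantity m i) (D_quantity m j) x =
    zigzag_sign i j * (?Q i * ?Q j - ind ({i, j} \<in> zigzag_edges (2 * m - 1)))"
    if i: "i \<in> {1..2 * m - 1}" and j: "j \<in> {1..2 * m - 1}" and ij: "i < j" for i j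
  proof -
    define T where "T k a = x a * partial_deriv a (D_quantity m k) x" for k a
    have x0: "x i \<noteq> 0" "x (i + 1) \<noteq> 0" "x j \<noteq> 0" "x (j + 1) \<noteq> 0"
      using nz i j by auto
    note Tj = theta_D_quantity[OF m j x0(3,4), folded T_def] and Ti = theta_D_quantity[OF m i x0(1,2), folded T_def]
    have "poisson_bracket (2 * m) D_bracket (D_quantity m i) (D_quantity m j) x =
      (\<Sum>a=1..2 * m. T i a * D_ham m j x a)"
      unfolding poisson_bracket_def D_ham_def T_def by (simp add: sum_distrib_left mult_ac)
    also have "\<dots> = (\<Sum>a=1..2 * m. ?Q j * (D_bracket j a * T i a + D_bracket (j + 1) a * T i a) +
      (- 1) ^ j / (x j * x (j + 1)) * (D_left j x * (T i a * ind (a = j)) - D_right m j x * (T i a * ind (a = j + 1))))"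
      by (intro sum.cong refl)
        (simp add: D_ham[OF m j x0(3,4)] D_bracket_skew[of j] D_bracket_skew[of "Suc j"] algebra_simps)
    also have "\<dots> = ?Q j * (D_ham m i x j + D_ham m i x (j + 1)) +
      (- 1) ^ j / (x j * x (j + 1)) * (D_left j x * T i j - D_right m j x * T i (j + 1))"
    proof -
      have cs: "(\<Sum>a=1..2 * m. T i a * ind (a = k)) = T i k" if "k \<in> {1..2 * m}" for k
        using that by (simp add: if_distrib[of "(*) _"] cong: if_cong)
      have jm: "j \<in> {1..2 * m}" "j + 1 \<in> {1..2 * m}" using j by auto
      show ?thesis
        unfolding D_ham_def T_def[symmetric] sum.distrib sum_subtractf sum_distrib_left[symmetric]
          cs[OF jm(1)] cs[OF jm(2)] ..
    qed
    also have "D_ham m i x j + D_ham m i x (j + 1) =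
      zigzag_sign i j * ?Q i - (- 1) ^ i / (x i * x (i + 1)) * (D_right m i x * ind (j = i + 1))"
    proof -
      have S: "(D_bracket j i + D_bracket j (i + 1)) + (D_bracket (j + 1) i + D_bracket (j + 1) (i + 1)) = - zigzag_sign i j"
        unfolding D_bracket_zigzag_sign[OF ij, symmetric]
        by (simp add: D_bracket_skew[of i] D_bracket_skew[of "Suc i"])
      have jm: "j \<in> {1..2 * m}" "j + 1 \<in> {1..2 * m}" using j by auto
      have "D_ham m i x j + D_ham m i x (j + 1) =
        - ?Q i * ((D_bracket j i + D_bracket j (i + 1)) + (D_bracket (j + 1) i + D_bracket (j + 1) (i + 1))) +
        (- 1) ^ i / (x i * x (i + 1)) * (D_left i x * (ind (j = i) + ind (j + 1 = i)) -
          D_right m i x * (ind (j = i + 1) + ind (j + 1 = i + 1)))"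
        unfolding D_ham[OF m i x0(1,2) jm(1)] D_ham[OF m i x0(1,2) jm(2)]
        by (simp only: distrib_left right_diff_distrib add_ac diff_conv_add_uminus minus_add_distrib)
      then show ?thesis unfolding S using ij by simp
    qed
    also have "?Q j * (zigzag_sign i j * ?Q i - (- 1) ^ i / (x i * x (i + 1)) * (D_right m i x * ind (j = i + 1))) +
        (- 1) ^ j / (x j * x (j + 1)) * (D_left j x * T i j - D_right m j x * T i (j + 1)) =
      zigzag_sign i j * (?Q i * ?Q j - ind ({i, j} \<in> zigzag_edges (2 * m - 1)))"
    proof -
      have edge: "{i, j} \<in> zigzag_edges (2 * m - 1) \<longleftrightarrow> j = i + 2 \<or> i = 1 \<and> j = 2 \<or> i = 2 * m - 2 \<and> j = 2 * m - 1"
        using i j ij m by (subst mem_zigzag_edges) auto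
      have jm: "j \<in> {1..2 * m}" "j + 1 \<in> {1..2 * m}" using j by auto
      consider "j = i + 1" | "j = i + 2" | "i + 2 < j" using ij by linarith
      then show ?thesis
      proof cases
        case 1
        define k where "k = i + 2"
        have distrib: "a * b + - a * c = a * (b - c)" for a b c :: complex
          by (simp add: algebra_simps)
        have L: "D_left j x = x i * x k" and R: "D_right m i x = x i * x k"
          using 1 i j by (auto simp: D_left_def D_right_def k_def)
        have Tj: "T i j = (1 / (x i * x j)) * (D_left i x - ?Q i * x i * x j)"
          and Tk: "T i k = (1 / (x i * x j)) * (x i * x k)"
          using Ti[OF jm(1)] Ti[OF jm(2)] 1 unfolding R by (auto simp: k_def algebra_simps)
        have Qi: "?Q i * x i * x j = 1 + D_ext m x (i - 1) * x j + x i * x k"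
          and Qj: "?Q j * x j * x k = 1 + x i * x k + x j * D_ext m x (j + 2)"
          using x0 1 i j by (auto simp: D_quantity_def D_ext_def k_def)
        have jk: "j + 1 = k" "i + 1 = j" using 1 by (auto simp: k_def)
        have nz': "x i \<noteq> 0" "x j \<noteq> 0" "x k \<noteq> 0" using x0 jk by auto
        have "(- 1 :: complex) ^ i = - ((- 1) ^ j)" using 1 by simp
        then have "?Q j * (zigzag_sign i j * ?Q i - (- 1) ^ i / (x i * x (i + 1)) * (D_right m i x * ind (j = i + 1))) +
            (- 1) ^ j / (x j * x (j + 1)) * (D_left j x * T i j - D_right m j x * T i (j + 1)) =
          zigzag_sign i j * (?Q i * ?Q j) + (- 1) ^ j / (x j * x j) *
            (?Q j * x j * x k + (D_left i x - ?Q i * x i * x j) - D_right m j x)"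
          unfolding jk R L Tj Tk using nz' 1 by (simp add: field_simps)
        also have "?Q j * x j * x k + (D_left i x - ?Q i * x i * x j) - D_right m j x =
          (D_left i x - D_ext m x (i - 1) * x j) - (D_right m j x - x j * D_ext m x (j + 2))"
          unfolding Qi Qj by simp
        \<comment> \<open>In the interior the two terms cancel. At an end the doubled coordinate in
          the extended product leaves a square, and this produces the edges \<open>{1, 2}\<close>
          and \<open>{2 * m - 2, 2 * m - 1}\<close> that close the cycle.\<close>
        also have "D_left i x - D_ext m x (i - 1) * x j = x j * x j * ind (i = 1)"
          using 1 i by (auto simp: D_left_def D_ext_def numeral_2_eq_2 algebra_simps)
        also have "D_right m j x - x j * D_ext m x (j + 2) = x j * x j * ind (j = 2 * m - 1)"
          using 1 j m by (auto simp: D_right_def D_ext_def numeral_2_eq_2 algebra_simps)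
        also have "zigzag_sign i j * (?Q i * ?Q j) +
            (- 1) ^ j / (x j * x j) * (x j * x j * ind (i = 1) - x j * x j * ind (j = 2 * m - 1)) =
          zigzag_sign i j * (?Q i * ?Q j) + (- 1) ^ j * (ind (i = 1) - ind (j = 2 * m - 1))"
          using nz' by (simp add: field_simps)
        also have "(- 1) ^ j * (ind (i = 1) - ind (j = 2 * m - 1)) = - zigzag_sign i j * ind (i = 1 \<or> j = 2 * m - 1)"
        proof -
          have "zigzag_sign i j = - 1" if "i = 1" using that 1 by (simp add: zigzag_sign_def)
          moreover have "zigzag_sign i j = - 1 \<and> even i" if "j = 2 * m - 1"
          proof -
            obtain k where "m = k + 2" using m le_Suc_ex by (metis add.commute)
            then show ?thesis using that 1 by (simp add: zigzag_sign_def power_add[symmetric] mult_2[symmetric])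
          qed
          ultimately show ?thesis using 1 m by auto
        qed
        also have "i = 1 \<or> j = 2 * m - 1 \<longleftrightarrow> {i, j} \<in> zigzag_edges (2 * m - 1)"
          using edge 1 m by auto
        also have "zigzag_sign i j * (?Q i * ?Q j) + - zigzag_sign i j * ind ({i, j} \<in> zigzag_edges (2 * m - 1)) =
          zigzag_sign i j * (?Q i * ?Q j - ind ({i, j} \<in> zigzag_edges (2 * m - 1)))"
          by (rule distrib)
        finally show ?thesis .
      next
        \<comment> \<open>Here \<open>D_left j x * T i j\<close> equals
          \<open>x j * x (j + 1)\<close>, which the prefactor cancels; the remaining sign is the
          constant belonging to the edge \<open>{i, i + 2}\<close>.\<close>
        case 2
        have L: "D_left j x = x (i + 1) * x (j + 1)" and R: "D_right m i x = x i * x j"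
          using 2 i j by (auto simp: D_left_def D_right_def)
        have Tj: "T i j = (1 / (x i * x (i + 1))) * (x i * x j)" and Tk: "T i (j + 1) = 0"
          using Ti[OF jm(1)] Ti[OF jm(2)] 2 unfolding R by auto
        have "zigzag_sign i j = - ((- 1) ^ i)"
          using 2 by (cases "even i") (auto simp: zigzag_sign_def power_add[symmetric] mult_2[symmetric] elim!: evenE oddE)
        moreover have "(- 1 :: complex) ^ j = (- 1) ^ i" using 2 by simp
        ultimately show ?thesis
          unfolding L Tj Tk using edge 2 x0 by (simp add: field_simps)
      next
        case 3
        have "T i j = 0" "T i (j + 1) = 0"
          using Ti[OF jm(1)] Ti[OF jm(2)] 3 by auto
        then show ?thesis using edge 3 m i j by auto
      qed
    qed
    finally show ?thesis .
  qed
  consider "i < j" | "j < i" | "i = j" by linarith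
  then show ?thesis
  proof cases
    case 2
    have b: "poisson_bracket (2 * m) D_bracket (D_quantity m i) (D_quantity m j) x =
      - poisson_bracket (2 * m) D_bracket (D_quantity m j) (D_quantity m i) x"
      by (rule poisson_bracket_skew) (rule D_bracket_skew)
    show ?thesis
      unfolding b less[OF j i 2] zigzag_sign_skew[of i j] insert_commute[of i j "{}"]
      by (simp add: mult.commute)
  next
    case 3
    have "poisson_bracket (2 * m) D_bracket (D_quantity m i) (D_quantity m i) x =
      - poisson_bracket (2 * m) D_bracket (D_quantity m i) (D_quantity m i) x"
      by (rule poisson_bracket_skew) (rule D_bracket_skew)
    then show ?thesis using 3 by (simp add: zigzag_sign_def)
  qed (use less i j in blast)
qed

section \<open>Type D: independence and integrability\<close>

lemma tendsto_det:
  fixes A :: "'b \<Rightarrow> nat \<Rightarrow> nat \<Rightarrow> complex"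
  assumes "\<And>i j. i < m \<Longrightarrow> j < m \<Longrightarrow> ((\<lambda>t. A t i j) \<longlongrightarrow> B i j) F"
  shows "((\<lambda>t. det (mat m m (\<lambda>(i, j). A t i j))) \<longlongrightarrow> det (mat m m (\<lambda>(i, j). B i j))) F"
proof -
  have det: "det (mat m m (\<lambda>(i, j). C i j)) =
    (\<Sum>p\<in>{p. p permutes {0..<m}}. signof p * (\<Prod>i=0..<m. C i (p i)))" for C :: "nat \<Rightarrow> nat \<Rightarrow> complex"
    by (subst det_def'[of _ m]) (auto intro!: sum.cong prod.cong simp: permutes_in_image)
  show ?thesis
    unfolding det using assms
    by (intro tendsto_sum tendsto_mult tendsto_const tendsto_prod) (auto simp: permutes_in_image)
qed

text \<open>Exchange argument: elements of \<open>A\<close> outside the top interval weigh at most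
  \<open>2 * l + 1\<close>, while the equally many missing top elements weigh at least
  \<open>2 * l + 3\<close>. Hence the top interval is the unique set of maximal weight of its
  size.\<close>

lemma sum_weight_less:
  fixes A :: "nat set"
  assumes A: "A \<subseteq> {1..n}" "card A = n - l" "l \<le> n" "A \<noteq> {l + 1..n}"
  shows "(\<Sum>i\<in>A. 2 * i + 1) < (\<Sum>i=l + 1..n. 2 * i + 1)"
proof -
  let ?B = "{l + 1..n}"
  have fin: "finite A" using A(1) finite_subset by blast
  have "card A = card ?B" using A by simp
  then have card: "card (A - ?B) = card (?B - A)"
    using fin card_Diff_subset_Int[of A ?B] card_Diff_subset_Int[of ?B A] by (simp add: Int_commute)
  have "A - ?B \<noteq> {}"
  proof
    assume "A - ?B = {}"
    then have "A \<subseteq> ?B" by blast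
    then have "A = ?B" using \<open>card A = card ?B\<close> card_subset_eq[of ?B A] by simp
    then show False using A by simp
  qed
  then have pos: "0 < card (A - ?B)" using fin by (simp add: card_gt_0_iff)
  have "(\<Sum>i\<in>A - ?B. 2 * i + 1) \<le> card (A - ?B) * (2 * l + 1)"
    using sum_bounded_above[of "A - ?B" "\<lambda>i. 2 * i + 1" "2 * l + 1"] A by force
  also have "\<dots> < card (?B - A) * (2 * l + 3)"
    using pos unfolding card by (intro mult_strict_left_mono) simp_all
  also have "\<dots> \<le> (\<Sum>i\<in>?B - A. 2 * i + 1)"
    using sum_bounded_below[of "?B - A" "2 * l + 3" "\<lambda>i. 2 * i + 1"] by force
  finally have less: "(\<Sum>i\<in>A - ?B. 2 * i + 1) < (\<Sum>i\<in>?B - A. 2 * i + 1)" .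
  have "(\<Sum>i\<in>A. 2 * i + 1) = (\<Sum>i\<in>A \<inter> ?B. 2 * i + 1) + (\<Sum>i\<in>A - ?B. 2 * i + 1)"
    using sum.Int_Diff[OF fin] .
  also have "\<dots> < (\<Sum>i\<in>?B \<inter> A. 2 * i + 1) + (\<Sum>i\<in>?B - A. 2 * i + 1)"
    using less by (simp add: Int_commute)
  also have "\<dots> = (\<Sum>i\<in>?B. 2 * i + 1)"
    using sum.Int_Diff[of ?B "\<lambda>i. 2 * i + 1" A] by simp
  finally show ?thesis .
qed

lemma (in tube) card_Union_matching:
  assumes "S \<in> matchings k" shows "card (\<Union>S) = 2 * k"
proof -
  have S: "S \<subseteq> E" "card S = k" "pairwise disjnt S" using assms by (auto simp: matchings_def)
  have "card (\<Union>S) = (\<Sum>e\<in>S. card e)"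
    using S finite_subset[OF edge_subset finite_V] by (intro card_Union_disjoint) auto
  also have "\<dots> = (\<Sum>e\<in>S. 2)"
  proof (rule sum.cong)
    fix e assume "e \<in> S"
    then obtain i j where "e = {i, j}" "i \<noteq> j" using S edge[of e] by blast
    then show "card e = 2" by simp
  qed simp
  finally show ?thesis using S by simp
qed

text \<open>The labels \<open>1..2 * k\<close> form a path in the cycle. Its perfect matching is
  built from the middle outwards, starting from the empty path or from \<open>{1, 2}\<close> and
  adding one edge on each side; hence the induction in steps of two.\<close>

lemma ex_initial_matching:
  assumes "2 * k < n"
  shows "\<exists>S. S \<subseteq> zigzag_edges n \<and> finite S \<and> card S = k \<and> pairwise disjnt S \<and> \<Union>S = {1..2 * k}"
  using assms
proof (induction k rule: less_induct)
  case (less k)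
  consider "k = 0" | "k = 1" | j where "k = j + 2" by (metis add_2_eq_Suc' not0_implies_Suc One_nat_def)
  then show ?case
  proof cases
    case 1
    then show ?thesis by (intro exI[of _ "{}"]) simp
  next
    case 2
    then show ?thesis by (intro exI[of _ "{{1, 2}}"]) (auto simp: zigzag_edges_def)
  next
    case (3 j)
    then obtain S where S: "S \<subseteq> zigzag_edges n" "finite S" "card S = j" "pairwise disjnt S" "\<Union>S = {1..2 * j}"
      using less.IH[of j] less.prems by auto
    define e f where "e = {2 * j + 1, 2 * j + 1 + 2}" and "f = {2 * j + 2, 2 * j + 2 + 2}"
    have "e \<inter> \<Union>S = {}" "f \<inter> \<Union>S = {}" unfolding S(5) e_def f_def by auto
    then have d: "disjnt e s" "disjnt f s" "disjnt s e" "disjnt s f" if "s \<in> S" for s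
      using that unfolding disjnt_def by blast+
    have ef: "disjnt e f" "disjnt f e" "e \<noteq> {}" "f \<noteq> {}" "e \<noteq> f"
      by (auto simp: disjnt_def e_def f_def doubleton_eq_iff)
    then have nin: "e \<notin> S" "f \<notin> S" using d unfolding disjnt_def by blast+
    have "e \<in> zigzag_edges n"
      unfolding zigzag_edges_def e_def using less.prems 3
      by (intro UnI2 CollectI exI[of _ "2 * j + 1"]) simp
    moreover have "f \<in> zigzag_edges n"
      unfolding zigzag_edges_def f_def using less.prems 3
      by (intro UnI2 CollectI exI[of _ "2 * j + 2"]) simp
    moreover have "pairwise disjnt (insert e (insert f S))"
      unfolding pairwise_insert using S(4) d ef by blast
    moreover have "card (insert e (insert f S)) = k"
      using S nin ef 3 by simp
    moreover have "\<Union>(insert e (insert f S)) = {1..2 * k}"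
      unfolding Union_insert S(5) e_def f_def using 3 by auto
    ultimately show ?thesis using S(1,2) by (intro exI[of _ "insert e (insert f S)"]) blast
  qed
qed

context
  fixes m :: nat
  assumes m: "2 \<le> m"
begin

interpretation tube "{1..2 * m - 1}" "zigzag_edges (2 * m - 1)" zigzag_sign
  using m by (intro tube_zigzag) auto

lemma reg_D_quantity': "\<forall>i\<in>{1..2 * m}. x i \<noteq> 0 \<Longrightarrow> j \<in> {1..2 * m - 1} \<Longrightarrow> reg (2 * m) x (D_quantity m j)"
  by (rule reg_D_quantity[OF m]) auto

lemma D_integral_compose: "D_integral m k = (\<lambda>x. matching_sum k (\<lambda>j. D_quantity m j x))"
  using D_integral_def[OF m] by blast

lemma reg_D_integral: "\<forall>i\<in>{1..2 * m}. x i \<noteq> 0 \<Longrightarrow> reg (2 * m) x (D_integral m k)"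
  unfolding D_integral_compose
  by (rule reg_compose[OF reg_polynomial[OF polynomial_matching_sum[OF subset_refl]]]) (rule reg_D_quantity')

lemma partial_deriv_D_integral:
  assumes x: "\<forall>i\<in>{1..2 * m}. x i \<noteq> 0"
  shows "partial_deriv a (D_integral m k) x = (\<Sum>j=1..2 * m - 1.
    d_matching_sum k j (\<lambda>j. D_quantity m j x) * partial_deriv a (D_quantity m j) x)"
proof -
  have "partial_deriv a (D_integral m k) x = (\<Sum>j=1..2 * m - 1.
    partial_deriv j (matching_sum k) (\<lambda>j. D_quantity m j x) * partial_deriv a (\<lambda>x. D_quantity m j x) x)"
    unfolding D_integral_compose
    by (rule partial_deriv_compose[OF reg_polynomial[OF polynomial_matching_sum[OF subset_refl]]])
      (rule reg_D_quantity'[OF x])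
  then show ?thesis by (simp only: partial_deriv_matching_sum cong: sum.cong)
qed

lemma D_integrals_commute:
  "\<forall>\<^sub>F x in gen (2 * m). poisson_bracket (2 * m) D_bracket (D_integral m k) (D_integral m l) x = 0"
  unfolding D_integral_compose
proof (rule matching_sums_commute[OF refl])
  show "reg (2 * m) (\<lambda>_. 1) (D_quantity m i)" if "i \<in> {1..2 * m - 1}" for i
    by (rule reg_D_quantity'[OF _ that]) simp
  show "\<forall>\<^sub>F x in gen (2 * m). poisson_bracket (2 * m) D_bracket (D_quantity m i) (D_quantity m j) x =
    zigzag_sign i j * (D_quantity m i x * D_quantity m j x - (if {i, j} \<in> zigzag_edges (2 * m - 1) then 1 else 0))"
    if "i \<in> {1..2 * m - 1}" "j \<in> {1..2 * m - 1}" for i j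
    by (rule eventually_mono[OF eventually_coords_nonzero]) (rule D_quantity_bracket[OF m that])
qed

lemma D_integral_invariant: "\<forall>\<^sub>F x in gen (2 * m). D_integral m k (D_map (2 * m + 1) x) = D_integral m k x"
proof -
  note E = poisson_map_D_even_step[OF m] and O = poisson_map_D_odd_step[OF m]
  have "\<forall>\<^sub>F x in gen (2 * m). \<forall>i\<in>{1..2 * m}. D_even_step (2 * m + 1) x i \<noteq> 0"
    by (rule eventually_poisson_map[OF E eventually_coords_nonzero])
  moreover have "\<forall>\<^sub>F x in gen (2 * m). \<forall>i\<in>{1..2 * m}. D_odd_step (2 * m + 1) (D_even_step (2 * m + 1) x) i \<noteq> 0"
    by (rule eventually_poisson_map[OF E eventually_poisson_map[OF O eventually_coords_nonzero]])
  ultimately show ?thesis using eventually_coords_nonzero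
  proof eventually_elim
    case (elim x)
    let ?y = "D_even_step (2 * m + 1) x"
    have odd: "\<forall>i\<in>{1..2 * m}. D_odd_step (2 * m + 1) ?y i = (if even i = False then D_exchange m i ?y / ?y i else ?y i)"
      and even: "\<forall>i\<in>{1..2 * m}. ?y i = (if even i = True then D_exchange m i x / x i else x i)"
      using D_odd_step_exchange[OF m, of _ ?y] D_even_step_exchange[OF m, of _ x] by simp_all
    have "D_integral m k (D_odd_step (2 * m + 1) ?y) = D_integral m k ?y"
      by (rule D_integral_half[OF m elim(1,2) odd])
    also have "\<dots> = D_integral m k x"
      by (rule D_integral_half[OF m elim(3,1) even])
    finally show ?case by (simp add: D_map_def)
  qed
qed

text \<open>Independence is read off along \<open>x i = t ^ i\<close> as \<open>t\<close> tends to \<open>0\<close>: there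
  \<open>D_quantity m j x\<close> is asymptotic to \<open>1 / (x j * x (j + 1))\<close>, and the dominant terms of the
  \<open>k\<close>-th integral come from the matchings of \<open>{1..2 k}\<close>.\<close>

definition top_weight :: "nat \<Rightarrow> nat" where
  "top_weight k = (\<Sum>i=2 * k + 1..2 * m - 1. 2 * i + 1)"

text \<open>Every dominant matching and every label \<open>j\<close> left uncovered by it contribute
  minus the exponent of \<open>x a\<close> in \<open>x j * x (j + 1)\<close>.\<close>

definition limit_entry :: "nat \<Rightarrow> nat \<Rightarrow> complex" where
  "limit_entry a k = (\<Sum>j=1..2 * m - 1. \<Sum>S\<in>{S \<in> matchings k. j \<notin> \<Union>S}.
     ind ({1..2 * m - 1} - \<Union>S = {2 * k + 1..2 * m - 1}) * - (ind (a = j) + ind (a = j + 1)))"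

text \<open>A dominant matching of size \<open>k\<close> covers the labels up to
  \<open>2 * k\<close>, so the leading monomial involves only coordinates with index at least
  \<open>2 * k + 1\<close>.\<close>

lemma limit_entry_above: "l < k \<Longrightarrow> limit_entry (2 * l + 1) k = 0"
  unfolding limit_entry_def
proof (intro sum.neutral ballI)
  fix j S assume l: "l < k" and j: "j \<in> {1..2 * m - 1}" and S: "S \<in> {S \<in> matchings k. j \<notin> \<Union>S}"
  have "2 * k + 1 \<le> j" if "{1..2 * m - 1} - \<Union>S = {2 * k + 1..2 * m - 1}"
  proof -
    have "j \<in> {1..2 * m - 1} - \<Union>S" using j S by blast
    then show ?thesis unfolding that by simp
  qed
  then show "ind ({1..2 * m - 1} - \<Union>S = {2 * k + 1..2 * m - 1}) * - (ind (2 * l + 1 = j) + ind (2 * l + 1 = j + 1)) = 0"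
    using l by (cases "{1..2 * m - 1} - \<Union>S = {2 * k + 1..2 * m - 1}") simp_all
qed

text \<open>The coordinate \<open>x (2 * k + 1)\<close> could enter through the labels
  \<open>2 * k\<close> and \<open>2 * k + 1\<close>, but the first is covered. All contributions
  equal -1, so their number, positive by \<open>ex_initial_matching\<close>, cannot cancel
  out.\<close>

lemma limit_entry_diagonal:
  assumes "k < m" shows "limit_entry (2 * k + 1) k \<noteq> 0"
proof -
  let ?V = "{1..2 * m - 1}" and ?top = "{2 * k + 1..2 * m - 1}"
  let ?A = "{S \<in> matchings k. ?V - \<Union>S = ?top}"
  have "2 * k < 2 * m - 1" using assms by linarith
  from ex_initial_matching[OF this]
  obtain S where "S \<subseteq> zigzag_edges (2 * m - 1)" "finite S" "card S = k" "pairwise disjnt S" "\<Union>S = {1..2 * k}"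
    by (elim exE conjE)
  then have SA: "S \<in> ?A" unfolding matchings_def by auto
  have fin: "finite ?A" by (rule finite_subset[OF _ finite_matchings]) (rule Collect_restrict)
  have pos: "card ?A \<noteq> 0"
    unfolding card_0_eq[OF fin] using SA by (rule ex_in_conv[THEN iffD1, OF exI])
  have "limit_entry (2 * k + 1) k = (\<Sum>j=1..2 * m - 1. if j = 2 * k + 1 then - of_nat (card ?A) else 0)"
    unfolding limit_entry_def
  proof (rule sum.cong)
    fix j assume j: "j \<in> ?V"
    have "(\<Sum>S\<in>{S \<in> matchings k. j \<notin> \<Union>S}. ind (?V - \<Union>S = ?top) * - (ind (2 * k + 1 = j) + ind (2 * k + 1 = j + 1))) =
      (\<Sum>S\<in>?A. if j = 2 * k + 1 then - 1 else 0)"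
    proof (rule sum.mono_neutral_cong)
      show "ind (?V - \<Union>S = ?top) * - (ind (2 * k + 1 = j) + ind (2 * k + 1 = j + 1)) = 0"
        if "S \<in> {S \<in> matchings k. j \<notin> \<Union>S} - ?A" for S using that by simp
      show "(if j = 2 * k + 1 then - 1 else 0) = (0 :: complex)" if S: "S \<in> ?A - {S \<in> matchings k. j \<notin> \<Union>S}" for S
      proof -
        have "j \<notin> ?top" using S by blast
        then show ?thesis using assms by auto
      qed
      show "ind (?V - \<Union>S = ?top) * - (ind (2 * k + 1 = j) + ind (2 * k + 1 = j + 1)) = (if j = 2 * k + 1 then - 1 else 0)"
        if S: "S \<in> {S \<in> matchings k. j \<notin> \<Union>S} \<inter> ?A" for S
      proof -
        have "j \<in> ?top" using S j by blast
        then show ?thesis using S by auto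
      qed
    qed (rule fin finite_subset[OF Collect_restrict finite_matchings])+
    then show "(\<Sum>S\<in>{S \<in> matchings k. j \<notin> \<Union>S}. ind (?V - \<Union>S = ?top) * - (ind (2 * k + 1 = j) + ind (2 * k + 1 = j + 1))) =
      (if j = 2 * k + 1 then - of_nat (card ?A) else 0)" by simp
  qed simp
  also have "\<dots> = - of_nat (card ?A)" using assms by simp
  finally show ?thesis using pos by simp
qed

lemma tendsto_D_integral_derivative:
  assumes a: "a \<in> {1..2 * m}" and k: "k < m"
  shows "((\<lambda>t. t ^ top_weight k * (t ^ a * partial_deriv a (D_integral m k) (\<lambda>i. t ^ i))) \<longlongrightarrow> limit_entry a k) (at 0)"
proof -
  let ?V = "{1..2 * m - 1}"
  define X where "X t = (\<lambda>i. t ^ i)" for t :: complex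
  define N where "N j t = 1 + D_ext m (X t) (j - 1) * X t (j + 1) + X t j * D_ext m (X t) (j + 2)" for j t
  \<comment> \<open>On the curve the \<open>j\<close>-th quantity is
    \<open>N j t / t ^ (2 * j + 1)\<close> and its logarithmic derivative in direction
    \<open>a\<close> is \<open>\<tau> j t / t ^ (2 * j + 1)\<close>. Since \<open>N j\<close> tends
    to 1, \<open>w S\<close> is the pole order of the monomial of the matching
    \<open>S\<close>.\<close>
  define \<tau> where "\<tau> j t = - N j t * (ind (a = j) + ind (a = j + 1)) +
     D_left j (X t) * ind (a + 1 = j \<or> a = j + 1) + D_right m j (X t) * ind (a = j \<or> a = j + 2)" for j t
  define w where "w S = (\<Sum>i\<in>?V - \<Union>S. 2 * i + 1)" for S
  have N1: "(N j \<longlongrightarrow> 1) (at 0)" if "j \<in> ?V" for j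
  proof -
    have "((\<lambda>t. D_ext m (X t) i) \<longlongrightarrow> (if i = 0 \<or> i = 2 * m + 1 then 2 else 0)) (at 0)" for i
    proof -
      consider "i = 0" | "i = 2 * m + 1" | "i \<noteq> 0" "i \<noteq> 2 * m + 1" by blast
      then show ?thesis
        by cases (use m in \<open>auto simp: D_ext_def X_def intro!: tendsto_eq_intros\<close>)
    qed
    note ext = this[of "j - 1"] this[of "j + 2"]
    have "((\<lambda>t. X t i) \<longlongrightarrow> 0) (at 0)" if "1 \<le> i" for i
      unfolding X_def using that by (auto intro!: tendsto_eq_intros)
    then have "((\<lambda>t. X t j) \<longlongrightarrow> 0) (at 0)" "((\<lambda>t. X t (j + 1)) \<longlongrightarrow> 0) (at 0)" using that by auto
    then show ?thesis
      unfolding N_def[abs_def] using ext by (auto intro!: tendsto_eq_intros)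
  qed
  have left: "((\<lambda>t. D_left j (X t)) \<longlongrightarrow> 0) (at 0)" if "j \<in> ?V" for j
    unfolding D_left_def X_def by (cases "j = 1") (auto intro!: tendsto_eq_intros)
  have right: "((\<lambda>t. D_right m j (X t)) \<longlongrightarrow> 0) (at 0)" if "j \<in> ?V" for j
    unfolding D_right_def X_def using that by (cases "j = 2 * m - 1") (auto intro!: tendsto_eq_intros)
  have tau: "(\<tau> j \<longlongrightarrow> - (ind (a = j) + ind (a = j + 1))) (at 0)" if "j \<in> ?V" for j
  proof -
    have "(\<tau> j \<longlongrightarrow> - 1 * (ind (a = j) + ind (a = j + 1)) + 0 * ind (a + 1 = j \<or> a = j + 1) +
      0 * ind (a = j \<or> a = j + 2)) (at 0)"
      unfolding \<tau>_def[abs_def] by (intro tendsto_intros N1 left right that)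
    then show ?thesis by simp
  qed
  have w: "w S \<le> top_weight k" "w S = top_weight k \<longleftrightarrow> ?V - \<Union>S = {2 * k + 1..2 * m - 1}"
    if S: "S \<in> matchings k" for S
  proof -
    have sub: "\<Union>S \<subseteq> ?V" using S edge_subset unfolding matchings_def by blast
    have "card (?V - \<Union>S) = (2 * m - 1) - 2 * k"
      using card_Union_matching[OF S] card_Diff_subset[OF finite_subset[OF sub finite_V] sub] by simp
    moreover have "2 * k \<le> 2 * m - 1" using k by linarith
    ultimately have less: "w S < top_weight k" if "?V - \<Union>S \<noteq> {2 * k + 1..2 * m - 1}"
      unfolding w_def top_weight_def using that by (intro sum_weight_less[OF Diff_subset])
    have eq: "w S = top_weight k" if "?V - \<Union>S = {2 * k + 1..2 * m - 1}"
      unfolding w_def top_weight_def that ..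
    show "w S \<le> top_weight k" "w S = top_weight k \<longleftrightarrow> ?V - \<Union>S = {2 * k + 1..2 * m - 1}"
      using less eq less_imp_le less_irrefl order_refl by metis+
  qed
  have "((\<lambda>t. \<Sum>j\<in>?V. \<Sum>S\<in>{S \<in> matchings k. j \<notin> \<Union>S}.
      t ^ (top_weight k - w S) * (\<Prod>i\<in>?V - \<Union>S - {j}. N i t) * \<tau> j t) \<longlongrightarrow> limit_entry a k) (at 0)"
    unfolding limit_entry_def
  proof (intro tendsto_sum)
    fix j S assume j: "j \<in> ?V" and "S \<in> {S \<in> matchings k. j \<notin> \<Union>S}"
    then have S: "S \<in> matchings k" by simp
    have "((\<lambda>t::complex. t ^ (top_weight k - w S)) \<longlongrightarrow> 0 ^ (top_weight k - w S)) (at 0)"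
      by (intro tendsto_intros)
    moreover have "(0 :: complex) ^ (top_weight k - w S) = ind (?V - \<Union>S = {2 * k + 1..2 * m - 1})"
      using w[OF S] by (auto simp: power_0_left)
    moreover have "((\<lambda>t. \<Prod>i\<in>?V - \<Union>S - {j}. N i t) \<longlongrightarrow> (\<Prod>i\<in>?V - \<Union>S - {j}. 1)) (at 0)"
      by (intro tendsto_prod N1) auto
    ultimately have "((\<lambda>t. t ^ (top_weight k - w S) * (\<Prod>i\<in>?V - \<Union>S - {j}. N i t) * \<tau> j t) \<longlongrightarrow>
      ind (?V - \<Union>S = {2 * k + 1..2 * m - 1}) * (\<Prod>i\<in>?V - \<Union>S - {j}. 1) * - (ind (a = j) + ind (a = j + 1))) (at 0)"
      by (intro tendsto_mult tau[OF j]) simp_all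
    then show "((\<lambda>t. t ^ (top_weight k - w S) * (\<Prod>i\<in>?V - \<Union>S - {j}. N i t) * \<tau> j t) \<longlongrightarrow>
      ind (?V - \<Union>S = {2 * k + 1..2 * m - 1}) * - (ind (a = j) + ind (a = j + 1))) (at 0)"
      by (simp only: prod.neutral_const mult_1_right)
  qed
  moreover have "\<forall>\<^sub>F t in at 0. (\<Sum>j\<in>?V. \<Sum>S\<in>{S \<in> matchings k. j \<notin> \<Union>S}.
      t ^ (top_weight k - w S) * (\<Prod>i\<in>?V - \<Union>S - {j}. N i t) * \<tau> j t) =
      t ^ top_weight k * (t ^ a * partial_deriv a (D_integral m k) (\<lambda>i. t ^ i))"
    unfolding eventually_at_filter
  proof (rule always_eventually, intro allI impI)
    fix t :: complex assume t: "t \<noteq> 0"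
    have nz: "\<forall>i\<in>{1..2 * m}. X t i \<noteq> 0" using t by (simp add: X_def)
    have J0: "D_quantity m j (X t) = N j t / (X t j * X t (j + 1))" for j
      by (simp add: D_quantity_def N_def)
    have XX: "X t j * X t (j + 1) = t ^ (2 * j + 1)" for j
      by (simp add: X_def power_add[symmetric] mult_2)
    note J = J0[unfolded XX]
    have J': "D_quantity m j (X t) * X t j * X t (j + 1) = N j t" for j
      unfolding mult.assoc XX J using t by simp
    have "t ^ top_weight k * (t ^ a * partial_deriv a (D_integral m k) (X t)) =
      (\<Sum>j\<in>?V. t ^ top_weight k * (d_matching_sum k j (\<lambda>j. D_quantity m j (X t)) *
        (X t a * partial_deriv a (D_quantity m j) (X t))))"
      unfolding partial_deriv_D_integral[OF nz] by (simp add: X_def sum_distrib_left mult_ac)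
    also have "\<dots> = (\<Sum>j\<in>?V. \<Sum>S\<in>{S \<in> matchings k. j \<notin> \<Union>S}.
      t ^ (top_weight k - w S) * (\<Prod>i\<in>?V - \<Union>S - {j}. N i t) * \<tau> j t)"
    proof (rule sum.cong)
      fix j assume j: "j \<in> ?V"
      have xj: "X t j \<noteq> 0" "X t (j + 1) \<noteq> 0" using t by (simp_all add: X_def)
      have theta: "X t a * partial_deriv a (D_quantity m j) (X t) = (1 / t ^ (2 * j + 1)) * \<tau> j t"
        unfolding theta_D_quantity[OF m j xj a] J' \<tau>_def
        by (simp add: X_def power_add[symmetric] mult_2)
      show "t ^ top_weight k * (d_matching_sum k j (\<lambda>j. D_quantity m j (X t)) *
        (X t a * partial_deriv a (D_quantity m j) (X t))) = (\<Sum>S\<in>{S \<in> matchings k. j \<notin> \<Union>S}.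
      t ^ (top_weight k - w S) * (\<Prod>i\<in>?V - \<Union>S - {j}. N i t) * \<tau> j t)"
        unfolding d_matching_sum_def sum_distrib_left sum_distrib_right theta
      proof (rule sum.cong)
        fix S assume S: "S \<in> {S \<in> matchings k. j \<notin> \<Union>S}"
        have "w S = (2 * j + 1) + (\<Sum>i\<in>?V - \<Union>S - {j}. 2 * i + 1)"
          unfolding w_def using S j by (intro sum.remove) auto
        then have tw: "t ^ w S = t ^ (2 * j + 1) * (\<Prod>i\<in>?V - \<Union>S - {j}. t ^ (2 * i + 1))"
          by (simp only: power_add power_sum)
        have "t ^ top_weight k = t ^ (top_weight k - w S) * t ^ w S"
          using w(1)[of S] S by (simp add: power_add[symmetric])
        then show "t ^ top_weight k * ((\<Prod>i\<in>?V - \<Union>S - {j}. D_quantity m i (X t)) * (1 / t ^ (2 * j + 1) * \<tau> j t)) =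
          t ^ (top_weight k - w S) * (\<Prod>i\<in>?V - \<Union>S - {j}. N i t) * \<tau> j t"
          unfolding tw J prod_dividef using t by simp
      qed simp
    qed simp
    finally show "(\<Sum>j\<in>?V. \<Sum>S\<in>{S \<in> matchings k. j \<notin> \<Union>S}.
      t ^ (top_weight k - w S) * (\<Prod>i\<in>?V - \<Union>S - {j}. N i t) * \<tau> j t) =
      t ^ top_weight k * (t ^ a * partial_deriv a (D_integral m k) (\<lambda>i. t ^ i))"
      unfolding X_def by simp
  qed
  ultimately show ?thesis by (rule Lim_transform_eventually)
qed

text \<open>The derivatives in the odd-indexed directions, after rows and columns are scaled by
  powers of \<open>t\<close>, converge to a triangular matrix with nonzero diagonal. The determinant
  is therefore nonzero for some small nonzero \<open>t\<close>, and the scaling does not affect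
  independence.\<close>

lemma D_integrals_independent: "functionally_independent (2 * m) m (\<lambda>i. D_integral m (i - 1))"
proof -
  define A where "A t l i = t ^ top_weight (i - 1) *
    (t ^ (2 * l - 1) * partial_deriv (2 * l - 1) (D_integral m (i - 1)) (\<lambda>j. t ^ j))" for t :: complex and l i
  define T where "T l i = limit_entry (2 * l - 1) (i - 1)" for l i
  have T_above: "T l i = 0" if "1 \<le> l" "l < i" for l i
  proof -
    have "2 * l - 1 = 2 * (l - 1) + 1" using that by simp
    then show ?thesis unfolding T_def using limit_entry_above[of "l - 1" "i - 1"] that by simp
  qed
  have T_diag: "T l l \<noteq> 0" if "l \<in> {1..m}" for l
  proof -
    have "2 * l - 1 = 2 * (l - 1) + 1" "l - 1 < m" using that by auto
    then show ?thesis unfolding T_def using limit_entry_diagonal[of "l - 1"] by metis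
  qed
  have "det (mat m m (\<lambda>(l, i). T (Suc l) (Suc i))) \<noteq> 0"
    unfolding det_nonzero_iff_injective
  proof (intro allI impI)
    fix c assume c: "\<forall>l\<in>{1..m}. (\<Sum>i=1..m. c i * T l i) = 0"
    have "l \<in> {1..m} \<Longrightarrow> c l = 0" for l
    proof (induction l rule: less_induct)
      case (less l)
      have "(\<Sum>i=1..m. c i * T l i) = (\<Sum>i=1..m. if i = l then c l * T l l else 0)"
      proof (rule sum.cong)
        fix i assume i: "i \<in> {1..m}"
        show "c i * T l i = (if i = l then c l * T l l else 0)"
          using less.IH[of i] T_above[of l i] i less.prems by (cases i l rule: linorder_cases) auto
      qed simp
      then show ?case using c less.prems T_diag by simp
    qed
    then show "\<forall>i\<in>{1..m}. c i = 0" by blast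
  qed
  moreover have "((\<lambda>t. det (mat m m (\<lambda>(l, i). A t (Suc l) (Suc i)))) \<longlongrightarrow>
      det (mat m m (\<lambda>(l, i). T (Suc l) (Suc i)))) (at 0)"
    unfolding A_def T_def by (intro tendsto_det tendsto_D_integral_derivative) auto
  ultimately have "\<forall>\<^sub>F t in at 0. det (mat m m (\<lambda>(l, i). A t (Suc l) (Suc i))) \<noteq> 0"
    by (rule tendsto_imp_eventually_ne[rotated])
  moreover have "\<forall>\<^sub>F t in at (0 :: complex). t \<noteq> 0"
    by (simp add: eventually_at_filter)
  ultimately have "\<forall>\<^sub>F t in at 0. det (mat m m (\<lambda>(l, i). A t (Suc l) (Suc i))) \<noteq> 0 \<and> t \<noteq> 0"
    by (rule eventually_conj)
  then obtain t where t: "det (mat m m (\<lambda>(l, i). A t (Suc l) (Suc i))) \<noteq> 0" "t \<noteq> 0"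
    using eventually_happens[of _ "at (0 :: complex)"] by auto
  show ?thesis
  proof (rule functionally_independentI[where a = "\<lambda>j. t ^ j" and \<kappa> = "\<lambda>l. 2 * l - 1"])
    show "reg (2 * m) (\<lambda>j. t ^ j) (D_integral m (i - 1))" for i
      using t by (intro reg_D_integral) simp
    show "2 * l - 1 \<in> {1..2 * m}" if "l \<in> {1..m}" for l using that by auto
    fix c assume c: "\<And>l. l \<in> {1..m} \<Longrightarrow>
      (\<Sum>i=1..m. c i * partial_deriv (2 * l - 1) (D_integral m (i - 1)) (\<lambda>j. t ^ j)) = 0"
    \<comment> \<open>Dividing \<open>c i\<close> by its power of \<open>t\<close> absorbs the
      column scaling; the row scaling is the common factor \<open>t ^ (2 * l - 1)\<close> of the
      sum.\<close>
    have "\<forall>l\<in>{1..m}. (\<Sum>i=1..m. (c i / t ^ top_weight (i - 1)) * A t l i) = 0"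
    proof
      fix l assume l: "l \<in> {1..m}"
      have "(\<Sum>i=1..m. (c i / t ^ top_weight (i - 1)) * A t l i) =
        (\<Sum>i=1..m. t ^ (2 * l - 1) * (c i * partial_deriv (2 * l - 1) (D_integral m (i - 1)) (\<lambda>j. t ^ j)))"
        unfolding A_def using t by (intro sum.cong refl) simp
      also have "\<dots> = 0" unfolding sum_distrib_left[symmetric] c[OF l] by simp
      finally show "(\<Sum>i=1..m. (c i / t ^ top_weight (i - 1)) * A t l i) = 0" .
    qed
    with t(1)[unfolded det_nonzero_iff_injective, THEN spec]
    have "\<forall>i\<in>{1..m}. c i / t ^ top_weight (i - 1) = 0"
      by (rule mp)
    then show "\<forall>i\<in>{1..m}. c i = 0" using t by simp
  qed
qed

lemma D_map_completely_integrable: "completely_integrable m D_form (D_map (2 * m + 1))"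
proof (rule completely_integrableI[where C = D_bracket and I = "\<lambda>i. D_integral m (i - 1)" and a = "\<lambda>_. 1"])
  show "skew_on (2 * m) D_form" unfolding skew_on_def by (intro ballI D_form_skew)
  show "reg (2 * m) (\<lambda>_. 1) (D_integral m (i - 1))" for i by (rule reg_D_integral) simp
qed (rule D_form_inverse poisson_map_D_map[OF m] D_integral_invariant D_integrals_independent D_integrals_commute)+

end

section \<open>Type E\<close>

text \<open>For the quantities attached to the nonhomogeneous tubes the brackets are \<open>\<pm> (f g - c)\<close> with
  \<open>c \<in> {0, 1}\<close>, or zero, and the half steps permute the quantities while changing the sign of the
  bracket, so that a few brackets determine all others.\<close>

definition pulls_back :: "nat \<Rightarrow> ((nat \<Rightarrow> complex) \<Rightarrow> nat \<Rightarrow> complex) \<Rightarrow>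
    ((nat \<Rightarrow> complex) \<Rightarrow> complex) \<Rightarrow> ((nat \<Rightarrow> complex) \<Rightarrow> complex) \<Rightarrow> bool" where
  "pulls_back n \<iota> f f' \<longleftrightarrow> (\<exists>a. reg n a f') \<and> (\<forall>\<^sub>F x in gen n. f (\<iota> x) = f' x)"

definition bracket_law :: "nat \<Rightarrow> complex \<Rightarrow> complex \<Rightarrow>
    ((nat \<Rightarrow> complex) \<Rightarrow> complex) \<Rightarrow> ((nat \<Rightarrow> complex) \<Rightarrow> complex) \<Rightarrow> bool" where
  "bracket_law n s c f g \<longleftrightarrow> (\<exists>a. reg n a f) \<and> (\<exists>a. reg n a g) \<and>
     (\<forall>\<^sub>F x in gen n. poisson_bracket n E_bracket f g x = s * (f x * g x - c))"

lemma bracket_lawD: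
  "bracket_law n s c f g \<Longrightarrow> \<forall>\<^sub>F x in gen n. poisson_bracket n E_bracket f g x = s * (f x * g x - c)"
  by (simp add: bracket_law_def)

lemma pulls_backD: "pulls_back n \<iota> f f' \<Longrightarrow> \<forall>\<^sub>F x in gen n. f (\<iota> x) = f' x"
  by (simp add: pulls_back_def)

text \<open>Pulling back along an anti-Poisson map negates the bracket, so a law for
  \<open>f\<close>, \<open>g\<close> passes to their images with the opposite sign and the same
  constant \<open>c\<close>.\<close>

lemma bracket_transport:
  assumes pm: "poisson_map n E_bracket (- 1) \<iota>"
    and f: "pulls_back n \<iota> f f'" and g: "pulls_back n \<iota> g g'" and br: "bracket_law n s c f g"
  shows "bracket_law n (- s) c f' g'"
proof -
  from br obtain a b where reg: "reg n a f" "reg n b g" by (auto simp: bracket_law_def)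
  have f: "\<forall>\<^sub>F x in gen n. f (\<iota> x) = f' x" "\<exists>a. reg n a f'"
    and g: "\<forall>\<^sub>F x in gen n. g (\<iota> x) = g' x" "\<exists>a. reg n a g'"
    using assms by (simp_all add: pulls_back_def)
  have "\<forall>\<^sub>F x in gen n. poisson_bracket n E_bracket f' g' x = - s * (f' x * g' x - c)"
    using poisson_map_bracket[OF pm reg] eventually_poisson_map[OF pm bracket_lawD[OF br]] f(1) g(1)
      eventually_partial_deriv_cong[OF f(1)] eventually_partial_deriv_cong[OF g(1)]
  proof eventually_elim
    case (elim x)
    have "poisson_bracket n E_bracket f' g' x = poisson_bracket n E_bracket (\<lambda>y. f (\<iota> y)) (\<lambda>y. g (\<iota> y)) x"
      using elim by (simp add: poisson_bracket_def)
    then show ?case using elim by simp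
  qed
  then show ?thesis using f g by (simp add: bracket_law_def)
qed

section \<open>Types E: Leibniz rules, half steps and a common criterion\<close>

lemma poisson_bracket_add_left:
  "reg n x f \<Longrightarrow> reg n x g \<Longrightarrow>
    poisson_bracket n C (\<lambda>x. f x + g x) h x = poisson_bracket n C f h x + poisson_bracket n C g h x"
  unfolding poisson_bracket_def by (simp add: partial_deriv_add algebra_simps sum.distrib)

lemma poisson_bracket_add_right:
  "reg n x f \<Longrightarrow> reg n x g \<Longrightarrow>
    poisson_bracket n C h (\<lambda>x. f x + g x) x = poisson_bracket n C h f x + poisson_bracket n C h g x"
  unfolding poisson_bracket_def by (simp add: partial_deriv_add algebra_simps sum.distrib)

lemma poisson_bracket_mult_left:
  "reg n x f \<Longrightarrow> reg n x g \<Longrightarrow>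
    poisson_bracket n C (\<lambda>x. f x * g x) h x = f x * poisson_bracket n C g h x + g x * poisson_bracket n C f h x"
  unfolding poisson_bracket_def by (simp add: partial_deriv_mult algebra_simps sum.distrib sum_distrib_left)

lemma poisson_bracket_mult_right:
  "reg n x f \<Longrightarrow> reg n x g \<Longrightarrow>
    poisson_bracket n C h (\<lambda>x. f x * g x) x = f x * poisson_bracket n C h g x + g x * poisson_bracket n C h f x"
  unfolding poisson_bracket_def by (simp add: partial_deriv_mult algebra_simps sum.distrib sum_distrib_left)

lemmas poisson_bracket_leibniz =
  poisson_bracket_add_left poisson_bracket_add_right poisson_bracket_mult_left poisson_bracket_mult_right

lemma E_bracket_skew: "E_bracket j i = - E_bracket i j"
  by (auto simp: E_bracket_def)

lemma E_form_skew: "skew_on n E_form"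
  unfolding skew_on_def E_form_def by (intro ballI, subst E_bracket_skew) (rule refl)

lemma E_bracket_row:
  assumes "i \<in> {1..2 * m}"
  shows "(\<Sum>b=1..2 * m. E_bracket i b * g b) = (if odd i then g (i + 1) else - g (i - 1))"
proof -
  define k where "k = (if odd i then i + 1 else i - 1)"
  have "k \<in> {1..2 * m}" using assms unfolding k_def by (cases "odd i") (auto; presburger)+
  have "(\<Sum>b=1..2 * m. E_bracket i b * g b) = (\<Sum>b\<in>{k}. E_bracket i b * g b)"
    using \<open>k \<in> {1..2 * m}\<close> assms by (intro sum.mono_neutral_right) (auto simp: E_bracket_def k_def)
  also have "\<dots> = (if odd i then g (i + 1) else - g (i - 1))"
    using assms by (auto simp: E_bracket_def k_def)
  finally show ?thesis .
qed

lemma poisson_bracket_E: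
  "poisson_bracket (2 * m) E_bracket f g x = (\<Sum>k<m. x (2 * k + 1) * x (2 * k + 2) *
     (partial_deriv (2 * k + 1) f x * partial_deriv (2 * k + 2) g x -
      partial_deriv (2 * k + 2) f x * partial_deriv (2 * k + 1) g x))"
proof -
  define h where "h i = (\<Sum>b=1..2 * m. E_bracket i b * (x i * partial_deriv i f x * (x b * partial_deriv b g x)))" for i
  have h: "h i = (if odd i then x i * partial_deriv i f x * (x (i + 1) * partial_deriv (i + 1) g x)
      else - (x i * partial_deriv i f x * (x (i - 1) * partial_deriv (i - 1) g x)))" if "i \<in> {1..2 * m}" for i
    unfolding h_def E_bracket_row[OF that] ..
  have "poisson_bracket (2 * m) E_bracket f g x = (\<Sum>i=1..2 * m. h i)"
    unfolding poisson_bracket_def h_def by (simp add: mult_ac)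
  also have "\<dots> = (\<Sum>k<m. h (2 * k + 1) + h (2 * k + 2))"
    by (induction m) (simp_all add: add.assoc)
  also have "\<dots> = (\<Sum>k<m. x (2 * k + 1) * x (2 * k + 2) *
     (partial_deriv (2 * k + 1) f x * partial_deriv (2 * k + 2) g x -
      partial_deriv (2 * k + 2) f x * partial_deriv (2 * k + 1) g x))"
  proof (intro sum.cong refl)
    fix k assume "k \<in> {..<m}"
    then have k: "2 * k + 1 \<in> {1..2 * m}" "2 * k + 2 \<in> {1..2 * m}" by auto
    show "h (2 * k + 1) + h (2 * k + 2) = x (2 * k + 1) * x (2 * k + 2) *
     (partial_deriv (2 * k + 1) f x * partial_deriv (2 * k + 2) g x -
      partial_deriv (2 * k + 2) f x * partial_deriv (2 * k + 1) g x)"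
    proof -
      have "odd (2 * k + 1)" "even (2 * k + 2)" "2 * k + 1 + 1 = 2 * k + 2" "2 * k + 2 - 1 = 2 * k + 1" by auto
      then show ?thesis
        unfolding h[OF k(1)] h[OF k(2)] by (simp only: if_True if_False not_True_eq_False not_False_eq_True) (simp add: algebra_simps del: One_nat_def add_2_eq_Suc' add_Suc_right)
    qed
  qed
  finally show ?thesis .
qed

definition E_even_step :: "nat \<Rightarrow> (nat \<Rightarrow> complex) \<Rightarrow> nat \<Rightarrow> complex" where
  "E_even_step n x i = (if i \<in> {1..n} \<and> even i then (1 + x (i - 1)) / x i else x i)"

text \<open>Each mutated coordinate has a single frozen partner \<open>p i\<close>. With v_i = log
  (x i) and u_i = log (x (p i)), the half step is v_i -> log F_i - v_i with u fixed, and
  \<open>sym\<close> says that the derivative of log F_j by u_i is symmetric in i and j, that is,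
  that log F is a gradient.\<close>

lemma poisson_map_E_half:
  assumes \<Phi>: "\<And>x i. i \<in> {1..2 * m} \<Longrightarrow> \<Phi> x i = (if even i = e then F i x / x i else x i)"
    and poly: "\<And>i. i \<in> {1..2 * m} \<Longrightarrow> even i = e \<Longrightarrow> polynomial_fun (2 * m) (F i)"
    and nz: "\<And>i. i \<in> {1..2 * m} \<Longrightarrow> even i = e \<Longrightarrow> \<exists>x. F i x \<noteq> 0"
    and frozen: "\<And>i x y. i \<in> {1..2 * m} \<Longrightarrow> even i = e \<Longrightarrow>
      (\<And>j. j \<in> {1..2 * m} \<Longrightarrow> even j \<noteq> e \<Longrightarrow> x j = y j) \<Longrightarrow> F i x = F i y"
    and sym: "\<And>i j x. i \<in> {1..2 * m} \<Longrightarrow> j \<in> {1..2 * m} \<Longrightarrow> even i = e \<Longrightarrow> even j = e \<Longrightarrow> i < j \<Longrightarrow>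
      (let p = (\<lambda>i. if e then i - 1 else i + 1) in
      F i x * (x (p i) * partial_deriv (p i) (F j) x) = F j x * (x (p j) * partial_deriv (p j) (F i) x))"
  shows "poisson_map (2 * m) E_bracket (- 1) \<Phi>"
proof (rule poisson_map_half_step[where S = "{i \<in> {1..2 * m}. even i = e}" and F = F])
  fix i j x assume ij: "i \<in> {i \<in> {1..2 * m}. even i = e}" "j \<in> {i \<in> {1..2 * m}. even i = e}"
  define p where "p i = (if e then i - 1 else i + 1)" for i :: nat
  have row: "(\<Sum>b=1..2 * m. E_bracket i b * x b * partial_deriv b G x) =
    (if e then - 1 else 1) * (x (p i) * partial_deriv (p i) G x)" if "i \<in> {i \<in> {1..2 * m}. even i = e}" for i G
    using E_bracket_row[of i m "\<lambda>b. x b * partial_deriv b G x"] that by (auto simp: p_def mult.assoc)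
  have less: "F i x * (x (p i) * partial_deriv (p i) (F j) x) = F j x * (x (p j) * partial_deriv (p j) (F i) x)"
    if "i < j" "i \<in> {i \<in> {1..2 * m}. even i = e}" "j \<in> {i \<in> {1..2 * m}. even i = e}" for i j
    using sym[of i j x] that unfolding p_def Let_def by blast
  have "F i x * (x (p i) * partial_deriv (p i) (F j) x) = F j x * (x (p j) * partial_deriv (p j) (F i) x)"
    using less[of i j] less[of j i] ij by (cases i j rule: linorder_cases) auto
  then show "F i x * (\<Sum>b=1..2 * m. E_bracket i b * x b * partial_deriv b (F j) x) =
    F j x * (\<Sum>b=1..2 * m. E_bracket j b * x b * partial_deriv b (F i) x)"
    unfolding row[OF ij(1)] row[OF ij(2)] by (simp add: algebra_simps)
next
  fix i j assume "(i \<in> {i \<in> {1..2 * m}. even i = e}) = (j \<in> {i \<in> {1..2 * m}. even i = e})"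
    "i \<in> {1..2 * m}" "j \<in> {1..2 * m}"
  then show "E_bracket i j = 0" by (auto simp: E_bracket_def)
next
  fix i and x y :: "nat \<Rightarrow> complex" assume "i \<in> {i \<in> {1..2 * m}. even i = e}"
    "\<And>j. j \<in> {1..2 * m} - {i \<in> {1..2 * m}. even i = e} \<Longrightarrow> x j = y j"
  then show "F i x = F i y" by (intro frozen) auto
qed (use \<Phi> poly nz in \<open>auto intro: E_bracket_skew\<close>)

text \<open>The exchange polynomial of \<open>i\<close> involves only the partner of
  \<open>i\<close>, so for distinct indices both sides of the symmetry condition vanish.\<close>

lemma poisson_map_E_even_step: "poisson_map (2 * m) E_bracket (- 1) (E_even_step (2 * m))"
proof (rule poisson_map_E_half[where e = True and F = "\<lambda>i x. 1 + x (i - 1)"])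
  fix i j :: nat and x :: "nat \<Rightarrow> complex"
  assume ij: "i \<in> {1..2 * m}" "j \<in> {1..2 * m}" "even i = True" "even j = True" "i < j"
  have pd: "partial_deriv k (\<lambda>x. 1 + x (l - 1)) x = ind (l - 1 = k)" for k l
    by (rule partial_deriv_eqI) (auto intro!: derivative_eq_intros)
  show "let p = \<lambda>i. if True then i - 1 else i + 1 in
     (1 + x (i - 1)) * (x (p i) * partial_deriv (p i) (\<lambda>x. 1 + x (j - 1)) x) =
     (1 + x (j - 1)) * (x (p j) * partial_deriv (p j) (\<lambda>x. 1 + x (i - 1)) x)"
    unfolding Let_def pd using ij by auto
next
  fix i assume i: "i \<in> {1..2 * m}" "even i = True"
  then have "i - 1 \<in> {1..2 * m}" by (auto elim!: evenE)
  then show "polynomial_fun (2 * m) (\<lambda>x. 1 + x (i - 1))"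
    by (intro polynomial_fun.intros) auto
  show "\<exists>x. 1 + x (i - 1) \<noteq> (0 :: complex)" by (rule exI[of _ "\<lambda>_. 0"]) simp
  fix x y :: "nat \<Rightarrow> complex" assume "\<And>j. j \<in> {1..2 * m} \<Longrightarrow> even j \<noteq> True \<Longrightarrow> x j = y j"
  then have "x (i - 1) = y (i - 1)" using i \<open>i - 1 \<in> {1..2 * m}\<close> by auto
  then show "1 + x (i - 1) = 1 + y (i - 1)" by simp
qed (auto simp: E_even_step_def)

lemma poisson_bracket_E_skew: "poisson_bracket n E_bracket g f x = - poisson_bracket n E_bracket f g x"
  by (rule poisson_bracket_skew) (rule E_bracket_skew)

lemma poisson_bracket_E_swap:
  "poisson_bracket n E_bracket f g x = c \<Longrightarrow> poisson_bracket n E_bracket g f x = - c"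
  by (simp only: poisson_bracket_E_skew[of n g f])

text \<open>\<open>I'\<close> stands for the integrals seen between the two half steps. It may
  differ from \<open>I\<close>: in type E6 each half step interchanges the two tubes, and only the
  full map fixes the integrals.\<close>

lemma completely_integrable_E:
  assumes map: "\<And>x. \<Phi> x = E_even_step (2 * m) (\<iota> x)" and pm: "poisson_map (2 * m) E_bracket (- 1) \<iota>"
    and reg: "\<And>i. i \<in> {1..m} \<Longrightarrow> reg (2 * m) a (I i)"
    and odd: "\<And>i. i \<in> {1..m} \<Longrightarrow> \<forall>\<^sub>F x in gen (2 * m). I' i (\<iota> x) = I i x"
    and even: "\<And>i. i \<in> {1..m} \<Longrightarrow> \<forall>\<^sub>F x in gen (2 * m). I i (E_even_step (2 * m) x) = I' i x"
    and inj: "\<And>c. (\<And>l. l \<in> {1..m} \<Longrightarrow> (\<Sum>i=1..m. c i * partial_deriv l (I i) a) = 0) \<Longrightarrow>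
      (\<forall>i\<in>{1..m}. c i = 0)"
    and invol: "\<And>i j. i \<in> {1..m} \<Longrightarrow> j \<in> {1..m} \<Longrightarrow> i < j \<Longrightarrow>
      \<forall>\<^sub>F x in gen (2 * m). poisson_bracket (2 * m) E_bracket (I i) (I j) x = 0"
  shows "completely_integrable m E_form \<Phi>"
proof (rule completely_integrableI[where C = E_bracket and a = a and I = I])
  show "skew_on (2 * m) E_form" by (rule E_form_skew)
  show "inverse_on (2 * m) E_form E_bracket" by (rule E_form_inverse)
  have "poisson_map (2 * m) E_bracket (- 1 * - 1) (\<lambda>x. E_even_step (2 * m) (\<iota> x))"
    by (rule poisson_map_compose[OF pm poisson_map_E_even_step])
  then show "poisson_map (2 * m) E_bracket 1 \<Phi>" by (simp add: map[abs_def])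
  show "functionally_independent (2 * m) m I"
    by (rule functionally_independentI[where \<kappa> = "\<lambda>l. l", OF reg _ inj]) auto
  fix i assume i: "i \<in> {1..m}"
  show "\<forall>\<^sub>F x in gen (2 * m). I i (\<Phi> x) = I i x"
    using eventually_poisson_map[OF pm even[OF i]] odd[OF i] by eventually_elim (simp add: map)
  fix j assume j: "j \<in> {1..m}"
  show "\<forall>\<^sub>F x in gen (2 * m). poisson_bracket (2 * m) E_bracket (I i) (I j) x = 0"
  proof (cases i j rule: linorder_cases)
    case less
    then show ?thesis by (rule invol[OF i j])
  next
    case equal
    have "poisson_bracket (2 * m) E_bracket (I i) (I i) x = 0" for x
      using poisson_bracket_E_skew[of "2 * m" "I i" "I i" x] by simp
    then show ?thesis using equal by simp
  next
    case greater
    show ?thesis unfolding poisson_bracket_E_skew[of _ "I i"] using invol[OF j i greater] by simp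
  qed
qed (fact reg)

lemma poisson_bracket_E_6: "poisson_bracket 6 E_bracket f g x =
    x 1 * x 2 * (partial_deriv 1 f x * partial_deriv 2 g x - partial_deriv 2 f x * partial_deriv 1 g x) +
    x 3 * x 4 * (partial_deriv 3 f x * partial_deriv 4 g x - partial_deriv 4 f x * partial_deriv 3 g x) +
    x 5 * x 6 * (partial_deriv 5 f x * partial_deriv 6 g x - partial_deriv 6 f x * partial_deriv 5 g x)"
proof -
  have "(\<Sum>k<3. h k) = h 0 + h 1 + h 2" for h :: "nat \<Rightarrow> complex" by (simp add: eval_nat_numeral)
  moreover have "2 * (3 :: nat) = 6" "2 * 0 + 1 = (1 :: nat)" "2 * 0 + 2 = (2 :: nat)" "2 * 1 + 1 = (3 :: nat)" "2 * 1 + 2 = (4 :: nat)" "2 * 2 + 1 = (5 :: nat)" "2 * 2 + 2 = (6 :: nat)"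
    by simp_all
  ultimately show ?thesis
    using poisson_bracket_E[of 3 f g x] by (simp only:)
qed

lemma poisson_bracket_E_8: "poisson_bracket 8 E_bracket f g x =
    x 1 * x 2 * (partial_deriv 1 f x * partial_deriv 2 g x - partial_deriv 2 f x * partial_deriv 1 g x) +
    x 3 * x 4 * (partial_deriv 3 f x * partial_deriv 4 g x - partial_deriv 4 f x * partial_deriv 3 g x) +
    x 5 * x 6 * (partial_deriv 5 f x * partial_deriv 6 g x - partial_deriv 6 f x * partial_deriv 5 g x) +
    x 7 * x 8 * (partial_deriv 7 f x * partial_deriv 8 g x - partial_deriv 8 f x * partial_deriv 7 g x)"
proof -
  have "(\<Sum>k<4. h k) = h 0 + h 1 + h 2 + h 3" for h :: "nat \<Rightarrow> complex" by (simp add: eval_nat_numeral)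
  moreover have "2 * (4 :: nat) = 8" "2 * 0 + 1 = (1 :: nat)" "2 * 0 + 2 = (2 :: nat)" "2 * 1 + 1 = (3 :: nat)" "2 * 1 + 2 = (4 :: nat)" "2 * 2 + 1 = (5 :: nat)" "2 * 2 + 2 = (6 :: nat)" "2 * 3 + 1 = (7 :: nat)" "2 * 3 + 2 = (8 :: nat)"
    by simp_all
  ultimately show ?thesis
    using poisson_bracket_E[of 4 f g x] by (simp only:)
qed

lemma E_even_step_6: "E_even_step 6 x = x(2 := (1 + x 1) / x 2, 4 := (1 + x 3) / x 4, 6 := (1 + x 5) / x 6)"
proof
  fix i :: nat
  have "i \<in> {1..6} \<and> even i \<longleftrightarrow> i = 2 \<or> i = 4 \<or> i = 6" unfolding atLeastAtMost_iff by presburger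
  then show "E_even_step 6 x i = (x(2 := (1 + x 1) / x 2, 4 := (1 + x 3) / x 4, 6 := (1 + x 5) / x 6)) i"
    by (auto simp: E_even_step_def)
qed

lemma E_even_step_8: "E_even_step 8 x = x(2 := (1 + x 1) / x 2, 4 := (1 + x 3) / x 4, 6 := (1 + x 5) / x 6, 8 := (1 + x 7) / x 8)"
proof
  fix i :: nat
  have "i \<in> {1..8} \<and> even i \<longleftrightarrow> i = 2 \<or> i = 4 \<or> i = 6 \<or> i = 8" unfolding atLeastAtMost_iff by presburger
  then show "E_even_step 8 x i = (x(2 := (1 + x 1) / x 2, 4 := (1 + x 3) / x 4, 6 := (1 + x 5) / x 6, 8 := (1 + x 7) / x 8)) i"
    by (auto simp: E_even_step_def)
qed

text \<open>At the all-ones point the cyclic symmetry of the E6 formulas makes \<open>E6_J1\<close>,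
  \<open>E6_J2\<close> and \<open>E6_J3\<close> equal, and then the differential of their product is
  a multiple of that of their sum. The value 2 at the index 5 breaks this symmetry.\<close>

definition base_point :: "nat \<Rightarrow> complex" where
  "base_point i = (if i = 5 then 2 else 1)"

subsection \<open>The quiver of type E6\<close>

definition E6_odd_step :: "(nat \<Rightarrow> complex) \<Rightarrow> nat \<Rightarrow> complex" where
  "E6_odd_step x = x(1 := (1 + x 2) * (1 + x 2 * x 4 * x 6) / x 1,
     3 := (1 + x 2 * x 4 * x 6) * (1 + x 4) / x 3,
     5 := (1 + x 2 * x 4 * x 6) * (1 + x 6) / x 5)"

lemma E6_map_eq: "E6_map x = E_even_step 6 (E6_odd_step x)"
  unfolding E_even_step_6 E6_odd_step_def E6_map_def Let_def by (simp add: fun_upd_twist)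

text \<open>\<open>J i\<close> and \<open>K i\<close> come from the two tubes of rank 3, which each half step interchanges.\<close>

definition E6_J1 :: "(nat \<Rightarrow> complex) \<Rightarrow> complex" where
  "E6_J1 x =
     ((1 + x 3 + x 4) * (1 + x 5) + (1 + x 4) * (x 2 * x 4 * x 6)) / (x 3 * x 4 * x 6)"

definition E6_J2 :: "(nat \<Rightarrow> complex) \<Rightarrow> complex" where
  "E6_J2 x =
     ((1 + x 5 + x 6) * (1 + x 1) + (1 + x 6) * (x 2 * x 4 * x 6)) / (x 5 * x 6 * x 2)"

definition E6_J3 :: "(nat \<Rightarrow> complex) \<Rightarrow> complex" where
  "E6_J3 x =
     ((1 + x 1 + x 2) * (1 + x 3) + (1 + x 2) * (x 2 * x 4 * x 6)) / (x 1 * x 2 * x 4)"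

definition E6_K1 :: "(nat \<Rightarrow> complex) \<Rightarrow> complex" where
  "E6_K1 x =
     ((1 + x 5 + x 6) * (1 + x 3) + (1 + x 6) * (x 2 * x 4 * x 6)) / (x 5 * x 6 * x 4)"

definition E6_K2 :: "(nat \<Rightarrow> complex) \<Rightarrow> complex" where
  "E6_K2 x =
     ((1 + x 3 + x 4) * (1 + x 1) + (1 + x 4) * (x 2 * x 4 * x 6)) / (x 3 * x 4 * x 2)"

definition E6_K3 :: "(nat \<Rightarrow> complex) \<Rightarrow> complex" where
  "E6_K3 x =
     ((1 + x 1 + x 2) * (1 + x 5) + (1 + x 2) * (x 2 * x 4 * x 6)) / (x 1 * x 2 * x 6)"

lemma E6_odd_step_action:
  assumes "x 1 * x 2 * x 3 * x 4 * x 5 * x 6 * (1 + x 2) * (1 + x 4) * (1 + x 6) * (1 + x 2 * x 4 * x 6) \<noteq> 0"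
  shows "E6_J1 (E6_odd_step x) = E6_K1 x"
    and "E6_J2 (E6_odd_step x) = E6_K3 x"
    and "E6_J3 (E6_odd_step x) = E6_K2 x"
    and "E6_K1 (E6_odd_step x) = E6_J1 x"
    and "E6_K3 (E6_odd_step x) = E6_J2 x"
    and "E6_K2 (E6_odd_step x) = E6_J3 x"
proof -
  \<comment> \<open>With plain variables for the coordinates, clearing denominators turns each claim
    into a polynomial identity.\<close>
  define y1 y2 y3 y4 y5 y6 where y: "y1 = x 1" "y2 = x 2" "y3 = x 3" "y4 = x 4" "y5 = x 5" "y6 = x 6"
  have *: "y1 \<noteq> 0" "y2 \<noteq> 0" "y3 \<noteq> 0" "y4 \<noteq> 0" "y5 \<noteq> 0" "y6 \<noteq> 0" "1 + y2 \<noteq> 0" "1 + y4 \<noteq> 0" "1 + y6 \<noteq> 0" "1 + y2 * y4 * y6 \<noteq> 0"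
    using assms unfolding y by auto
  have o: "E6_odd_step x 1 = (1 + y2) * (1 + y2 * y4 * y6) / y1"
    "E6_odd_step x 2 = y2"
    "E6_odd_step x 3 = (1 + y2 * y4 * y6) * (1 + y4) / y3"
    "E6_odd_step x 4 = y4"
    "E6_odd_step x 5 = (1 + y2 * y4 * y6) * (1 + y6) / y5"
    "E6_odd_step x 6 = y6"
    by (simp_all add: E6_odd_step_def y)
  show "E6_J1 (E6_odd_step x) = E6_K1 x"
    unfolding E6_J1_def E6_K1_def Let_def o y[symmetric] by (simp add: divide_simps *) Groebner_Basis.algebra
  show "E6_J2 (E6_odd_step x) = E6_K3 x"
    unfolding E6_J2_def E6_K3_def Let_def o y[symmetric] by (simp add: divide_simps *) Groebner_Basis.algebra
  show "E6_J3 (E6_odd_step x) = E6_K2 x"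
    unfolding E6_J3_def E6_K2_def Let_def o y[symmetric] by (simp add: divide_simps *) Groebner_Basis.algebra
  show "E6_K1 (E6_odd_step x) = E6_J1 x"
    unfolding E6_K1_def E6_J1_def Let_def o y[symmetric] by (simp add: divide_simps *) Groebner_Basis.algebra
  show "E6_K3 (E6_odd_step x) = E6_J2 x"
    unfolding E6_K3_def E6_J2_def Let_def o y[symmetric] by (simp add: divide_simps *) Groebner_Basis.algebra
  show "E6_K2 (E6_odd_step x) = E6_J3 x"
    unfolding E6_K2_def E6_J3_def Let_def o y[symmetric] by (simp add: divide_simps *) Groebner_Basis.algebra
qed

lemma E6_even_step_action:
  assumes "x 1 * x 2 * x 3 * x 4 * x 5 * x 6 * (1 + x 1) * (1 + x 3) * (1 + x 5) \<noteq> 0"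
  shows "E6_J1 (E_even_step 6 x) = E6_K2 x"
    and "E6_J2 (E_even_step 6 x) = E6_K1 x"
    and "E6_J3 (E_even_step 6 x) = E6_K3 x"
    and "E6_K2 (E_even_step 6 x) = E6_J1 x"
    and "E6_K1 (E_even_step 6 x) = E6_J2 x"
    and "E6_K3 (E_even_step 6 x) = E6_J3 x"
proof -
  define y1 y2 y3 y4 y5 y6 where y: "y1 = x 1" "y2 = x 2" "y3 = x 3" "y4 = x 4" "y5 = x 5" "y6 = x 6"
  have *: "y1 \<noteq> 0" "y2 \<noteq> 0" "y3 \<noteq> 0" "y4 \<noteq> 0" "y5 \<noteq> 0" "y6 \<noteq> 0" "1 + y1 \<noteq> 0" "1 + y3 \<noteq> 0" "1 + y5 \<noteq> 0"
    using assms unfolding y by auto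
  have o: "E_even_step 6 x 1 = y1"
    "E_even_step 6 x 2 = (1 + y1) / y2"
    "E_even_step 6 x 3 = y3"
    "E_even_step 6 x 4 = (1 + y3) / y4"
    "E_even_step 6 x 5 = y5"
    "E_even_step 6 x 6 = (1 + y5) / y6"
    by (simp_all add: E_even_step_6 y)
  show "E6_J1 (E_even_step 6 x) = E6_K2 x"
    unfolding E6_J1_def E6_K2_def Let_def o y[symmetric] by (simp add: divide_simps *) Groebner_Basis.algebra
  show "E6_J2 (E_even_step 6 x) = E6_K1 x"
    unfolding E6_J2_def E6_K1_def Let_def o y[symmetric] by (simp add: divide_simps *) Groebner_Basis.algebra
  show "E6_J3 (E_even_step 6 x) = E6_K3 x"
    unfolding E6_J3_def E6_K3_def Let_def o y[symmetric] by (simp add: divide_simps *) Groebner_Basis.algebra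
  show "E6_K2 (E_even_step 6 x) = E6_J1 x"
    unfolding E6_K2_def E6_J1_def Let_def o y[symmetric] by (simp add: divide_simps *) Groebner_Basis.algebra
  show "E6_K1 (E_even_step 6 x) = E6_J2 x"
    unfolding E6_K1_def E6_J2_def Let_def o y[symmetric] by (simp add: divide_simps *) Groebner_Basis.algebra
  show "E6_K3 (E_even_step 6 x) = E6_J3 x"
    unfolding E6_K3_def E6_J3_def Let_def o y[symmetric] by (simp add: divide_simps *) Groebner_Basis.algebra
qed

\<comment> \<open>The differentiation rules themselves produce the right-hand sides, left open as
  schematic variables; only the brackets computed from them have to be recognised.\<close>
schematic_goal E6_J1_deriv:
  assumes "x 1 * x 2 * x 3 * x 4 * x 5 * x 6 \<noteq> 0"
  shows "partial_deriv 1 E6_J1 x = ?D1"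
    and "partial_deriv 2 E6_J1 x = ?D2"
    and "partial_deriv 3 E6_J1 x = ?D3"
    and "partial_deriv 4 E6_J1 x = ?D4"
    and "partial_deriv 5 E6_J1 x = ?D5"
    and "partial_deriv 6 E6_J1 x = ?D6"
  by (rule partial_deriv_eqI, simp add: E6_J1_def Let_def,
    ((rule derivative_eq_intros refl | use assms in simp)+)[1])+

schematic_goal E6_J3_deriv:
  assumes "x 1 * x 2 * x 3 * x 4 * x 5 * x 6 \<noteq> 0"
  shows "partial_deriv 1 E6_J3 x = ?D1"
    and "partial_deriv 2 E6_J3 x = ?D2"
    and "partial_deriv 3 E6_J3 x = ?D3"
    and "partial_deriv 4 E6_J3 x = ?D4"
    and "partial_deriv 5 E6_J3 x = ?D5"
    and "partial_deriv 6 E6_J3 x = ?D6"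
  by (rule partial_deriv_eqI, simp add: E6_J3_def Let_def,
    ((rule derivative_eq_intros refl | use assms in simp)+)[1])+

schematic_goal E6_K1_deriv:
  assumes "x 1 * x 2 * x 3 * x 4 * x 5 * x 6 \<noteq> 0"
  shows "partial_deriv 1 E6_K1 x = ?D1"
    and "partial_deriv 2 E6_K1 x = ?D2"
    and "partial_deriv 3 E6_K1 x = ?D3"
    and "partial_deriv 4 E6_K1 x = ?D4"
    and "partial_deriv 5 E6_K1 x = ?D5"
    and "partial_deriv 6 E6_K1 x = ?D6"
  by (rule partial_deriv_eqI, simp add: E6_K1_def Let_def,
    ((rule derivative_eq_intros refl | use assms in simp)+)[1])+

schematic_goal E6_K2_deriv:
  assumes "x 1 * x 2 * x 3 * x 4 * x 5 * x 6 \<noteq> 0"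
  shows "partial_deriv 1 E6_K2 x = ?D1"
    and "partial_deriv 2 E6_K2 x = ?D2"
    and "partial_deriv 3 E6_K2 x = ?D3"
    and "partial_deriv 4 E6_K2 x = ?D4"
    and "partial_deriv 5 E6_K2 x = ?D5"
    and "partial_deriv 6 E6_K2 x = ?D6"
  by (rule partial_deriv_eqI, simp add: E6_K2_def Let_def,
    ((rule derivative_eq_intros refl | use assms in simp)+)[1])+

schematic_goal E6_K3_deriv:
  assumes "x 1 * x 2 * x 3 * x 4 * x 5 * x 6 \<noteq> 0"
  shows "partial_deriv 1 E6_K3 x = ?D1"
    and "partial_deriv 2 E6_K3 x = ?D2"
    and "partial_deriv 3 E6_K3 x = ?D3"
    and "partial_deriv 4 E6_K3 x = ?D4"
    and "partial_deriv 5 E6_K3 x = ?D5"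
    and "partial_deriv 6 E6_K3 x = ?D6"
  by (rule partial_deriv_eqI, simp add: E6_K3_def Let_def,
    ((rule derivative_eq_intros refl | use assms in simp)+)[1])+

lemma E6_bracket_J3_J1:
  assumes "x 1 * x 2 * x 3 * x 4 * x 5 * x 6 \<noteq> 0"
  shows "poisson_bracket 6 E_bracket E6_J3 E6_J1 x = - (E6_J3 x * E6_J1 x - 1)"
proof -
  have two: "of_nat 2 = (2 :: complex)" "a ^ (2 - 1) = a" for a :: complex by simp_all
  define y1 y2 y3 y4 y5 y6 where y: "y1 = x 1" "y2 = x 2" "y3 = x 3" "y4 = x 4" "y5 = x 5" "y6 = x 6"
  have *: "y1 \<noteq> 0" "y2 \<noteq> 0" "y3 \<noteq> 0" "y4 \<noteq> 0" "y5 \<noteq> 0" "y6 \<noteq> 0" using assms unfolding y by auto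
  show ?thesis
    unfolding poisson_bracket_E_6 E6_J3_deriv[OF assms] E6_J1_deriv[OF assms]
      E6_J3_def E6_J1_def Let_def two One_nat_def[symmetric] y[symmetric]
      mult_zero_left mult_zero_right add_0_left add_0_right mult_1_left mult_1_right diff_zero
    by (simp add: divide_simps *) Groebner_Basis.algebra
qed

lemma E6_bracket_J3_K1:
  assumes "x 1 * x 2 * x 3 * x 4 * x 5 * x 6 \<noteq> 0"
  shows "poisson_bracket 6 E_bracket E6_J3 E6_K1 x = 0"
proof -
  have two: "of_nat 2 = (2 :: complex)" "a ^ (2 - 1) = a" for a :: complex by simp_all
  define y1 y2 y3 y4 y5 y6 where y: "y1 = x 1" "y2 = x 2" "y3 = x 3" "y4 = x 4" "y5 = x 5" "y6 = x 6"
  have *: "y1 \<noteq> 0" "y2 \<noteq> 0" "y3 \<noteq> 0" "y4 \<noteq> 0" "y5 \<noteq> 0" "y6 \<noteq> 0" using assms unfolding y by auto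
  show ?thesis
    unfolding poisson_bracket_E_6 E6_J3_deriv[OF assms] E6_K1_deriv[OF assms]
      E6_J3_def E6_K1_def Let_def two One_nat_def[symmetric] y[symmetric]
      mult_zero_left mult_zero_right add_0_left add_0_right mult_1_left mult_1_right diff_zero
    by (simp add: divide_simps *) Groebner_Basis.algebra
qed

lemma E6_bracket_J3_K2:
  assumes "x 1 * x 2 * x 3 * x 4 * x 5 * x 6 \<noteq> 0"
  shows "poisson_bracket 6 E_bracket E6_J3 E6_K2 x = 0"
proof -
  have two: "of_nat 2 = (2 :: complex)" "a ^ (2 - 1) = a" for a :: complex by simp_all
  define y1 y2 y3 y4 y5 y6 where y: "y1 = x 1" "y2 = x 2" "y3 = x 3" "y4 = x 4" "y5 = x 5" "y6 = x 6"
  have *: "y1 \<noteq> 0" "y2 \<noteq> 0" "y3 \<noteq> 0" "y4 \<noteq> 0" "y5 \<noteq> 0" "y6 \<noteq> 0" using assms unfolding y by auto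
  show ?thesis
    unfolding poisson_bracket_E_6 E6_J3_deriv[OF assms] E6_K2_deriv[OF assms]
      E6_J3_def E6_K2_def Let_def two One_nat_def[symmetric] y[symmetric]
      mult_zero_left mult_zero_right add_0_left add_0_right mult_1_left mult_1_right diff_zero
    by (simp add: divide_simps *) Groebner_Basis.algebra
qed

lemma E6_bracket_J3_K3:
  assumes "x 1 * x 2 * x 3 * x 4 * x 5 * x 6 \<noteq> 0"
  shows "poisson_bracket 6 E_bracket E6_J3 E6_K3 x = 0"
proof -
  have two: "of_nat 2 = (2 :: complex)" "a ^ (2 - 1) = a" for a :: complex by simp_all
  define y1 y2 y3 y4 y5 y6 where y: "y1 = x 1" "y2 = x 2" "y3 = x 3" "y4 = x 4" "y5 = x 5" "y6 = x 6"
  have *: "y1 \<noteq> 0" "y2 \<noteq> 0" "y3 \<noteq> 0" "y4 \<noteq> 0" "y5 \<noteq> 0" "y6 \<noteq> 0" using assms unfolding y by auto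
  show ?thesis
    unfolding poisson_bracket_E_6 E6_J3_deriv[OF assms] E6_K3_deriv[OF assms]
      E6_J3_def E6_K3_def Let_def two One_nat_def[symmetric] y[symmetric]
      mult_zero_left mult_zero_right add_0_left add_0_right mult_1_left mult_1_right diff_zero
    by (simp add: divide_simps *) Groebner_Basis.algebra
qed

text \<open>One exchange polynomial depends on the partner of another only through the common factor
  \<open>1 + x 2 * x 4 * x 6\<close>, which is symmetric in the three partners; hence the
  logarithmic derivatives agree.\<close>

lemma poisson_map_E6_odd_step: "poisson_map 6 E_bracket (- 1) E6_odd_step"
proof -
  define F where "F i x = (if i = 1 then (1 + x 2) * (1 + x 2 * x 4 * x 6) else if i = 3 then (1 + x 2 * x 4 * x 6) * (1 + x 4) else (1 + x 2 * x 4 * x 6) * (1 + x 6))" for i :: nat and x :: "nat \<Rightarrow> complex"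
  have idx: "i \<in> {1, 3, 5}" if "i \<in> {1..2 * 3}" "even i = False" for i :: nat
  proof -
    have "1 \<le> i" "i \<le> 6" "odd i" using that by auto
    then show ?thesis unfolding insert_iff empty_iff by presburger
  qed
  have pd: "partial_deriv 2 (F 3) x = (1 + x 4) * (x 4 * x 6)"
    "partial_deriv 2 (F 5) x = (1 + x 6) * (x 4 * x 6)"
    "partial_deriv 4 (F 1) x = (1 + x 2) * (x 2 * x 6)"
    "partial_deriv 4 (F 5) x = (1 + x 6) * (x 2 * x 6)"
    "partial_deriv 6 (F 1) x = (1 + x 2) * (x 2 * x 4)"
    "partial_deriv 6 (F 3) x = (1 + x 4) * (x 2 * x 4)" for x
    by (rule partial_deriv_eqI, (auto simp: F_def algebra_simps intro!: derivative_eq_intros)[1])+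
  have sym: "F 1 x * (x 2 * partial_deriv 2 (F 3) x) = F 3 x * (x 4 * partial_deriv 4 (F 1) x)"
    "F 1 x * (x 2 * partial_deriv 2 (F 5) x) = F 5 x * (x 6 * partial_deriv 6 (F 1) x)"
    "F 3 x * (x 4 * partial_deriv 4 (F 5) x) = F 5 x * (x 6 * partial_deriv 6 (F 3) x)" for x
    by (simp_all only: pd) (simp_all add: F_def algebra_simps)
  have suc: "1 + 1 = (2 :: nat)" "3 + 1 = (4 :: nat)" "5 + 1 = (6 :: nat)" by simp_all
  have "poisson_map (2 * 3) E_bracket (- 1) E6_odd_step"
  proof (rule poisson_map_E_half[where e = False and F = F])
    fix i :: nat assume i: "i \<in> {1..2 * 3}" "even i = False"
    show "polynomial_fun (2 * 3) (F i)"
      using idx[OF i] unfolding F_def by (auto intro!: polynomial_fun.intros)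
    show "\<exists>x. F i x \<noteq> 0" by (rule exI[of _ "\<lambda>_. 1"]) (simp add: F_def)
    fix x y :: "nat \<Rightarrow> complex" assume "\<And>j. j \<in> {1..2 * 3} \<Longrightarrow> even j \<noteq> False \<Longrightarrow> x j = y j"
    then have "x 2 = y 2" "x 4 = y 4" "x 6 = y 6" by simp_all
    then show "F i x = F i y" by (simp add: F_def)
  next
    fix i :: nat and x assume i: "i \<in> {1..2 * 3}"
    show "E6_odd_step x i = (if even i = False then F i x / x i else x i)"
      using idx[OF i] by (auto simp: E6_odd_step_def F_def)
  next
    fix i j :: nat and x :: "nat \<Rightarrow> complex"
    assume ij: "i \<in> {1..2 * 3}" "j \<in> {1..2 * 3}" "even i = False" "even j = False" "i < j"
    have "(i, j) \<in> {(1, 3), (1, 5), (3, 5)}" using idx[OF ij(1,3)] idx[OF ij(2,4)] ij(5) by auto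
    then show "let p = \<lambda>i. if False then i - 1 else i + 1 in
       F i x * (x (p i) * partial_deriv (p i) (F j) x) = F j x * (x (p j) * partial_deriv (p j) (F i) x)"
      unfolding Let_def if_False using sym[of x] by (elim insertE emptyE; simp only: prod.inject suc)
  qed
  then show ?thesis by simp
qed

lemma E6_reg:
  assumes "a 1 * a 2 * a 3 * a 4 * a 5 * a 6 \<noteq> 0"
  shows "reg 6 a E6_J1"
    and "reg 6 a E6_J2"
    and "reg 6 a E6_J3"
    and "reg 6 a E6_K1"
    and "reg 6 a E6_K2"
    and "reg 6 a E6_K3"
  unfolding E6_J1_def[abs_def] E6_J2_def[abs_def] E6_J3_def[abs_def] E6_K1_def[abs_def] E6_K2_def[abs_def] E6_K3_def[abs_def] Let_def
  by (intro reg_divide reg_diff reg_add reg_mult reg_power reg_const reg_coord; use assms in simp)+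

lemma E6_odd_pulls_back:
  shows "pulls_back 6 (E6_odd_step) E6_J1 E6_K1"
    and "pulls_back 6 (E6_odd_step) E6_J2 E6_K3"
    and "pulls_back 6 (E6_odd_step) E6_J3 E6_K2"
    and "pulls_back 6 (E6_odd_step) E6_K1 E6_J1"
    and "pulls_back 6 (E6_odd_step) E6_K3 E6_J2"
    and "pulls_back 6 (E6_odd_step) E6_K2 E6_J3"
proof -
  have nz: "\<forall>\<^sub>F x in gen 6. x 1 * x 2 * x 3 * x 4 * x 5 * x 6 * (1 + x 2) * (1 + x 4) * (1 + x 6) * (1 + x 2 * x 4 * x 6) \<noteq> 0"
    by (rule eventually_gen_nonzero[where a = "\<lambda>_. 1"]) (auto intro!: polynomial_fun.intros)
  show "pulls_back 6 (E6_odd_step) E6_J1 E6_K1"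
    "pulls_back 6 (E6_odd_step) E6_J2 E6_K3"
    "pulls_back 6 (E6_odd_step) E6_J3 E6_K2"
    "pulls_back 6 (E6_odd_step) E6_K1 E6_J1"
    "pulls_back 6 (E6_odd_step) E6_K3 E6_J2"
    "pulls_back 6 (E6_odd_step) E6_K2 E6_J3"
    unfolding pulls_back_def
    by (intro conjI exI[of _ "\<lambda>_. 1"] E6_reg eventually_mono[OF nz] E6_odd_step_action; simp)+
qed

lemma E6_even_pulls_back:
  shows "pulls_back 6 (E_even_step 6) E6_J1 E6_K2"
    and "pulls_back 6 (E_even_step 6) E6_J2 E6_K1"
    and "pulls_back 6 (E_even_step 6) E6_J3 E6_K3"
    and "pulls_back 6 (E_even_step 6) E6_K2 E6_J1"
    and "pulls_back 6 (E_even_step 6) E6_K1 E6_J2"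
    and "pulls_back 6 (E_even_step 6) E6_K3 E6_J3"
proof -
  have nz: "\<forall>\<^sub>F x in gen 6. x 1 * x 2 * x 3 * x 4 * x 5 * x 6 * (1 + x 1) * (1 + x 3) * (1 + x 5) \<noteq> 0"
    by (rule eventually_gen_nonzero[where a = "\<lambda>_. 1"]) (auto intro!: polynomial_fun.intros)
  show "pulls_back 6 (E_even_step 6) E6_J1 E6_K2"
    "pulls_back 6 (E_even_step 6) E6_J2 E6_K1"
    "pulls_back 6 (E_even_step 6) E6_J3 E6_K3"
    "pulls_back 6 (E_even_step 6) E6_K2 E6_J1"
    "pulls_back 6 (E_even_step 6) E6_K1 E6_J2"
    "pulls_back 6 (E_even_step 6) E6_K3 E6_J3"
    unfolding pulls_back_def
    by (intro conjI exI[of _ "\<lambda>_. 1"] E6_reg eventually_mono[OF nz] E6_even_step_action; simp)+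
qed

text \<open>Under the group generated by the half steps the pairs within a tube form one orbit and
  the nine mixed pairs form three. The brackets of \<open>E6_J3\<close> with \<open>E6_J1\<close>,
  \<open>E6_K1\<close>, \<open>E6_K2\<close> and \<open>E6_K3\<close> represent the four orbits; all
  others are transported.\<close>

lemma E6_brackets:
  shows "bracket_law 6 (- 1) 1 E6_J3 E6_J1"
    and "bracket_law 6 0 0 E6_J3 E6_K1"
    and "bracket_law 6 0 0 E6_J3 E6_K2"
    and "bracket_law 6 0 0 E6_J3 E6_K3"
    and "bracket_law 6 1 1 E6_K3 E6_K2"
    and "bracket_law 6 (- 1) 1 E6_J2 E6_J3"
    and "bracket_law 6 1 1 E6_K1 E6_K3"
    and "bracket_law 6 (- 1) 1 E6_J1 E6_J2"
    and "bracket_law 6 1 1 E6_K2 E6_K1"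
    and "bracket_law 6 0 0 E6_K3 E6_J1"
    and "bracket_law 6 0 0 E6_J2 E6_K1"
    and "bracket_law 6 0 0 E6_K2 E6_J2"
    and "bracket_law 6 0 0 E6_J1 E6_K1"
    and "bracket_law 6 0 0 E6_K3 E6_J2"
    and "bracket_law 6 0 0 E6_K2 E6_J1"
proof -
  have nz: "\<forall>\<^sub>F x in gen 6. x 1 * x 2 * x 3 * x 4 * x 5 * x 6 \<noteq> 0"
    by (rule eventually_gen_nonzero[where a = "\<lambda>_. 1"]) (auto intro!: polynomial_fun.intros)
  have reg: "\<exists>a. reg 6 a E6_J1" "\<exists>a. reg 6 a E6_J3" "\<exists>a. reg 6 a E6_K1" "\<exists>a. reg 6 a E6_K2" "\<exists>a. reg 6 a E6_K3"
    using E6_reg[of "\<lambda>_. 1"] by auto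
  note o = bracket_transport[OF poisson_map_E6_odd_step]
    and e = bracket_transport[OF poisson_map_E_even_step[of 3, simplified]]
    and po = E6_odd_pulls_back and pe = E6_even_pulls_back
  have J3J1: "bracket_law 6 (- 1) 1 E6_J3 E6_J1"
    unfolding bracket_law_def using reg nz by (auto elim!: eventually_mono simp: E6_bracket_J3_J1)
  have J3K1: "bracket_law 6 0 0 E6_J3 E6_K1"
    unfolding bracket_law_def using reg nz by (auto elim!: eventually_mono simp: E6_bracket_J3_K1)
  have J3K2: "bracket_law 6 0 0 E6_J3 E6_K2"
    unfolding bracket_law_def using reg nz by (auto elim!: eventually_mono simp: E6_bracket_J3_K2)
  have J3K3: "bracket_law 6 0 0 E6_J3 E6_K3"
    unfolding bracket_law_def using reg nz by (auto elim!: eventually_mono simp: E6_bracket_J3_K3)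
  note K3K2 = e[OF pe(3) pe(1) J3J1]
  note J2J3 = o[OF po(5) po(6) K3K2]
  note K1K3 = e[OF pe(2) pe(3) J2J3]
  note J1J2 = o[OF po(4) po(5) K1K3]
  note K2K1 = e[OF pe(1) pe(2) J1J2]
  note K3J1 = e[OF pe(3) pe(4) J3K2]
  note J2K1 = o[OF po(5) po(1) K3J1]
  note K2J2 = o[OF po(3) po(5) J3K3]
  note J1K1 = e[OF pe(4) pe(2) K2J2]
  note K3J2 = e[OF pe(3) pe(5) J3K1]
  note K2J1 = o[OF po(3) po(4) J3K1]
  show "bracket_law 6 (- 1) 1 E6_J3 E6_J1"
    "bracket_law 6 0 0 E6_J3 E6_K1"
    "bracket_law 6 0 0 E6_J3 E6_K2"
    "bracket_law 6 0 0 E6_J3 E6_K3"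
    "bracket_law 6 1 1 E6_K3 E6_K2"
    "bracket_law 6 (- 1) 1 E6_J2 E6_J3"
    "bracket_law 6 1 1 E6_K1 E6_K3"
    "bracket_law 6 (- 1) 1 E6_J1 E6_J2"
    "bracket_law 6 1 1 E6_K2 E6_K1"
    "bracket_law 6 0 0 E6_K3 E6_J1"
    "bracket_law 6 0 0 E6_J2 E6_K1"
    "bracket_law 6 0 0 E6_K2 E6_J2"
    "bracket_law 6 0 0 E6_J1 E6_K1"
    "bracket_law 6 0 0 E6_K3 E6_J2"
    "bracket_law 6 0 0 E6_K2 E6_J1"
    using J3J1 J3K1 J3K2 J3K3 K3K2 J2J3 K1K3 J1J2 K2K1 K3J1 J2K1 K2J2 J1K1 K3J2 K2J1 by simp_all
qed

text \<open>On a triangle the matching sums are the product and the sum. Both are taken for the tube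
  of the \<open>J i\<close>, and the sum for the tube of the \<open>K i\<close>.\<close>

definition E6_integral :: "nat \<Rightarrow> (nat \<Rightarrow> complex) \<Rightarrow> complex" where
  "E6_integral i x = (if i = 1 then E6_J1 x * E6_J2 x * E6_J3 x
     else if i = 2 then E6_J1 x + E6_J2 x + E6_J3 x
     else E6_K1 x + E6_K2 x + E6_K3 x)"

lemma E6_integral_simps:
  "E6_integral 1 = (\<lambda>x. E6_J1 x * E6_J2 x * E6_J3 x)"
  "E6_integral 2 = (\<lambda>x. E6_J1 x + E6_J2 x + E6_J3 x)"
  "E6_integral 3 = (\<lambda>x. E6_K1 x + E6_K2 x + E6_K3 x)"
  by (simp_all add: E6_integral_def fun_eq_iff)

lemma E6_base_values:
  "E6_J1 base_point = 11"
  "E6_J2 base_point = 5"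
  "E6_J3 base_point = 8"
  "E6_K1 base_point = 5"
  "E6_K2 base_point = 8"
  "E6_K3 base_point = 11"
  by (simp_all add: E6_J1_def E6_J2_def E6_J3_def E6_K1_def E6_K2_def E6_K3_def base_point_def Let_def)

lemma E6_base_derivs:
  "partial_deriv 1 E6_J1 base_point = 0"
  "partial_deriv 2 E6_J1 base_point = 2"
  "partial_deriv 3 E6_J1 base_point = - 8"
  "partial_deriv 1 E6_J2 base_point = 2"
  "partial_deriv 2 E6_J2 base_point = - 4"
  "partial_deriv 3 E6_J2 base_point = 0"
  "partial_deriv 1 E6_J3 base_point = - 6"
  "partial_deriv 2 E6_J3 base_point = - 3"
  "partial_deriv 3 E6_J3 base_point = 3"
  "partial_deriv 1 E6_K1 base_point = 0"
  "partial_deriv 2 E6_K1 base_point = 1"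
  "partial_deriv 3 E6_K1 base_point = 2"
  "partial_deriv 1 E6_K2 base_point = 3"
  "partial_deriv 2 E6_K2 base_point = - 6"
  "partial_deriv 3 E6_K2 base_point = - 6"
  "partial_deriv 1 E6_K3 base_point = - 8"
  "partial_deriv 2 E6_K3 base_point = - 5"
  "partial_deriv 3 E6_K3 base_point = 0"
  by (rule trans[OF partial_deriv_eqI], simp add: E6_J1_def E6_J2_def E6_J3_def E6_K1_def E6_K2_def E6_K3_def Let_def,
    ((rule derivative_eq_intros refl | simp add: base_point_def)+)[1], simp add: base_point_def)+

lemma E6_base_reg: "reg 6 base_point E6_J1"
    "reg 6 base_point E6_J2"
    "reg 6 base_point E6_J3"
    "reg 6 base_point E6_K1"
    "reg 6 base_point E6_K2"
    "reg 6 base_point E6_K3"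
  by (rule E6_reg, simp add: base_point_def)+

lemma E6_integral_base_derivs:
  "partial_deriv 1 (E6_integral 1) base_point = - 154"
  "partial_deriv 2 (E6_integral 1) base_point = - 437"
  "partial_deriv 3 (E6_integral 1) base_point = - 155"
  "partial_deriv 1 (E6_integral 2) base_point = - 4"
  "partial_deriv 2 (E6_integral 2) base_point = - 5"
  "partial_deriv 3 (E6_integral 2) base_point = - 5"
  "partial_deriv 1 (E6_integral 3) base_point = - 5"
  "partial_deriv 2 (E6_integral 3) base_point = - 10"
  "partial_deriv 3 (E6_integral 3) base_point = - 4"
  unfolding E6_integral_simps
  by (simp_all add: partial_deriv_add[of 6] partial_deriv_mult[of 6] reg_add reg_mult E6_base_reg
    E6_base_values E6_base_derivs[simplified One_nat_def] E6_base_derivs)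

text \<open>The Leibniz rules expand each bracket into brackets of the six quantities. Once these
  are replaced by their laws, a polynomial identity in the values of the quantities remains.\<close>

lemma E6_involution:
  "\<forall>\<^sub>F x in gen 6. poisson_bracket 6 E_bracket (E6_integral 1) (E6_integral 2) x = 0 \<and>
     poisson_bracket 6 E_bracket (E6_integral 1) (E6_integral 3) x = 0 \<and>
     poisson_bracket 6 E_bracket (E6_integral 2) (E6_integral 3) x = 0"
proof -
  have "\<forall>\<^sub>F x in gen 6. x 1 * x 2 * x 3 * x 4 * x 5 * x 6 \<noteq> 0"
    by (rule eventually_gen_nonzero[where a = "\<lambda>_. 1"]) (auto intro!: polynomial_fun.intros)
  then show ?thesis
    using E6_brackets[THEN bracket_lawD]
  proof eventually_elim
    case (elim x)
    define vJ1 vJ2 vJ3 vK1 vK2 vK3 where v: "vJ1 = E6_J1 x" "vJ2 = E6_J2 x" "vJ3 = E6_J3 x" "vK1 = E6_K1 x" "vK2 = E6_K2 x" "vK3 = E6_K3 x"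
    have self: "poisson_bracket 6 E_bracket f f x = 0" for f
      using poisson_bracket_E_skew[of 6 f f x] by simp
    note swap = elim(2-)[THEN poisson_bracket_E_swap]
    note leibniz = poisson_bracket_leibniz[where n = 6] reg_add[where n = 6] reg_mult[where n = 6] E6_reg[OF elim(1)]
    have I12: "poisson_bracket 6 E_bracket (E6_integral 1) (E6_integral 2) x = 0"
      unfolding E6_integral_simps by (simp only: leibniz, unfold swap elim self v[symmetric], Groebner_Basis.algebra)
    have I13: "poisson_bracket 6 E_bracket (E6_integral 1) (E6_integral 3) x = 0"
      unfolding E6_integral_simps by (simp only: leibniz, unfold swap elim self v[symmetric], Groebner_Basis.algebra)
    have I23: "poisson_bracket 6 E_bracket (E6_integral 2) (E6_integral 3) x = 0"
      unfolding E6_integral_simps by (simp only: leibniz, unfold swap elim self v[symmetric], Groebner_Basis.algebra)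
    show ?case using I12 I13 I23 by blast
  qed
qed

lemma E6_map_completely_integrable: "completely_integrable 3 E_form E6_map"
proof (rule completely_integrable_E[where \<iota> = E6_odd_step and I = E6_integral and a = base_point])
  have idx: "i \<in> {1, 2, 3}" if "i \<in> {1..3}" for i :: nat using that by auto
  let ?I = "\<lambda>i x. if i = 1 then E6_K1 x * E6_K2 x * E6_K3 x
    else if i = 2 then E6_K1 x + E6_K2 x + E6_K3 x
    else E6_J1 x + E6_J2 x + E6_J3 x"
  show "E6_map x = E_even_step (2 * 3) (E6_odd_step x)" for x by (simp add: E6_map_eq)
  show "poisson_map (2 * 3) E_bracket (- 1) E6_odd_step" using poisson_map_E6_odd_step by simp
  show "reg (2 * 3) base_point (E6_integral i)" if "i \<in> {1..3}" for i
    using idx[OF that] E6_base_reg by (auto simp: E6_integral_simps simp del: One_nat_def intro!: reg_add reg_mult)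
  show "\<forall>\<^sub>F x in gen (2 * 3). ?I i (E6_odd_step x) = E6_integral i x" for i
  proof -
    have "\<forall>\<^sub>F x in gen 6. ?I i (E6_odd_step x) = E6_integral i x"
      using E6_odd_pulls_back[THEN pulls_backD] by eventually_elim (simp add: E6_integral_def algebra_simps)
    then show ?thesis by simp
  qed
  show "\<forall>\<^sub>F x in gen (2 * 3). E6_integral i (E_even_step (2 * 3) x) = ?I i x" for i
  proof -
    have "\<forall>\<^sub>F x in gen 6. E6_integral i (E_even_step 6 x) = ?I i x"
      using E6_even_pulls_back[THEN pulls_backD] by eventually_elim (simp add: E6_integral_def algebra_simps)
    then show ?thesis by simp
  qed
  show "\<forall>i\<in>{1..3}. c i = 0"
    if c: "\<And>l. l \<in> {1..3} \<Longrightarrow> (\<Sum>i=1..3. c i * partial_deriv l (E6_integral i) base_point) = 0" for c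
  proof -
    have sum: "(\<Sum>i=1..3. f i) = f 1 + f 2 + f 3" for f :: "nat \<Rightarrow> complex" by (simp add: eval_nat_numeral)
    define c1 c2 c3 where k: "c1 = c 1" "c2 = c 2" "c3 = c 3"
    have eq: "c1 * (- 154) + c2 * (- 4) + c3 * (- 5) = 0"
      "c1 * (- 437) + c2 * (- 5) + c3 * (- 10) = 0"
      "c1 * (- 155) + c2 * (- 5) + c3 * (- 4) = 0"
      using c[of 1] c[of 2] c[of 3] unfolding sum E6_integral_base_derivs k by simp_all
    have "c1 = 0"
    proof -
      \<comment> \<open>Cramer's rule: the three multipliers are the cofactors of the first column
        of the coefficient matrix, and -546 is its determinant, all divided by a common factor. The
        steps for \<open>c2\<close> and \<open>c3\<close> use the other columns.\<close>
      have "c1 * (- 546) - ((c1 * (- 154) + c2 * (- 4) + c3 * (- 5)) * (- 10) +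
         (c1 * (- 437) + c2 * (- 5) + c3 * (- 10)) * (3) +
         (c1 * (- 155) + c2 * (- 5) + c3 * (- 4)) * (5)) = 0"
        by Groebner_Basis.algebra
      then show ?thesis unfolding eq by simp
    qed
    moreover
    have "c2 = 0"
    proof -
      have "c2 * (- 546) - ((c1 * (- 154) + c2 * (- 4) + c3 * (- 5)) * (- 66) +
         (c1 * (- 437) + c2 * (- 5) + c3 * (- 10)) * (- 53) +
         (c1 * (- 155) + c2 * (- 5) + c3 * (- 4)) * (215)) = 0"
        by Groebner_Basis.algebra
      then show ?thesis unfolding eq by simp
    qed
    moreover
    have "c3 = 0"
    proof -
      have "c3 * (- 273) - ((c1 * (- 154) + c2 * (- 4) + c3 * (- 5)) * (235) +
         (c1 * (- 437) + c2 * (- 5) + c3 * (- 10)) * (- 25) +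
         (c1 * (- 155) + c2 * (- 5) + c3 * (- 4)) * (- 163)) = 0"
        by Groebner_Basis.algebra
      then show ?thesis unfolding eq by simp
    qed
    ultimately have "c i = 0" if "i \<in> {1..3}" for i
      using idx[OF that] unfolding k by (auto simp del: One_nat_def)
    then show ?thesis by blast
  qed
  show "\<forall>\<^sub>F x in gen (2 * 3). poisson_bracket (2 * 3) E_bracket (E6_integral i) (E6_integral j) x = 0"
    if "i \<in> {1..3}" "j \<in> {1..3}" "i < j" for i j
  proof -
    have "(i, j) \<in> {(1, 2), (1, 3), (2, 3)}" using idx[OF that(1)] idx[OF that(2)] that(3) by auto
    moreover have "2 * 3 = (6 :: nat)" by simp
    ultimately show ?thesis using E6_involution by (auto simp only: insert_iff empty_iff prod.inject eventually_conj_iff)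
  qed
qed

subsection \<open>The quiver of type E7\<close>

definition E7_odd_step :: "(nat \<Rightarrow> complex) \<Rightarrow> nat \<Rightarrow> complex" where
  "E7_odd_step x = x(1 := (1 + x 2) * (1 + x 2 * x 4) / x 1,
     3 := (1 + x 2 * x 4) * (1 + x 4) * (1 + x 4 * x 6) / x 3,
     5 := (1 + x 4 * x 6) * (1 + x 6) / x 5)"

lemma E7_map_eq: "E7_map x = E_even_step 6 (E7_odd_step x)"
  unfolding E_even_step_6 E7_odd_step_def E7_map_def Let_def by (simp add: fun_upd_twist)

text \<open>\<open>R i\<close> come from the tube of rank 3.  \<open>L\<close> is a product of two sums of opposite
  quantities of the tube of rank 4; the odd step fixes only the product, not the factors.\<close>

definition E7_R1 :: "(nat \<Rightarrow> complex) \<Rightarrow> complex" where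
  "E7_R1 x = (let p = 1 + x 2 * x 4; T = 1 + x 4 * x 6 in
     ((x 3)^2 + p * (1 + x 4) * T + 2 * x 3 + x 3 * x 4 * (1 + x 2 + x 6)) / (x 3 * (x 4)^2))"

definition E7_R2 :: "(nat \<Rightarrow> complex) \<Rightarrow> complex" where
  "E7_R2 x = (let p = 1 + x 2 * x 4; T = 1 + x 4 * x 6 in
     (x 3 * (1 + x 1) * (1 + x 5) + (1 + x 4) * (x 1 + p) * (x 5 + T)) / (x 2 * x 3 * x 4 * x 6))"

definition E7_R3 :: "(nat \<Rightarrow> complex) \<Rightarrow> complex" where
  "E7_R3 x = (let p = 1 + x 2 * x 4; T = 1 + x 4 * x 6 in
     (x 3 * (1 + x 1 + x 2) * (1 + x 5 + x 6) + (x 1 + (1 + x 2) * p) * (x 5 + (1 + x 6) * T)) / (x 1 * x 2 * x 4 * x 5 * x 6))"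

definition E7_L :: "(nat \<Rightarrow> complex) \<Rightarrow> complex" where
  "E7_L x = (let p = 1 + x 2 * x 4; T = 1 + x 4 * x 6 in
     ((p * T + x 5 * p + x 3 * (1 + x 5)) / (x 4 * x 6) + (p * T + x 1 * T + x 3 * (1 + x 1)) / (x 2 * x 4)) *
     ((p * (1 + x 2) * (1 + x 4) + x 3 * (1 + x 2) + x 1 * (1 + x 4) + x 1 * x 3) / (x 1 * x 2 * x 3 * x 4) +
      (T * (1 + x 6) * (1 + x 4) + x 3 * (1 + x 6) + x 5 * (1 + x 4) + x 3 * x 5) / (x 3 * x 4 * x 5 * x 6)))"

lemma E7_odd_step_action:
  assumes "x 1 * x 2 * x 3 * x 4 * x 5 * x 6 * (1 + x 2) * (1 + x 4) * (1 + x 6) * (1 + x 2 * x 4) * (1 + x 4 * x 6) \<noteq> 0"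
  shows "E7_R1 (E7_odd_step x) = E7_R1 x"
    and "E7_R2 (E7_odd_step x) = E7_R3 x"
    and "E7_R3 (E7_odd_step x) = E7_R2 x"
    and "E7_L (E7_odd_step x) = E7_L x"
proof -
  define y1 y2 y3 y4 y5 y6 where y: "y1 = x 1" "y2 = x 2" "y3 = x 3" "y4 = x 4" "y5 = x 5" "y6 = x 6"
  have *: "y1 \<noteq> 0" "y2 \<noteq> 0" "y3 \<noteq> 0" "y4 \<noteq> 0" "y5 \<noteq> 0" "y6 \<noteq> 0" "1 + y2 \<noteq> 0" "1 + y4 \<noteq> 0" "1 + y6 \<noteq> 0" "1 + y2 * y4 \<noteq> 0" "1 + y4 * y6 \<noteq> 0"
    using assms unfolding y by auto
  have o: "E7_odd_step x 1 = (1 + y2) * (1 + y2 * y4) / y1"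
    "E7_odd_step x 2 = y2"
    "E7_odd_step x 3 = (1 + y2 * y4) * (1 + y4) * (1 + y4 * y6) / y3"
    "E7_odd_step x 4 = y4"
    "E7_odd_step x 5 = (1 + y4 * y6) * (1 + y6) / y5"
    "E7_odd_step x 6 = y6"
    by (simp_all add: E7_odd_step_def y)
  show "E7_R1 (E7_odd_step x) = E7_R1 x"
    unfolding E7_R1_def Let_def o y[symmetric] by (simp add: divide_simps *) Groebner_Basis.algebra
  show "E7_R2 (E7_odd_step x) = E7_R3 x"
    unfolding E7_R2_def E7_R3_def Let_def o y[symmetric] by (simp add: divide_simps *) Groebner_Basis.algebra
  show "E7_R3 (E7_odd_step x) = E7_R2 x"
    unfolding E7_R3_def E7_R2_def Let_def o y[symmetric] by (simp add: divide_simps *) Groebner_Basis.algebra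
  show "E7_L (E7_odd_step x) = E7_L x"
    unfolding E7_L_def Let_def o y[symmetric] by (simp add: divide_simps *) Groebner_Basis.algebra
qed

lemma E7_even_step_action:
  assumes "x 1 * x 2 * x 3 * x 4 * x 5 * x 6 * (1 + x 1) * (1 + x 3) * (1 + x 5) \<noteq> 0"
  shows "E7_R1 (E_even_step 6 x) = E7_R2 x"
    and "E7_R2 (E_even_step 6 x) = E7_R1 x"
    and "E7_R3 (E_even_step 6 x) = E7_R3 x"
    and "E7_L (E_even_step 6 x) = E7_L x"
proof -
  define y1 y2 y3 y4 y5 y6 where y: "y1 = x 1" "y2 = x 2" "y3 = x 3" "y4 = x 4" "y5 = x 5" "y6 = x 6"
  have *: "y1 \<noteq> 0" "y2 \<noteq> 0" "y3 \<noteq> 0" "y4 \<noteq> 0" "y5 \<noteq> 0" "y6 \<noteq> 0" "1 + y1 \<noteq> 0" "1 + y3 \<noteq> 0" "1 + y5 \<noteq> 0"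
    using assms unfolding y by auto
  have o: "E_even_step 6 x 1 = y1"
    "E_even_step 6 x 2 = (1 + y1) / y2"
    "E_even_step 6 x 3 = y3"
    "E_even_step 6 x 4 = (1 + y3) / y4"
    "E_even_step 6 x 5 = y5"
    "E_even_step 6 x 6 = (1 + y5) / y6"
    by (simp_all add: E_even_step_6 y)
  show "E7_R1 (E_even_step 6 x) = E7_R2 x"
    unfolding E7_R1_def E7_R2_def Let_def o y[symmetric] by (simp add: divide_simps *) Groebner_Basis.algebra
  show "E7_R2 (E_even_step 6 x) = E7_R1 x"
    unfolding E7_R2_def E7_R1_def Let_def o y[symmetric] by (simp add: divide_simps *) Groebner_Basis.algebra
  show "E7_R3 (E_even_step 6 x) = E7_R3 x"
    unfolding E7_R3_def Let_def o y[symmetric] by (simp add: divide_simps *) Groebner_Basis.algebra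
  show "E7_L (E_even_step 6 x) = E7_L x"
    unfolding E7_L_def Let_def o y[symmetric] by (simp add: divide_simps *) Groebner_Basis.algebra
qed

schematic_goal E7_R1_deriv:
  assumes "x 1 * x 2 * x 3 * x 4 * x 5 * x 6 \<noteq> 0"
  shows "partial_deriv 1 E7_R1 x = ?D1"
    and "partial_deriv 2 E7_R1 x = ?D2"
    and "partial_deriv 3 E7_R1 x = ?D3"
    and "partial_deriv 4 E7_R1 x = ?D4"
    and "partial_deriv 5 E7_R1 x = ?D5"
    and "partial_deriv 6 E7_R1 x = ?D6"
  by (rule partial_deriv_eqI, simp add: E7_R1_def Let_def,
    ((rule derivative_eq_intros refl | use assms in simp)+)[1])+

\<comment> \<open>\<open>E7_R1\<close> does not involve \<open>x 1\<close> and \<open>x 5\<close>;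
  in a bracket with it, the derivatives of the other function along the conjugate coordinates
  \<open>x 2\<close> and \<open>x 6\<close> drop out. The same selection of indices serves for
  \<open>E7_L\<close>.\<close>
schematic_goal E7_R2_deriv:
  assumes "x 1 * x 2 * x 3 * x 4 * x 5 * x 6 \<noteq> 0"
  shows "partial_deriv 1 E7_R2 x = ?D1"
    and "partial_deriv 3 E7_R2 x = ?D3"
    and "partial_deriv 4 E7_R2 x = ?D4"
    and "partial_deriv 5 E7_R2 x = ?D5"
  by (rule partial_deriv_eqI, simp add: E7_R2_def Let_def,
    ((rule derivative_eq_intros refl | use assms in simp)+)[1])+

schematic_goal E7_L_deriv:
  assumes "x 1 * x 2 * x 3 * x 4 * x 5 * x 6 \<noteq> 0"
  shows "partial_deriv 1 E7_L x = ?D1"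
    and "partial_deriv 3 E7_L x = ?D3"
    and "partial_deriv 4 E7_L x = ?D4"
    and "partial_deriv 5 E7_L x = ?D5"
  by (rule partial_deriv_eqI, simp add: E7_L_def Let_def,
    ((rule derivative_eq_intros refl | use assms in simp)+)[1])+

lemma E7_bracket_R1_R2:
  assumes "x 1 * x 2 * x 3 * x 4 * x 5 * x 6 \<noteq> 0"
  shows "poisson_bracket 6 E_bracket E7_R1 E7_R2 x = - (E7_R1 x * E7_R2 x - 1)"
proof -
  \<comment> \<open>The power rule applied to the squares in the formulas leaves
    \<open>of_nat 2\<close> and the exponent \<open>2 - 1\<close>.\<close>
  have two: "of_nat 2 = (2 :: complex)" "a ^ (2 - 1) = a" for a :: complex by simp_all
  define y1 y2 y3 y4 y5 y6 where y: "y1 = x 1" "y2 = x 2" "y3 = x 3" "y4 = x 4" "y5 = x 5" "y6 = x 6"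
  have *: "y1 \<noteq> 0" "y2 \<noteq> 0" "y3 \<noteq> 0" "y4 \<noteq> 0" "y5 \<noteq> 0" "y6 \<noteq> 0" using assms unfolding y by auto
  show ?thesis
    unfolding poisson_bracket_E_6 E7_R1_deriv[OF assms] E7_R2_deriv[OF assms]
      E7_R1_def E7_R2_def Let_def two One_nat_def[symmetric] y[symmetric]
      mult_zero_left mult_zero_right add_0_left add_0_right mult_1_left mult_1_right diff_zero
    by (simp add: divide_simps *) Groebner_Basis.algebra
qed

lemma E7_bracket_R1_L:
  assumes "x 1 * x 2 * x 3 * x 4 * x 5 * x 6 \<noteq> 0"
  shows "poisson_bracket 6 E_bracket E7_R1 E7_L x = 0"
proof -
  have two: "of_nat 2 = (2 :: complex)" "a ^ (2 - 1) = a" for a :: complex by simp_all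
  define y1 y2 y3 y4 y5 y6 where y: "y1 = x 1" "y2 = x 2" "y3 = x 3" "y4 = x 4" "y5 = x 5" "y6 = x 6"
  have *: "y1 \<noteq> 0" "y2 \<noteq> 0" "y3 \<noteq> 0" "y4 \<noteq> 0" "y5 \<noteq> 0" "y6 \<noteq> 0" using assms unfolding y by auto
  show ?thesis
    unfolding poisson_bracket_E_6 E7_R1_deriv[OF assms] E7_L_deriv[OF assms]
      E7_R1_def E7_L_def Let_def two One_nat_def[symmetric] y[symmetric]
      mult_zero_left mult_zero_right add_0_left add_0_right mult_1_left mult_1_right diff_zero
    by (simp add: divide_simps *) Groebner_Basis.algebra
qed

lemma poisson_map_E7_odd_step: "poisson_map 6 E_bracket (- 1) E7_odd_step"
proof -
  define F where "F i x = (if i = 1 then (1 + x 2) * (1 + x 2 * x 4) else if i = 3 then (1 + x 2 * x 4) * (1 + x 4) * (1 + x 4 * x 6) else (1 + x 4 * x 6) * (1 + x 6))" for i :: nat and x :: "nat \<Rightarrow> complex"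
  have idx: "i \<in> {1, 3, 5}" if "i \<in> {1..2 * 3}" "even i = False" for i :: nat
  proof -
    have "1 \<le> i" "i \<le> 6" "odd i" using that by auto
    then show ?thesis unfolding insert_iff empty_iff by presburger
  qed
  have pd: "partial_deriv 2 (F 3) x = x 4 * (1 + x 4) * (1 + x 4 * x 6)"
    "partial_deriv 2 (F 5) x = 0"
    "partial_deriv 4 (F 1) x = (1 + x 2) * x 2"
    "partial_deriv 4 (F 5) x = x 6 * (1 + x 6)"
    "partial_deriv 6 (F 1) x = 0"
    "partial_deriv 6 (F 3) x = (1 + x 2 * x 4) * (1 + x 4) * x 4" for x
    by (rule partial_deriv_eqI, (auto simp: F_def algebra_simps intro!: derivative_eq_intros)[1])+
  have sym: "F 1 x * (x 2 * partial_deriv 2 (F 3) x) = F 3 x * (x 4 * partial_deriv 4 (F 1) x)"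
    "F 1 x * (x 2 * partial_deriv 2 (F 5) x) = F 5 x * (x 6 * partial_deriv 6 (F 1) x)"
    "F 3 x * (x 4 * partial_deriv 4 (F 5) x) = F 5 x * (x 6 * partial_deriv 6 (F 3) x)" for x
    by (simp_all only: pd) (simp_all add: F_def algebra_simps)
  have suc: "1 + 1 = (2 :: nat)" "3 + 1 = (4 :: nat)" "5 + 1 = (6 :: nat)" by simp_all
  have "poisson_map (2 * 3) E_bracket (- 1) E7_odd_step"
  proof (rule poisson_map_E_half[where e = False and F = F])
    fix i :: nat assume i: "i \<in> {1..2 * 3}" "even i = False"
    show "polynomial_fun (2 * 3) (F i)"
      using idx[OF i] unfolding F_def by (auto intro!: polynomial_fun.intros)
    show "\<exists>x. F i x \<noteq> 0" by (rule exI[of _ "\<lambda>_. 1"]) (simp add: F_def)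
    fix x y :: "nat \<Rightarrow> complex" assume "\<And>j. j \<in> {1..2 * 3} \<Longrightarrow> even j \<noteq> False \<Longrightarrow> x j = y j"
    then have "x 2 = y 2" "x 4 = y 4" "x 6 = y 6" by simp_all
    then show "F i x = F i y" by (simp add: F_def)
  next
    fix i :: nat and x assume i: "i \<in> {1..2 * 3}"
    show "E7_odd_step x i = (if even i = False then F i x / x i else x i)"
      using idx[OF i] by (auto simp: E7_odd_step_def F_def)
  next
    fix i j :: nat and x :: "nat \<Rightarrow> complex"
    assume ij: "i \<in> {1..2 * 3}" "j \<in> {1..2 * 3}" "even i = False" "even j = False" "i < j"
    have "(i, j) \<in> {(1, 3), (1, 5), (3, 5)}" using idx[OF ij(1,3)] idx[OF ij(2,4)] ij(5) by auto
    then show "let p = \<lambda>i. if False then i - 1 else i + 1 in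
       F i x * (x (p i) * partial_deriv (p i) (F j) x) = F j x * (x (p j) * partial_deriv (p j) (F i) x)"
      unfolding Let_def if_False using sym[of x] by (elim insertE emptyE; simp only: prod.inject suc)
  qed
  then show ?thesis by simp
qed

lemma E7_reg:
  assumes "a 1 * a 2 * a 3 * a 4 * a 5 * a 6 \<noteq> 0"
  shows "reg 6 a E7_R1"
    and "reg 6 a E7_R2"
    and "reg 6 a E7_R3"
    and "reg 6 a E7_L"
  unfolding E7_R1_def[abs_def] E7_R2_def[abs_def] E7_R3_def[abs_def] E7_L_def[abs_def] Let_def
  by (intro reg_divide reg_diff reg_add reg_mult reg_power reg_const reg_coord; use assms in simp)+

lemma E7_odd_pulls_back:
  shows "pulls_back 6 (E7_odd_step) E7_R1 E7_R1"
    and "pulls_back 6 (E7_odd_step) E7_R2 E7_R3"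
    and "pulls_back 6 (E7_odd_step) E7_R3 E7_R2"
    and "pulls_back 6 (E7_odd_step) E7_L E7_L"
proof -
  have nz: "\<forall>\<^sub>F x in gen 6. x 1 * x 2 * x 3 * x 4 * x 5 * x 6 * (1 + x 2) * (1 + x 4) * (1 + x 6) * (1 + x 2 * x 4) * (1 + x 4 * x 6) \<noteq> 0"
    by (rule eventually_gen_nonzero[where a = "\<lambda>_. 1"]) (auto intro!: polynomial_fun.intros)
  show "pulls_back 6 (E7_odd_step) E7_R1 E7_R1"
    "pulls_back 6 (E7_odd_step) E7_R2 E7_R3"
    "pulls_back 6 (E7_odd_step) E7_R3 E7_R2"
    "pulls_back 6 (E7_odd_step) E7_L E7_L"
    unfolding pulls_back_def
    by (intro conjI exI[of _ "\<lambda>_. 1"] E7_reg eventually_mono[OF nz] E7_odd_step_action; simp)+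
qed

lemma E7_even_pulls_back:
  shows "pulls_back 6 (E_even_step 6) E7_R1 E7_R2"
    and "pulls_back 6 (E_even_step 6) E7_R2 E7_R1"
    and "pulls_back 6 (E_even_step 6) E7_R3 E7_R3"
    and "pulls_back 6 (E_even_step 6) E7_L E7_L"
proof -
  have nz: "\<forall>\<^sub>F x in gen 6. x 1 * x 2 * x 3 * x 4 * x 5 * x 6 * (1 + x 1) * (1 + x 3) * (1 + x 5) \<noteq> 0"
    by (rule eventually_gen_nonzero[where a = "\<lambda>_. 1"]) (auto intro!: polynomial_fun.intros)
  show "pulls_back 6 (E_even_step 6) E7_R1 E7_R2"
    "pulls_back 6 (E_even_step 6) E7_R2 E7_R1"
    "pulls_back 6 (E_even_step 6) E7_R3 E7_R3"
    "pulls_back 6 (E_even_step 6) E7_L E7_L"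
    unfolding pulls_back_def
    by (intro conjI exI[of _ "\<lambda>_. 1"] E7_reg eventually_mono[OF nz] E7_even_step_action; simp)+
qed

text \<open>The half steps generate all permutations of the three \<open>R i\<close> and fix
  \<open>E7_L\<close>, so the pairs of \<open>R\<close>s form one orbit and the pairs of an
  \<open>R\<close> with \<open>E7_L\<close> another; one bracket of each kind is computed.\<close>

lemma E7_brackets:
  shows "bracket_law 6 (- 1) 1 E7_R1 E7_R2"
    and "bracket_law 6 0 0 E7_R1 E7_L"
    and "bracket_law 6 1 1 E7_R1 E7_R3"
    and "bracket_law 6 (- 1) 1 E7_R2 E7_R3"
    and "bracket_law 6 0 0 E7_R2 E7_L"
    and "bracket_law 6 0 0 E7_R3 E7_L"
proof -
  have nz: "\<forall>\<^sub>F x in gen 6. x 1 * x 2 * x 3 * x 4 * x 5 * x 6 \<noteq> 0"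
    by (rule eventually_gen_nonzero[where a = "\<lambda>_. 1"]) (auto intro!: polynomial_fun.intros)
  have reg: "\<exists>a. reg 6 a E7_L" "\<exists>a. reg 6 a E7_R1" "\<exists>a. reg 6 a E7_R2"
    using E7_reg[of "\<lambda>_. 1"] by auto
  note o = bracket_transport[OF poisson_map_E7_odd_step]
    and e = bracket_transport[OF poisson_map_E_even_step[of 3, simplified]]
    and po = E7_odd_pulls_back and pe = E7_even_pulls_back
  have R1R2: "bracket_law 6 (- 1) 1 E7_R1 E7_R2"
    unfolding bracket_law_def using reg nz by (auto elim!: eventually_mono simp: E7_bracket_R1_R2)
  have R1L: "bracket_law 6 0 0 E7_R1 E7_L"
    unfolding bracket_law_def using reg nz by (auto elim!: eventually_mono simp: E7_bracket_R1_L)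
  note R1R3 = o[OF po(1) po(2) R1R2]
  note R2R3 = e[OF pe(1) pe(3) R1R3]
  note R2L = e[OF pe(1) pe(4) R1L]
  note R3L = o[OF po(2) po(4) R2L]
  show "bracket_law 6 (- 1) 1 E7_R1 E7_R2"
    "bracket_law 6 0 0 E7_R1 E7_L"
    "bracket_law 6 1 1 E7_R1 E7_R3"
    "bracket_law 6 (- 1) 1 E7_R2 E7_R3"
    "bracket_law 6 0 0 E7_R2 E7_L"
    "bracket_law 6 0 0 E7_R3 E7_L"
    using R1R2 R1L R1R3 R2R3 R2L R3L by simp_all
qed

text \<open>The first two are the matching sums of a triangle. \<open>E7_L\<close> is the matching
  sum with one edge of a cycle of length 4, since (a + c)(b + d) is the sum over the edges of the
  cycle a, b, c, d of the product of the two uncovered vertices.\<close>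

definition E7_integral :: "nat \<Rightarrow> (nat \<Rightarrow> complex) \<Rightarrow> complex" where
  "E7_integral i x = (if i = 1 then E7_R1 x * E7_R2 x * E7_R3 x
     else if i = 2 then E7_R1 x + E7_R2 x + E7_R3 x
     else E7_L x)"

lemma E7_integral_simps:
  "E7_integral 1 = (\<lambda>x. E7_R1 x * E7_R2 x * E7_R3 x)"
  "E7_integral 2 = (\<lambda>x. E7_R1 x + E7_R2 x + E7_R3 x)"
  "E7_integral 3 = (\<lambda>x. E7_L x)"
  by (simp_all add: E7_integral_def fun_eq_iff)

lemma E7_base_values:
  "E7_R1 base_point = 14"
  "E7_R2 base_point = 30"
  "E7_R3 base_point = 21"
  "E7_L base_point = 399"
  by (simp_all add: E7_R1_def E7_R2_def E7_R3_def E7_L_def base_point_def Let_def)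

lemma E7_base_derivs:
  "partial_deriv 1 E7_R1 base_point = 0"
  "partial_deriv 2 E7_R1 base_point = 5"
  "partial_deriv 3 E7_R1 base_point = - 7"
  "partial_deriv 1 E7_R2 base_point = 11"
  "partial_deriv 2 E7_R2 base_point = - 22"
  "partial_deriv 3 E7_R2 base_point = - 24"
  "partial_deriv 1 E7_R3 base_point = - 16"
  "partial_deriv 2 E7_R3 base_point = - 7"
  "partial_deriv 3 E7_R3 base_point = 6"
  "partial_deriv 1 E7_L base_point = - 127"
  "partial_deriv 2 E7_L base_point = - 118"
  "partial_deriv 3 E7_L base_point = - 199"
  by (rule trans[OF partial_deriv_eqI], simp add: E7_R1_def E7_R2_def E7_R3_def E7_L_def Let_def,
    ((rule derivative_eq_intros refl | simp add: base_point_def)+)[1], simp add: base_point_def)+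

lemma E7_base_reg: "reg 6 base_point E7_R1"
    "reg 6 base_point E7_R2"
    "reg 6 base_point E7_R3"
    "reg 6 base_point E7_L"
  by (rule E7_reg, simp add: base_point_def)+

lemma E7_integral_base_derivs:
  "partial_deriv 1 (E7_integral 1) base_point = - 3486"
  "partial_deriv 2 (E7_integral 1) base_point = - 6258"
  "partial_deriv 3 (E7_integral 1) base_point = - 8946"
  "partial_deriv 1 (E7_integral 2) base_point = - 5"
  "partial_deriv 2 (E7_integral 2) base_point = - 24"
  "partial_deriv 3 (E7_integral 2) base_point = - 25"
  "partial_deriv 1 (E7_integral 3) base_point = - 127"
  "partial_deriv 2 (E7_integral 3) base_point = - 118"
  "partial_deriv 3 (E7_integral 3) base_point = - 199"
  unfolding E7_integral_simps
  by (simp_all add: partial_deriv_add[of 6] partial_deriv_mult[of 6] reg_add reg_mult E7_base_reg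
    E7_base_values E7_base_derivs[simplified One_nat_def] E7_base_derivs)

lemma E7_involution:
  "\<forall>\<^sub>F x in gen 6. poisson_bracket 6 E_bracket (E7_integral 1) (E7_integral 2) x = 0 \<and>
     poisson_bracket 6 E_bracket (E7_integral 1) (E7_integral 3) x = 0 \<and>
     poisson_bracket 6 E_bracket (E7_integral 2) (E7_integral 3) x = 0"
proof -
  have "\<forall>\<^sub>F x in gen 6. x 1 * x 2 * x 3 * x 4 * x 5 * x 6 \<noteq> 0"
    by (rule eventually_gen_nonzero[where a = "\<lambda>_. 1"]) (auto intro!: polynomial_fun.intros)
  then show ?thesis
    using E7_brackets[THEN bracket_lawD]
  proof eventually_elim
    case (elim x)
    define vR1 vR2 vR3 vL where v: "vR1 = E7_R1 x" "vR2 = E7_R2 x" "vR3 = E7_R3 x" "vL = E7_L x"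
    have self: "poisson_bracket 6 E_bracket f f x = 0" for f
      using poisson_bracket_E_skew[of 6 f f x] by simp
    note swap = elim(2-)[THEN poisson_bracket_E_swap]
    note leibniz = poisson_bracket_leibniz[where n = 6] reg_add[where n = 6] reg_mult[where n = 6] E7_reg[OF elim(1)]
    have I12: "poisson_bracket 6 E_bracket (E7_integral 1) (E7_integral 2) x = 0"
      unfolding E7_integral_simps by (simp only: leibniz, unfold swap elim self v[symmetric], Groebner_Basis.algebra)
    have I13: "poisson_bracket 6 E_bracket (E7_integral 1) (E7_integral 3) x = 0"
      unfolding E7_integral_simps by (simp only: leibniz, unfold swap elim self v[symmetric], Groebner_Basis.algebra)
    have I23: "poisson_bracket 6 E_bracket (E7_integral 2) (E7_integral 3) x = 0"
      unfolding E7_integral_simps by (simp only: leibniz, unfold swap elim self v[symmetric], Groebner_Basis.algebra)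
    show ?case using I12 I13 I23 by blast
  qed
qed

lemma E7_map_completely_integrable: "completely_integrable 3 E_form E7_map"
proof (rule completely_integrable_E[where \<iota> = E7_odd_step and I = E7_integral and a = base_point])
  have idx: "i \<in> {1, 2, 3}" if "i \<in> {1..3}" for i :: nat using that by auto
  let ?I = E7_integral
  show "E7_map x = E_even_step (2 * 3) (E7_odd_step x)" for x by (simp add: E7_map_eq)
  show "poisson_map (2 * 3) E_bracket (- 1) E7_odd_step" using poisson_map_E7_odd_step by simp
  show "reg (2 * 3) base_point (E7_integral i)" if "i \<in> {1..3}" for i
    using idx[OF that] E7_base_reg by (auto simp: E7_integral_simps simp del: One_nat_def intro!: reg_add reg_mult)
  show "\<forall>\<^sub>F x in gen (2 * 3). ?I i (E7_odd_step x) = E7_integral i x" for i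
  proof -
    have "\<forall>\<^sub>F x in gen 6. ?I i (E7_odd_step x) = E7_integral i x"
      using E7_odd_pulls_back[THEN pulls_backD] by eventually_elim (simp add: E7_integral_def algebra_simps)
    then show ?thesis by simp
  qed
  show "\<forall>\<^sub>F x in gen (2 * 3). E7_integral i (E_even_step (2 * 3) x) = ?I i x" for i
  proof -
    have "\<forall>\<^sub>F x in gen 6. E7_integral i (E_even_step 6 x) = ?I i x"
      using E7_even_pulls_back[THEN pulls_backD] by eventually_elim (simp add: E7_integral_def algebra_simps)
    then show ?thesis by simp
  qed
  show "\<forall>i\<in>{1..3}. c i = 0"
    if c: "\<And>l. l \<in> {1..3} \<Longrightarrow> (\<Sum>i=1..3. c i * partial_deriv l (E7_integral i) base_point) = 0" for c
  proof -
    have sum: "(\<Sum>i=1..3. f i) = f 1 + f 2 + f 3" for f :: "nat \<Rightarrow> complex" by (simp add: eval_nat_numeral)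
    define c1 c2 c3 where k: "c1 = c 1" "c2 = c 2" "c3 = c 3"
    have eq: "c1 * (- 3486) + c2 * (- 5) + c3 * (- 127) = 0"
      "c1 * (- 6258) + c2 * (- 24) + c3 * (- 118) = 0"
      "c1 * (- 8946) + c2 * (- 25) + c3 * (- 199) = 0"
      using c[of 1] c[of 2] c[of 3] unfolding sum E7_integral_base_derivs k by simp_all
    have "c1 = 0"
    proof -
      \<comment> \<open>Again the multipliers are the cofactors of one column divided by a common
        factor, and the left-hand coefficient is the determinant divided by the same factor.\<close>
      have "c1 * (990696) - ((c1 * (- 3486) + c2 * (- 5) + c3 * (- 127)) * (913) +
         (c1 * (- 6258) + c2 * (- 24) + c3 * (- 118)) * (1090) +
         (c1 * (- 8946) + c2 * (- 25) + c3 * (- 199)) * (- 1229)) = 0"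
        by Groebner_Basis.algebra
      then show ?thesis unfolding eq by simp
    qed
    moreover
    have "c2 = 0"
    proof -
      have "c2 * (47176) - ((c1 * (- 3486) + c2 * (- 5) + c3 * (- 127)) * (- 4517) +
         (c1 * (- 6258) + c2 * (- 24) + c3 * (- 118)) * (- 10534) +
         (c1 * (- 8946) + c2 * (- 25) + c3 * (- 199)) * (9129)) = 0"
        by Groebner_Basis.algebra
      then show ?thesis unfolding eq by simp
    qed
    moreover
    have "c3 = 0"
    proof -
      have "c3 * (47176) - ((c1 * (- 3486) + c2 * (- 5) + c3 * (- 127)) * (- 1387) +
         (c1 * (- 6258) + c2 * (- 24) + c3 * (- 118)) * (- 1010) +
         (c1 * (- 8946) + c2 * (- 25) + c3 * (- 199)) * (1247)) = 0"
        by Groebner_Basis.algebra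
      then show ?thesis unfolding eq by simp
    qed
    ultimately have "c i = 0" if "i \<in> {1..3}" for i
      using idx[OF that] unfolding k by (auto simp del: One_nat_def)
    then show ?thesis by blast
  qed
  show "\<forall>\<^sub>F x in gen (2 * 3). poisson_bracket (2 * 3) E_bracket (E7_integral i) (E7_integral j) x = 0"
    if "i \<in> {1..3}" "j \<in> {1..3}" "i < j" for i j
  proof -
    have "(i, j) \<in> {(1, 2), (1, 3), (2, 3)}" using idx[OF that(1)] idx[OF that(2)] that(3) by auto
    moreover have "2 * 3 = (6 :: nat)" by simp
    ultimately show ?thesis using E7_involution by (auto simp only: insert_iff empty_iff prod.inject eventually_conj_iff)
  qed
qed

subsection \<open>The quiver of type E8\<close>

definition E8_odd_step :: "(nat \<Rightarrow> complex) \<Rightarrow> nat \<Rightarrow> complex" where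
  "E8_odd_step x = x(1 := (1 + x 2) * (1 + x 2 * x 4) / x 1,
     3 := (1 + x 2 * x 4) * (1 + x 4 * x 6) / x 3,
     5 := (1 + x 4 * x 6) * (1 + x 6) * (1 + x 6 * x 8) / x 5,
     7 := (1 + x 6 * x 8) / x 7)"

lemma E8_map_eq: "E8_map x = E_even_step 8 (E8_odd_step x)"
  unfolding E_even_step_8 E8_odd_step_def E8_map_def Let_def by (simp add: fun_upd_twist)

text \<open>\<open>J i\<close> come from the tube of rank 5, in zigzag order \<open>1, 2, 4, 5, 3\<close> along the cycle, and
  \<open>K i\<close> from the tube of rank 3.\<close>

definition E8_J1 :: "(nat \<Rightarrow> complex) \<Rightarrow> complex" where
  "E8_J1 x = (let T = 1 + x 4 * x 6; q = 1 + x 6 * x 8 in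
     ((x 5)^2 + T * (1 + x 6) * q + 2 * x 5 + x 5 * x 6 * (1 + x 4 + x 8)) / (x 5 * (x 6)^2))"

definition E8_J2 :: "(nat \<Rightarrow> complex) \<Rightarrow> complex" where
  "E8_J2 x = (let T = 1 + x 4 * x 6; q = 1 + x 6 * x 8 in
     (x 5 * (1 + x 3) * (1 + x 7) + (1 + x 6) * (x 3 + T) * (x 7 + q)) / (x 4 * x 5 * x 6 * x 8))"

definition E8_J3 :: "(nat \<Rightarrow> complex) \<Rightarrow> complex" where
  "E8_J3 x = (let p = 1 + x 2 * x 4; T = 1 + x 4 * x 6; q = 1 + x 6 * x 8 in
     (x 3 * (x 5 * (1 + x 7) + x 7 + q) + p * (x 5 * (1 + x 7) + T * (x 7 + q))) / (x 3 * x 4 * x 6 * x 7 * x 8))"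

definition E8_J4 :: "(nat \<Rightarrow> complex) \<Rightarrow> complex" where
  "E8_J4 x = (let p = 1 + x 2 * x 4; T = 1 + x 4 * x 6; q = 1 + x 6 * x 8 in
     (x 3 * (1 + x 1) * (x 5 + q) + (x 1 + p) * (x 5 + T * q)) / (x 2 * x 3 * x 4 * x 6 * x 7))"

definition E8_J5 :: "(nat \<Rightarrow> complex) \<Rightarrow> complex" where
  "E8_J5 x = (let p = 1 + x 2 * x 4; T = 1 + x 4 * x 6 in
     x 7 * (x 3 * (1 + x 1 + x 2) * (1 + x 5 + x 6) + (x 1 + (1 + x 2) * p) * (x 5 + (1 + x 6) * T)) / (x 1 * x 2 * x 4 * x 5 * x 6))"

definition E8_K1 :: "(nat \<Rightarrow> complex) \<Rightarrow> complex" where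
  "E8_K1 x = (let p = 1 + x 2 * x 4; T = 1 + x 4 * x 6; q = 1 + x 6 * x 8; e = 2 + x 6 * (1 + x 8) in
     ((x 3)^2 * (x 5)^2 + T^2 * p * (1 + x 6) * q + (x 3)^2 * (1 + x 6) * q + (x 5)^2 * p + e * ((x 3)^2 * x 5 + T * p * x 5) + (1 + p) * (x 3 * (x 5)^2 + T * (1 + x 6) * q * x 3) + x 3 * x 5 * (e * (1 + p) + x 4 * x 6 * (e + p - 1))) / (x 3 * x 5 * (x 4)^2 * (x 6)^2))"

definition E8_K2 :: "(nat \<Rightarrow> complex) \<Rightarrow> complex" where
  "E8_K2 x = (let p = 1 + x 2 * x 4; T = 1 + x 4 * x 6; q = 1 + x 6 * x 8 in
     ((1 + x 1) * x 3 * ((x 5)^2 * (1 + x 7) + x 5 * (x 7 * (1 + x 6 + T) + q + x 6 + T) + (1 + x 6) * T * (x 7 + q)) + (x 1 + p) * ((x 5)^2 * (1 + x 7) + x 5 * T * (x 7 * (2 + x 6) + 1 + x 6 + q) + T^2 * (1 + x 6) * (x 7 + q))) / (x 2 * x 3 * x 4 * x 5 * (x 6)^2 * x 8))"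

definition E8_K3 :: "(nat \<Rightarrow> complex) \<Rightarrow> complex" where
  "E8_K3 x = (let p = 1 + x 2 * x 4; T = 1 + x 4 * x 6; q = 1 + x 6 * x 8 in
     ((x 1 + (1 + x 2) * p) * ((x 5)^2 * (1 + x 7) + x 5 * (q * (1 + x 6 + T) + x 7 * (q + x 6 + T)) + T * (1 + x 6) * q * (x 7 + q)) + x 3 * (1 + x 1 + x 2) * ((x 5)^2 * (1 + x 7) + x 5 * (q * (2 + x 6) + x 7 * (1 + x 6 + q)) + (1 + x 6) * q * (x 7 + q))) / (x 1 * x 2 * x 4 * x 5 * (x 6)^2 * x 7 * x 8))"

lemma E8_odd_step_action:
  assumes "x 1 * x 2 * x 3 * x 4 * x 5 * x 6 * x 7 * x 8 * (1 + x 2) * (1 + x 2 * x 4) * (1 + x 4 * x 6) * (1 + x 6) * (1 + x 6 * x 8) \<noteq> 0"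
  shows "E8_J1 (E8_odd_step x) = E8_J1 x"
    and "E8_J2 (E8_odd_step x) = E8_J3 x"
    and "E8_J3 (E8_odd_step x) = E8_J2 x"
    and "E8_J4 (E8_odd_step x) = E8_J5 x"
    and "E8_J5 (E8_odd_step x) = E8_J4 x"
    and "E8_K1 (E8_odd_step x) = E8_K1 x"
    and "E8_K2 (E8_odd_step x) = E8_K3 x"
    and "E8_K3 (E8_odd_step x) = E8_K2 x"
proof -
  define y1 y2 y3 y4 y5 y6 y7 y8 where y: "y1 = x 1" "y2 = x 2" "y3 = x 3" "y4 = x 4" "y5 = x 5" "y6 = x 6" "y7 = x 7" "y8 = x 8"
  have *: "y1 \<noteq> 0" "y2 \<noteq> 0" "y3 \<noteq> 0" "y4 \<noteq> 0" "y5 \<noteq> 0" "y6 \<noteq> 0" "y7 \<noteq> 0" "y8 \<noteq> 0" "1 + y2 \<noteq> 0" "1 + y2 * y4 \<noteq> 0" "1 + y4 * y6 \<noteq> 0" "1 + y6 \<noteq> 0" "1 + y6 * y8 \<noteq> 0"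
    using assms unfolding y by auto
  have o: "E8_odd_step x 1 = (1 + y2) * (1 + y2 * y4) / y1"
    "E8_odd_step x 2 = y2"
    "E8_odd_step x 3 = (1 + y2 * y4) * (1 + y4 * y6) / y3"
    "E8_odd_step x 4 = y4"
    "E8_odd_step x 5 = (1 + y4 * y6) * (1 + y6) * (1 + y6 * y8) / y5"
    "E8_odd_step x 6 = y6"
    "E8_odd_step x 7 = (1 + y6 * y8) / y7"
    "E8_odd_step x 8 = y8"
    by (simp_all add: E8_odd_step_def y)
  show "E8_J1 (E8_odd_step x) = E8_J1 x"
    unfolding E8_J1_def Let_def o y[symmetric] by (simp add: divide_simps *) Groebner_Basis.algebra
  show "E8_J2 (E8_odd_step x) = E8_J3 x"
    unfolding E8_J2_def E8_J3_def Let_def o y[symmetric] by (simp add: divide_simps *) Groebner_Basis.algebra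
  show "E8_J3 (E8_odd_step x) = E8_J2 x"
    unfolding E8_J3_def E8_J2_def Let_def o y[symmetric] by (simp add: divide_simps *) Groebner_Basis.algebra
  show "E8_J4 (E8_odd_step x) = E8_J5 x"
    unfolding E8_J4_def E8_J5_def Let_def o y[symmetric] by (simp add: divide_simps *) Groebner_Basis.algebra
  show "E8_J5 (E8_odd_step x) = E8_J4 x"
    unfolding E8_J5_def E8_J4_def Let_def o y[symmetric] by (simp add: divide_simps *) Groebner_Basis.algebra
  show "E8_K1 (E8_odd_step x) = E8_K1 x"
    unfolding E8_K1_def Let_def o y[symmetric] by (simp add: divide_simps *) Groebner_Basis.algebra
  show "E8_K2 (E8_odd_step x) = E8_K3 x"
    unfolding E8_K2_def E8_K3_def Let_def o y[symmetric] by (simp add: divide_simps *) Groebner_Basis.algebra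
  show "E8_K3 (E8_odd_step x) = E8_K2 x"
    unfolding E8_K3_def E8_K2_def Let_def o y[symmetric] by (simp add: divide_simps *) Groebner_Basis.algebra
qed

lemma E8_even_step_action:
  assumes "x 1 * x 2 * x 3 * x 4 * x 5 * x 6 * x 7 * x 8 * (1 + x 1) * (1 + x 3) * (1 + x 5) * (1 + x 7) \<noteq> 0"
  shows "E8_J1 (E_even_step 8 x) = E8_J2 x"
    and "E8_J2 (E_even_step 8 x) = E8_J1 x"
    and "E8_J3 (E_even_step 8 x) = E8_J4 x"
    and "E8_J4 (E_even_step 8 x) = E8_J3 x"
    and "E8_J5 (E_even_step 8 x) = E8_J5 x"
    and "E8_K1 (E_even_step 8 x) = E8_K2 x"
    and "E8_K2 (E_even_step 8 x) = E8_K1 x"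
    and "E8_K3 (E_even_step 8 x) = E8_K3 x"
proof -
  define y1 y2 y3 y4 y5 y6 y7 y8 where y: "y1 = x 1" "y2 = x 2" "y3 = x 3" "y4 = x 4" "y5 = x 5" "y6 = x 6" "y7 = x 7" "y8 = x 8"
  have *: "y1 \<noteq> 0" "y2 \<noteq> 0" "y3 \<noteq> 0" "y4 \<noteq> 0" "y5 \<noteq> 0" "y6 \<noteq> 0" "y7 \<noteq> 0" "y8 \<noteq> 0" "1 + y1 \<noteq> 0" "1 + y3 \<noteq> 0" "1 + y5 \<noteq> 0" "1 + y7 \<noteq> 0"
    using assms unfolding y by auto
  have o: "E_even_step 8 x 1 = y1"
    "E_even_step 8 x 2 = (1 + y1) / y2"
    "E_even_step 8 x 3 = y3"
    "E_even_step 8 x 4 = (1 + y3) / y4"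
    "E_even_step 8 x 5 = y5"
    "E_even_step 8 x 6 = (1 + y5) / y6"
    "E_even_step 8 x 7 = y7"
    "E_even_step 8 x 8 = (1 + y7) / y8"
    by (simp_all add: E_even_step_8 y)
  show "E8_J1 (E_even_step 8 x) = E8_J2 x"
    unfolding E8_J1_def E8_J2_def Let_def o y[symmetric] by (simp add: divide_simps *) Groebner_Basis.algebra
  show "E8_J2 (E_even_step 8 x) = E8_J1 x"
    unfolding E8_J2_def E8_J1_def Let_def o y[symmetric] by (simp add: divide_simps *) Groebner_Basis.algebra
  show "E8_J3 (E_even_step 8 x) = E8_J4 x"
    unfolding E8_J3_def E8_J4_def Let_def o y[symmetric] by (simp add: divide_simps *) Groebner_Basis.algebra
  show "E8_J4 (E_even_step 8 x) = E8_J3 x"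
    unfolding E8_J4_def E8_J3_def Let_def o y[symmetric] by (simp add: divide_simps *) Groebner_Basis.algebra
  show "E8_J5 (E_even_step 8 x) = E8_J5 x"
    unfolding E8_J5_def Let_def o y[symmetric] by (simp add: divide_simps *) Groebner_Basis.algebra
  show "E8_K1 (E_even_step 8 x) = E8_K2 x"
    unfolding E8_K1_def E8_K2_def Let_def o y[symmetric] by (simp add: divide_simps *) Groebner_Basis.algebra
  show "E8_K2 (E_even_step 8 x) = E8_K1 x"
    unfolding E8_K2_def E8_K1_def Let_def o y[symmetric] by (simp add: divide_simps *) Groebner_Basis.algebra
  show "E8_K3 (E_even_step 8 x) = E8_K3 x"
    unfolding E8_K3_def Let_def o y[symmetric] by (simp add: divide_simps *) Groebner_Basis.algebra
qed

schematic_goal E8_J1_deriv: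
  assumes "x 1 * x 2 * x 3 * x 4 * x 5 * x 6 * x 7 * x 8 \<noteq> 0"
  shows "partial_deriv 1 E8_J1 x = ?D1"
    and "partial_deriv 2 E8_J1 x = ?D2"
    and "partial_deriv 3 E8_J1 x = ?D3"
    and "partial_deriv 4 E8_J1 x = ?D4"
    and "partial_deriv 5 E8_J1 x = ?D5"
    and "partial_deriv 6 E8_J1 x = ?D6"
    and "partial_deriv 7 E8_J1 x = ?D7"
    and "partial_deriv 8 E8_J1 x = ?D8"
  by (rule partial_deriv_eqI, simp add: E8_J1_def Let_def,
    ((rule derivative_eq_intros refl | use assms in simp)+)[1])+

\<comment> \<open>\<open>E8_J1\<close> involves only \<open>x 4\<close>, \<open>x 5\<close>,
  \<open>x 6\<close> and \<open>x 8\<close>. A bracket with it therefore needs the derivatives of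
  the other function along the conjugate coordinates 3, 6, 5 and 7 alone.\<close>
schematic_goal E8_J2_deriv:
  assumes "x 1 * x 2 * x 3 * x 4 * x 5 * x 6 * x 7 * x 8 \<noteq> 0"
  shows "partial_deriv 3 E8_J2 x = ?D3"
    and "partial_deriv 5 E8_J2 x = ?D5"
    and "partial_deriv 6 E8_J2 x = ?D6"
    and "partial_deriv 7 E8_J2 x = ?D7"
  by (rule partial_deriv_eqI, simp add: E8_J2_def Let_def,
    ((rule derivative_eq_intros refl | use assms in simp)+)[1])+

schematic_goal E8_J4_deriv:
  assumes "x 1 * x 2 * x 3 * x 4 * x 5 * x 6 * x 7 * x 8 \<noteq> 0"
  shows "partial_deriv 3 E8_J4 x = ?D3"
    and "partial_deriv 5 E8_J4 x = ?D5"
    and "partial_deriv 6 E8_J4 x = ?D6"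
    and "partial_deriv 7 E8_J4 x = ?D7"
  by (rule partial_deriv_eqI, simp add: E8_J4_def Let_def,
    ((rule derivative_eq_intros refl | use assms in simp)+)[1])+

schematic_goal E8_K1_deriv:
  assumes "x 1 * x 2 * x 3 * x 4 * x 5 * x 6 * x 7 * x 8 \<noteq> 0"
  shows "partial_deriv 3 E8_K1 x = ?D3"
    and "partial_deriv 5 E8_K1 x = ?D5"
    and "partial_deriv 6 E8_K1 x = ?D6"
    and "partial_deriv 7 E8_K1 x = ?D7"
  by (rule partial_deriv_eqI, simp add: E8_K1_def Let_def,
    ((rule derivative_eq_intros refl | use assms in simp)+)[1])+

lemma E8_bracket_J1_J2:
  assumes "x 1 * x 2 * x 3 * x 4 * x 5 * x 6 * x 7 * x 8 \<noteq> 0"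
  shows "poisson_bracket 8 E_bracket E8_J1 E8_J2 x = - (E8_J1 x * E8_J2 x - 1)"
proof -
  have two: "of_nat 2 = (2 :: complex)" "a ^ (2 - 1) = a" for a :: complex by simp_all
  define y1 y2 y3 y4 y5 y6 y7 y8 where y: "y1 = x 1" "y2 = x 2" "y3 = x 3" "y4 = x 4" "y5 = x 5" "y6 = x 6" "y7 = x 7" "y8 = x 8"
  have *: "y1 \<noteq> 0" "y2 \<noteq> 0" "y3 \<noteq> 0" "y4 \<noteq> 0" "y5 \<noteq> 0" "y6 \<noteq> 0" "y7 \<noteq> 0" "y8 \<noteq> 0" using assms unfolding y by auto
  show ?thesis
    unfolding poisson_bracket_E_8 E8_J1_deriv[OF assms] E8_J2_deriv[OF assms]
      E8_J1_def E8_J2_def Let_def two One_nat_def[symmetric] y[symmetric]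
      mult_zero_left mult_zero_right add_0_left add_0_right mult_1_left mult_1_right diff_zero
    by (simp add: divide_simps *) Groebner_Basis.algebra
qed

lemma E8_bracket_J1_J4:
  assumes "x 1 * x 2 * x 3 * x 4 * x 5 * x 6 * x 7 * x 8 \<noteq> 0"
  shows "poisson_bracket 8 E_bracket E8_J1 E8_J4 x = E8_J1 x * E8_J4 x"
proof -
  have two: "of_nat 2 = (2 :: complex)" "a ^ (2 - 1) = a" for a :: complex by simp_all
  define y1 y2 y3 y4 y5 y6 y7 y8 where y: "y1 = x 1" "y2 = x 2" "y3 = x 3" "y4 = x 4" "y5 = x 5" "y6 = x 6" "y7 = x 7" "y8 = x 8"
  have *: "y1 \<noteq> 0" "y2 \<noteq> 0" "y3 \<noteq> 0" "y4 \<noteq> 0" "y5 \<noteq> 0" "y6 \<noteq> 0" "y7 \<noteq> 0" "y8 \<noteq> 0" using assms unfolding y by auto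
  show ?thesis
    unfolding poisson_bracket_E_8 E8_J1_deriv[OF assms] E8_J4_deriv[OF assms]
      E8_J1_def E8_J4_def Let_def two One_nat_def[symmetric] y[symmetric]
      mult_zero_left mult_zero_right add_0_left add_0_right mult_1_left mult_1_right diff_zero
    by (simp add: divide_simps *) Groebner_Basis.algebra
qed

lemma E8_bracket_J1_K1:
  assumes "x 1 * x 2 * x 3 * x 4 * x 5 * x 6 * x 7 * x 8 \<noteq> 0"
  shows "poisson_bracket 8 E_bracket E8_J1 E8_K1 x = 0"
proof -
  have two: "of_nat 2 = (2 :: complex)" "a ^ (2 - 1) = a" for a :: complex by simp_all
  define y1 y2 y3 y4 y5 y6 y7 y8 where y: "y1 = x 1" "y2 = x 2" "y3 = x 3" "y4 = x 4" "y5 = x 5" "y6 = x 6" "y7 = x 7" "y8 = x 8"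
  have *: "y1 \<noteq> 0" "y2 \<noteq> 0" "y3 \<noteq> 0" "y4 \<noteq> 0" "y5 \<noteq> 0" "y6 \<noteq> 0" "y7 \<noteq> 0" "y8 \<noteq> 0" using assms unfolding y by auto
  show ?thesis
    unfolding poisson_bracket_E_8 E8_J1_deriv[OF assms] E8_K1_deriv[OF assms]
      E8_J1_def E8_K1_def Let_def two One_nat_def[symmetric] y[symmetric]
      mult_zero_left mult_zero_right add_0_left add_0_right mult_1_left mult_1_right diff_zero
    by (simp add: divide_simps *) Groebner_Basis.algebra
qed

text \<open>Two consecutive exchange polynomials share one factor, \<open>1 + x 2 * x 4\<close>,
  \<open>1 + x 4 * x 6\<close> or \<open>1 + x 6 * x 8\<close>, and each depends on the partner of
  the other only through it. Nonconsecutive ones do not involve each other's partners.\<close>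

lemma poisson_map_E8_odd_step: "poisson_map 8 E_bracket (- 1) E8_odd_step"
proof -
  define F where "F i x = (if i = 1 then (1 + x 2) * (1 + x 2 * x 4) else if i = 3 then (1 + x 2 * x 4) * (1 + x 4 * x 6) else if i = 5 then (1 + x 4 * x 6) * (1 + x 6) * (1 + x 6 * x 8) else 1 + x 6 * x 8)" for i :: nat and x :: "nat \<Rightarrow> complex"
  have idx: "i \<in> {1, 3, 5, 7}" if "i \<in> {1..2 * 4}" "even i = False" for i :: nat
  proof -
    have "1 \<le> i" "i \<le> 8" "odd i" using that by auto
    then show ?thesis unfolding insert_iff empty_iff by presburger
  qed
  have pd: "partial_deriv 2 (F 3) x = x 4 * (1 + x 4 * x 6)"
    "partial_deriv 2 (F 5) x = 0"
    "partial_deriv 2 (F 7) x = 0"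
    "partial_deriv 4 (F 1) x = (1 + x 2) * x 2"
    "partial_deriv 4 (F 5) x = x 6 * (1 + x 6) * (1 + x 6 * x 8)"
    "partial_deriv 4 (F 7) x = 0"
    "partial_deriv 6 (F 1) x = 0"
    "partial_deriv 6 (F 3) x = (1 + x 2 * x 4) * x 4"
    "partial_deriv 6 (F 7) x = x 8"
    "partial_deriv 8 (F 1) x = 0"
    "partial_deriv 8 (F 3) x = 0"
    "partial_deriv 8 (F 5) x = (1 + x 4 * x 6) * (1 + x 6) * x 6" for x
    by (rule partial_deriv_eqI, (auto simp: F_def algebra_simps intro!: derivative_eq_intros)[1])+
  have sym: "F 1 x * (x 2 * partial_deriv 2 (F 3) x) = F 3 x * (x 4 * partial_deriv 4 (F 1) x)"
    "F 1 x * (x 2 * partial_deriv 2 (F 5) x) = F 5 x * (x 6 * partial_deriv 6 (F 1) x)"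
    "F 1 x * (x 2 * partial_deriv 2 (F 7) x) = F 7 x * (x 8 * partial_deriv 8 (F 1) x)"
    "F 3 x * (x 4 * partial_deriv 4 (F 5) x) = F 5 x * (x 6 * partial_deriv 6 (F 3) x)"
    "F 3 x * (x 4 * partial_deriv 4 (F 7) x) = F 7 x * (x 8 * partial_deriv 8 (F 3) x)"
    "F 5 x * (x 6 * partial_deriv 6 (F 7) x) = F 7 x * (x 8 * partial_deriv 8 (F 5) x)" for x
    by (simp_all only: pd) (simp_all add: F_def algebra_simps)
  have suc: "1 + 1 = (2 :: nat)" "3 + 1 = (4 :: nat)" "5 + 1 = (6 :: nat)" "7 + 1 = (8 :: nat)" by simp_all
  have "poisson_map (2 * 4) E_bracket (- 1) E8_odd_step"
  proof (rule poisson_map_E_half[where e = False and F = F])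
    fix i :: nat assume i: "i \<in> {1..2 * 4}" "even i = False"
    show "polynomial_fun (2 * 4) (F i)"
      using idx[OF i] unfolding F_def by (auto intro!: polynomial_fun.intros)
    show "\<exists>x. F i x \<noteq> 0" by (rule exI[of _ "\<lambda>_. 1"]) (simp add: F_def)
    fix x y :: "nat \<Rightarrow> complex" assume "\<And>j. j \<in> {1..2 * 4} \<Longrightarrow> even j \<noteq> False \<Longrightarrow> x j = y j"
    then have "x 2 = y 2" "x 4 = y 4" "x 6 = y 6" "x 8 = y 8" by simp_all
    then show "F i x = F i y" by (simp add: F_def)
  next
    fix i :: nat and x assume i: "i \<in> {1..2 * 4}"
    show "E8_odd_step x i = (if even i = False then F i x / x i else x i)"
      using idx[OF i] by (auto simp: E8_odd_step_def F_def)
  next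
    fix i j :: nat and x :: "nat \<Rightarrow> complex"
    assume ij: "i \<in> {1..2 * 4}" "j \<in> {1..2 * 4}" "even i = False" "even j = False" "i < j"
    have "(i, j) \<in> {(1, 3), (1, 5), (1, 7), (3, 5), (3, 7), (5, 7)}" using idx[OF ij(1,3)] idx[OF ij(2,4)] ij(5) by auto
    then show "let p = \<lambda>i. if False then i - 1 else i + 1 in
       F i x * (x (p i) * partial_deriv (p i) (F j) x) = F j x * (x (p j) * partial_deriv (p j) (F i) x)"
      unfolding Let_def if_False using sym[of x] by (elim insertE emptyE; simp only: prod.inject suc)
  qed
  then show ?thesis by simp
qed

lemma E8_reg:
  assumes "a 1 * a 2 * a 3 * a 4 * a 5 * a 6 * a 7 * a 8 \<noteq> 0"
  shows "reg 8 a E8_J1"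
    and "reg 8 a E8_J2"
    and "reg 8 a E8_J3"
    and "reg 8 a E8_J4"
    and "reg 8 a E8_J5"
    and "reg 8 a E8_K1"
    and "reg 8 a E8_K2"
    and "reg 8 a E8_K3"
  unfolding E8_J1_def[abs_def] E8_J2_def[abs_def] E8_J3_def[abs_def] E8_J4_def[abs_def] E8_J5_def[abs_def] E8_K1_def[abs_def] E8_K2_def[abs_def] E8_K3_def[abs_def] Let_def
  by (intro reg_divide reg_diff reg_add reg_mult reg_power reg_const reg_coord; use assms in simp)+

lemma E8_odd_pulls_back:
  shows "pulls_back 8 (E8_odd_step) E8_J1 E8_J1"
    and "pulls_back 8 (E8_odd_step) E8_J2 E8_J3"
    and "pulls_back 8 (E8_odd_step) E8_J3 E8_J2"
    and "pulls_back 8 (E8_odd_step) E8_J4 E8_J5"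
    and "pulls_back 8 (E8_odd_step) E8_J5 E8_J4"
    and "pulls_back 8 (E8_odd_step) E8_K1 E8_K1"
    and "pulls_back 8 (E8_odd_step) E8_K2 E8_K3"
    and "pulls_back 8 (E8_odd_step) E8_K3 E8_K2"
proof -
  have nz: "\<forall>\<^sub>F x in gen 8. x 1 * x 2 * x 3 * x 4 * x 5 * x 6 * x 7 * x 8 * (1 + x 2) * (1 + x 2 * x 4) * (1 + x 4 * x 6) * (1 + x 6) * (1 + x 6 * x 8) \<noteq> 0"
    by (rule eventually_gen_nonzero[where a = "\<lambda>_. 1"]) (auto intro!: polynomial_fun.intros)
  show "pulls_back 8 (E8_odd_step) E8_J1 E8_J1"
    "pulls_back 8 (E8_odd_step) E8_J2 E8_J3"
    "pulls_back 8 (E8_odd_step) E8_J3 E8_J2"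
    "pulls_back 8 (E8_odd_step) E8_J4 E8_J5"
    "pulls_back 8 (E8_odd_step) E8_J5 E8_J4"
    "pulls_back 8 (E8_odd_step) E8_K1 E8_K1"
    "pulls_back 8 (E8_odd_step) E8_K2 E8_K3"
    "pulls_back 8 (E8_odd_step) E8_K3 E8_K2"
    unfolding pulls_back_def
    by (intro conjI exI[of _ "\<lambda>_. 1"] E8_reg eventually_mono[OF nz] E8_odd_step_action; simp)+
qed

lemma E8_even_pulls_back:
  shows "pulls_back 8 (E_even_step 8) E8_J1 E8_J2"
    and "pulls_back 8 (E_even_step 8) E8_J2 E8_J1"
    and "pulls_back 8 (E_even_step 8) E8_J3 E8_J4"
    and "pulls_back 8 (E_even_step 8) E8_J4 E8_J3"
    and "pulls_back 8 (E_even_step 8) E8_J5 E8_J5"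
    and "pulls_back 8 (E_even_step 8) E8_K1 E8_K2"
    and "pulls_back 8 (E_even_step 8) E8_K2 E8_K1"
    and "pulls_back 8 (E_even_step 8) E8_K3 E8_K3"
proof -
  have nz: "\<forall>\<^sub>F x in gen 8. x 1 * x 2 * x 3 * x 4 * x 5 * x 6 * x 7 * x 8 * (1 + x 1) * (1 + x 3) * (1 + x 5) * (1 + x 7) \<noteq> 0"
    by (rule eventually_gen_nonzero[where a = "\<lambda>_. 1"]) (auto intro!: polynomial_fun.intros)
  show "pulls_back 8 (E_even_step 8) E8_J1 E8_J2"
    "pulls_back 8 (E_even_step 8) E8_J2 E8_J1"
    "pulls_back 8 (E_even_step 8) E8_J3 E8_J4"
    "pulls_back 8 (E_even_step 8) E8_J4 E8_J3"
    "pulls_back 8 (E_even_step 8) E8_J5 E8_J5"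
    "pulls_back 8 (E_even_step 8) E8_K1 E8_K2"
    "pulls_back 8 (E_even_step 8) E8_K2 E8_K1"
    "pulls_back 8 (E_even_step 8) E8_K3 E8_K3"
    unfolding pulls_back_def
    by (intro conjI exI[of _ "\<lambda>_. 1"] E8_reg eventually_mono[OF nz] E8_even_step_action; simp)+
qed

text \<open>The full map rotates the five \<open>J i\<close> and the three \<open>K i\<close>. Since
  5 and 3 are coprime, the fifteen mixed pairs form a single orbit; the pairs of \<open>J\<close>s
  form two, adjacent and nonadjacent. Hence three computed brackets suffice.\<close>

lemma E8_brackets:
  shows "bracket_law 8 (- 1) 1 E8_J1 E8_J2"
    and "bracket_law 8 1 0 E8_J1 E8_J4"
    and "bracket_law 8 0 0 E8_J1 E8_K1"
    and "bracket_law 8 1 1 E8_J1 E8_J3"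
    and "bracket_law 8 (- 1) 1 E8_J2 E8_J4"
    and "bracket_law 8 1 1 E8_J3 E8_J5"
    and "bracket_law 8 (- 1) 1 E8_J4 E8_J5"
    and "bracket_law 8 (- 1) 0 E8_J2 E8_J3"
    and "bracket_law 8 (- 1) 0 E8_J1 E8_J5"
    and "bracket_law 8 1 0 E8_J2 E8_J5"
    and "bracket_law 8 (- 1) 0 E8_J3 E8_J4"
    and "bracket_law 8 0 0 E8_J2 E8_K2"
    and "bracket_law 8 0 0 E8_J3 E8_K3"
    and "bracket_law 8 0 0 E8_J4 E8_K3"
    and "bracket_law 8 0 0 E8_J5 E8_K2"
    and "bracket_law 8 0 0 E8_J5 E8_K1"
    and "bracket_law 8 0 0 E8_J4 E8_K1"
    and "bracket_law 8 0 0 E8_J3 E8_K2"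
    and "bracket_law 8 0 0 E8_J2 E8_K3"
    and "bracket_law 8 0 0 E8_J1 E8_K3"
    and "bracket_law 8 0 0 E8_J1 E8_K2"
    and "bracket_law 8 0 0 E8_J2 E8_K1"
    and "bracket_law 8 0 0 E8_J3 E8_K1"
    and "bracket_law 8 0 0 E8_J4 E8_K2"
    and "bracket_law 8 0 0 E8_J5 E8_K3"
proof -
  have nz: "\<forall>\<^sub>F x in gen 8. x 1 * x 2 * x 3 * x 4 * x 5 * x 6 * x 7 * x 8 \<noteq> 0"
    by (rule eventually_gen_nonzero[where a = "\<lambda>_. 1"]) (auto intro!: polynomial_fun.intros)
  have reg: "\<exists>a. reg 8 a E8_J1" "\<exists>a. reg 8 a E8_J2" "\<exists>a. reg 8 a E8_J4" "\<exists>a. reg 8 a E8_K1"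
    using E8_reg[of "\<lambda>_. 1"] by auto
  note o = bracket_transport[OF poisson_map_E8_odd_step]
    and e = bracket_transport[OF poisson_map_E_even_step[of 4, simplified]]
    and po = E8_odd_pulls_back and pe = E8_even_pulls_back
  have J1J2: "bracket_law 8 (- 1) 1 E8_J1 E8_J2"
    unfolding bracket_law_def using reg nz by (auto elim!: eventually_mono simp: E8_bracket_J1_J2)
  have J1J4: "bracket_law 8 1 0 E8_J1 E8_J4"
    unfolding bracket_law_def using reg nz by (auto elim!: eventually_mono simp: E8_bracket_J1_J4)
  have J1K1: "bracket_law 8 0 0 E8_J1 E8_K1"
    unfolding bracket_law_def using reg nz by (auto elim!: eventually_mono simp: E8_bracket_J1_K1)
  note J1J3 = o[OF po(1) po(2) J1J2]
  note J2J4 = e[OF pe(1) pe(3) J1J3]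
  note J3J5 = o[OF po(2) po(4) J2J4]
  note J4J5 = e[OF pe(3) pe(5) J3J5]
  note J2J3 = e[OF pe(1) pe(4) J1J4]
  note J1J5 = o[OF po(1) po(4) J1J4]
  note J2J5 = e[OF pe(1) pe(5) J1J5]
  note J3J4 = o[OF po(2) po(5) J2J5]
  note J2K2 = e[OF pe(1) pe(6) J1K1]
  note J3K3 = o[OF po(2) po(7) J2K2]
  note J4K3 = e[OF pe(3) pe(8) J3K3]
  note J5K2 = o[OF po(4) po(8) J4K3]
  note J5K1 = e[OF pe(5) pe(7) J5K2]
  note J4K1 = o[OF po(5) po(6) J5K1]
  note J3K2 = e[OF pe(4) pe(6) J4K1]
  note J2K3 = o[OF po(3) po(7) J3K2]
  note J1K3 = e[OF pe(2) pe(8) J2K3]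
  note J1K2 = o[OF po(1) po(8) J1K3]
  note J2K1 = e[OF pe(1) pe(7) J1K2]
  note J3K1 = o[OF po(2) po(6) J2K1]
  note J4K2 = e[OF pe(3) pe(6) J3K1]
  note J5K3 = o[OF po(4) po(7) J4K2]
  show "bracket_law 8 (- 1) 1 E8_J1 E8_J2"
    "bracket_law 8 1 0 E8_J1 E8_J4"
    "bracket_law 8 0 0 E8_J1 E8_K1"
    "bracket_law 8 1 1 E8_J1 E8_J3"
    "bracket_law 8 (- 1) 1 E8_J2 E8_J4"
    "bracket_law 8 1 1 E8_J3 E8_J5"
    "bracket_law 8 (- 1) 1 E8_J4 E8_J5"
    "bracket_law 8 (- 1) 0 E8_J2 E8_J3"
    "bracket_law 8 (- 1) 0 E8_J1 E8_J5"
    "bracket_law 8 1 0 E8_J2 E8_J5"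
    "bracket_law 8 (- 1) 0 E8_J3 E8_J4"
    "bracket_law 8 0 0 E8_J2 E8_K2"
    "bracket_law 8 0 0 E8_J3 E8_K3"
    "bracket_law 8 0 0 E8_J4 E8_K3"
    "bracket_law 8 0 0 E8_J5 E8_K2"
    "bracket_law 8 0 0 E8_J5 E8_K1"
    "bracket_law 8 0 0 E8_J4 E8_K1"
    "bracket_law 8 0 0 E8_J3 E8_K2"
    "bracket_law 8 0 0 E8_J2 E8_K3"
    "bracket_law 8 0 0 E8_J1 E8_K3"
    "bracket_law 8 0 0 E8_J1 E8_K2"
    "bracket_law 8 0 0 E8_J2 E8_K1"
    "bracket_law 8 0 0 E8_J3 E8_K1"
    "bracket_law 8 0 0 E8_J4 E8_K2"
    "bracket_law 8 0 0 E8_J5 E8_K3"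
    using J1J2 J1J4 J1K1 J1J3 J2J4 J3J5 J4J5 J2J3 J1J5 J2J5 J3J4 J2K2 J3K3 J4K3 J5K2 J5K1 J4K1 J3K2 J2K3 J1K3 J1K2 J2K1 J3K1 J4K2 J5K3 by simp_all
qed

text \<open>The first three are the matching sums for k = 0, 1, 2 of the cycle with edges 12, 24,
  45, 53, 31: in the second, each term omits the two ends of one edge, and in the third, two
  disjoint edges leave a single vertex. The last is the matching sum for k = 1 of the triangle of
  the \<open>K i\<close>.\<close>

definition E8_integral :: "nat \<Rightarrow> (nat \<Rightarrow> complex) \<Rightarrow> complex" where
  "E8_integral i x = (if i = 1 then E8_J1 x * E8_J2 x * E8_J3 x * E8_J4 x * E8_J5 x
     else if i = 2 then E8_J3 x * E8_J4 x * E8_J5 x + E8_J1 x * E8_J2 x * E8_J3 x + E8_J2 x * E8_J4 x * E8_J5 x + E8_J1 x * E8_J3 x * E8_J5 x + E8_J1 x * E8_J2 x * E8_J4 x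
     else if i = 3 then E8_J1 x + E8_J2 x + E8_J3 x + E8_J4 x + E8_J5 x
     else E8_K1 x + E8_K2 x + E8_K3 x)"

lemma E8_integral_simps:
  "E8_integral 1 = (\<lambda>x. E8_J1 x * E8_J2 x * E8_J3 x * E8_J4 x * E8_J5 x)"
  "E8_integral 2 = (\<lambda>x. E8_J3 x * E8_J4 x * E8_J5 x + E8_J1 x * E8_J2 x * E8_J3 x + E8_J2 x * E8_J4 x * E8_J5 x + E8_J1 x * E8_J3 x * E8_J5 x + E8_J1 x * E8_J2 x * E8_J4 x)"
  "E8_integral 3 = (\<lambda>x. E8_J1 x + E8_J2 x + E8_J3 x + E8_J4 x + E8_J5 x)"
  "E8_integral 4 = (\<lambda>x. E8_K1 x + E8_K2 x + E8_K3 x)"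
  by (simp_all add: E8_integral_def fun_eq_iff)

lemma E8_base_values:
  "E8_J1 base_point = 11"
  "E8_J2 base_point = 13"
  "E8_J3 base_point = 27"
  "E8_J4 base_point = 26"
  "E8_J5 base_point = 21"
  "E8_K1 base_point = 79"
  "E8_K2 base_point = 128"
  "E8_K3 base_point = 205"
  by (simp_all add: E8_J1_def E8_J2_def E8_J3_def E8_J4_def E8_J5_def E8_K1_def E8_K2_def E8_K3_def base_point_def Let_def)

lemma E8_base_derivs:
  "partial_deriv 1 E8_J1 base_point = 0"
  "partial_deriv 2 E8_J1 base_point = 0"
  "partial_deriv 3 E8_J1 base_point = 0"
  "partial_deriv 4 E8_J1 base_point = 3"
  "partial_deriv 1 E8_J2 base_point = 0"
  "partial_deriv 2 E8_J2 base_point = 0"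
  "partial_deriv 3 E8_J2 base_point = 5"
  "partial_deriv 4 E8_J2 base_point = - 10"
  "partial_deriv 1 E8_J3 base_point = 0"
  "partial_deriv 2 E8_J3 base_point = 10"
  "partial_deriv 3 E8_J3 base_point = - 20"
  "partial_deriv 4 E8_J3 base_point = - 11"
  "partial_deriv 1 E8_J4 base_point = 10"
  "partial_deriv 2 E8_J4 base_point = - 20"
  "partial_deriv 3 E8_J4 base_point = - 18"
  "partial_deriv 4 E8_J4 base_point = - 14"
  "partial_deriv 1 E8_J5 base_point = - 16"
  "partial_deriv 2 E8_J5 base_point = - 7"
  "partial_deriv 3 E8_J5 base_point = 6"
  "partial_deriv 4 E8_J5 base_point = - 10"
  "partial_deriv 1 E8_K1 base_point = 0"
  "partial_deriv 2 E8_K1 base_point = 29"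
  "partial_deriv 3 E8_K1 base_point = - 28"
  "partial_deriv 4 E8_K1 base_point = - 94"
  "partial_deriv 1 E8_K2 base_point = 49"
  "partial_deriv 2 E8_K2 base_point = - 98"
  "partial_deriv 3 E8_K2 base_point = - 90"
  "partial_deriv 4 E8_K2 base_point = - 31"
  "partial_deriv 1 E8_K3 base_point = - 156"
  "partial_deriv 2 E8_K3 base_point = - 69"
  "partial_deriv 3 E8_K3 base_point = 60"
  "partial_deriv 4 E8_K3 base_point = - 102"
  by (rule trans[OF partial_deriv_eqI], simp add: E8_J1_def E8_J2_def E8_J3_def E8_J4_def E8_J5_def E8_K1_def E8_K2_def E8_K3_def Let_def,
    ((rule derivative_eq_intros refl | simp add: base_point_def)+)[1], simp add: base_point_def)+

lemma E8_base_reg: "reg 8 base_point E8_J1"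
    "reg 8 base_point E8_J2"
    "reg 8 base_point E8_J3"
    "reg 8 base_point E8_J4"
    "reg 8 base_point E8_J5"
    "reg 8 base_point E8_K1"
    "reg 8 base_point E8_K2"
    "reg 8 base_point E8_K3"
  by (rule E8_reg, simp add: base_point_def)+

lemma E8_integral_base_derivs:
  "partial_deriv 1 (E8_integral 1) base_point = - 795366"
  "partial_deriv 2 (E8_integral 1) base_point = - 1543542"
  "partial_deriv 3 (E8_integral 1) base_point = - 1607892"
  "partial_deriv 4 (E8_integral 1) base_point = - 4044534"
  "partial_deriv 1 (E8_integral 2) base_point = - 11562"
  "partial_deriv 2 (E8_integral 2) base_point = - 19819"
  "partial_deriv 3 (E8_integral 2) base_point = - 22427"
  "partial_deriv 4 (E8_integral 2) base_point = - 44774"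
  "partial_deriv 1 (E8_integral 3) base_point = - 6"
  "partial_deriv 2 (E8_integral 3) base_point = - 17"
  "partial_deriv 3 (E8_integral 3) base_point = - 27"
  "partial_deriv 4 (E8_integral 3) base_point = - 42"
  "partial_deriv 1 (E8_integral 4) base_point = - 107"
  "partial_deriv 2 (E8_integral 4) base_point = - 138"
  "partial_deriv 3 (E8_integral 4) base_point = - 58"
  "partial_deriv 4 (E8_integral 4) base_point = - 227"
  unfolding E8_integral_simps
  by (simp_all add: partial_deriv_add[of 8] partial_deriv_mult[of 8] reg_add reg_mult E8_base_reg
    E8_base_values E8_base_derivs[simplified One_nat_def] E8_base_derivs)

lemma E8_involution:
  "\<forall>\<^sub>F x in gen 8. poisson_bracket 8 E_bracket (E8_integral 1) (E8_integral 2) x = 0 \<and>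
     poisson_bracket 8 E_bracket (E8_integral 1) (E8_integral 3) x = 0 \<and>
     poisson_bracket 8 E_bracket (E8_integral 1) (E8_integral 4) x = 0 \<and>
     poisson_bracket 8 E_bracket (E8_integral 2) (E8_integral 3) x = 0 \<and>
     poisson_bracket 8 E_bracket (E8_integral 2) (E8_integral 4) x = 0 \<and>
     poisson_bracket 8 E_bracket (E8_integral 3) (E8_integral 4) x = 0"
proof -
  have "\<forall>\<^sub>F x in gen 8. x 1 * x 2 * x 3 * x 4 * x 5 * x 6 * x 7 * x 8 \<noteq> 0"
    by (rule eventually_gen_nonzero[where a = "\<lambda>_. 1"]) (auto intro!: polynomial_fun.intros)
  then show ?thesis
    using E8_brackets[THEN bracket_lawD]
  proof eventually_elim
    case (elim x)
    define vJ1 vJ2 vJ3 vJ4 vJ5 vK1 vK2 vK3 where v: "vJ1 = E8_J1 x" "vJ2 = E8_J2 x" "vJ3 = E8_J3 x" "vJ4 = E8_J4 x" "vJ5 = E8_J5 x" "vK1 = E8_K1 x" "vK2 = E8_K2 x" "vK3 = E8_K3 x"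
    have self: "poisson_bracket 8 E_bracket f f x = 0" for f
      using poisson_bracket_E_skew[of 8 f f x] by simp
    note swap = elim(2-)[THEN poisson_bracket_E_swap]
    note leibniz = poisson_bracket_leibniz[where n = 8] reg_add[where n = 8] reg_mult[where n = 8] E8_reg[OF elim(1)]
    have I12: "poisson_bracket 8 E_bracket (E8_integral 1) (E8_integral 2) x = 0"
      unfolding E8_integral_simps by (simp only: leibniz, unfold swap elim self v[symmetric], Groebner_Basis.algebra)
    have I13: "poisson_bracket 8 E_bracket (E8_integral 1) (E8_integral 3) x = 0"
      unfolding E8_integral_simps by (simp only: leibniz, unfold swap elim self v[symmetric], Groebner_Basis.algebra)
    have I14: "poisson_bracket 8 E_bracket (E8_integral 1) (E8_integral 4) x = 0"
      unfolding E8_integral_simps by (simp only: leibniz, unfold swap elim self v[symmetric], Groebner_Basis.algebra)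
    have I23: "poisson_bracket 8 E_bracket (E8_integral 2) (E8_integral 3) x = 0"
      unfolding E8_integral_simps by (simp only: leibniz, unfold swap elim self v[symmetric], Groebner_Basis.algebra)
    have I24: "poisson_bracket 8 E_bracket (E8_integral 2) (E8_integral 4) x = 0"
      unfolding E8_integral_simps by (simp only: leibniz, unfold swap elim self v[symmetric], Groebner_Basis.algebra)
    have I34: "poisson_bracket 8 E_bracket (E8_integral 3) (E8_integral 4) x = 0"
      unfolding E8_integral_simps by (simp only: leibniz, unfold swap elim self v[symmetric], Groebner_Basis.algebra)
    show ?case using I12 I13 I14 I23 I24 I34 by blast
  qed
qed

lemma E8_map_completely_integrable: "completely_integrable 4 E_form E8_map"
proof (rule completely_integrable_E[where \<iota> = E8_odd_step and I = E8_integral and a = base_point])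
  have idx: "i \<in> {1, 2, 3, 4}" if "i \<in> {1..4}" for i :: nat using that by auto
  let ?I = E8_integral
  show "E8_map x = E_even_step (2 * 4) (E8_odd_step x)" for x by (simp add: E8_map_eq)
  show "poisson_map (2 * 4) E_bracket (- 1) E8_odd_step" using poisson_map_E8_odd_step by simp
  show "reg (2 * 4) base_point (E8_integral i)" if "i \<in> {1..4}" for i
    using idx[OF that] E8_base_reg by (auto simp: E8_integral_simps simp del: One_nat_def intro!: reg_add reg_mult)
  show "\<forall>\<^sub>F x in gen (2 * 4). ?I i (E8_odd_step x) = E8_integral i x" for i
  proof -
    have "\<forall>\<^sub>F x in gen 8. ?I i (E8_odd_step x) = E8_integral i x"
      using E8_odd_pulls_back[THEN pulls_backD] by eventually_elim (simp add: E8_integral_def algebra_simps)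
    then show ?thesis by simp
  qed
  show "\<forall>\<^sub>F x in gen (2 * 4). E8_integral i (E_even_step (2 * 4) x) = ?I i x" for i
  proof -
    have "\<forall>\<^sub>F x in gen 8. E8_integral i (E_even_step 8 x) = ?I i x"
      using E8_even_pulls_back[THEN pulls_backD] by eventually_elim (simp add: E8_integral_def algebra_simps)
    then show ?thesis by simp
  qed
  show "\<forall>i\<in>{1..4}. c i = 0"
    if c: "\<And>l. l \<in> {1..4} \<Longrightarrow> (\<Sum>i=1..4. c i * partial_deriv l (E8_integral i) base_point) = 0" for c
  proof -
    have sum: "(\<Sum>i=1..4. f i) = f 1 + f 2 + f 3 + f 4" for f :: "nat \<Rightarrow> complex" by (simp add: eval_nat_numeral)
    define c1 c2 c3 c4 where k: "c1 = c 1" "c2 = c 2" "c3 = c 3" "c4 = c 4"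
    have eq: "c1 * (- 795366) + c2 * (- 11562) + c3 * (- 6) + c4 * (- 107) = 0"
      "c1 * (- 1543542) + c2 * (- 19819) + c3 * (- 17) + c4 * (- 138) = 0"
      "c1 * (- 1607892) + c2 * (- 22427) + c3 * (- 27) + c4 * (- 58) = 0"
      "c1 * (- 4044534) + c2 * (- 44774) + c3 * (- 42) + c4 * (- 227) = 0"
      using c[of 1] c[of 2] c[of 3] c[of 4] unfolding sum E8_integral_base_derivs k by simp_all
    have "c1 = 0"
    proof -
      \<comment> \<open>Cramer's rule for the 4 by 4 system. Each column is divided by its own
        common factor, so the coefficients on the left for \<open>c1\<close>, \<open>c2\<close>,
        \<open>c3\<close> and \<open>c4\<close> are different fractions of the same
        determinant.\<close>
      have "c1 * (1631558394648) - ((c1 * (- 795366) + c2 * (- 11562) + c3 * (- 6) + c4 * (- 107)) * (3024047) +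
         (c1 * (- 1543542) + c2 * (- 19819) + c3 * (- 17) + c4 * (- 138)) * (- 415452) +
         (c1 * (- 1607892) + c2 * (- 22427) + c3 * (- 27) + c4 * (- 58)) * (2346760) +
         (c1 * (- 4044534) + c2 * (- 44774) + c3 * (- 42) + c4 * (- 227)) * (- 1772479)) = 0"
        by Groebner_Basis.algebra
      then show ?thesis unfolding eq by simp
    qed
    moreover
    have "c2 = 0"
    proof -
      have "c2 * (41834830632) - ((c1 * (- 795366) + c2 * (- 11562) + c3 * (- 6) + c4 * (- 107)) * (- 29067125) +
         (c1 * (- 1543542) + c2 * (- 19819) + c3 * (- 17) + c4 * (- 138)) * (29537904) +
         (c1 * (- 1607892) + c2 * (- 22427) + c3 * (- 27) + c4 * (- 58)) * (- 9158764) +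
         (c1 * (- 4044534) + c2 * (- 44774) + c3 * (- 42) + c4 * (- 227)) * (- 1915595)) = 0"
        by Groebner_Basis.algebra
      then show ?thesis unfolding eq by simp
    qed
    moreover
    have "c3 = 0"
    proof -
      have "c3 * (41834830632) - ((c1 * (- 795366) + c2 * (- 11562) + c3 * (- 6) + c4 * (- 107)) * (16892134493) +
         (c1 * (- 1543542) + c2 * (- 19819) + c3 * (- 17) + c4 * (- 138)) * (- 19572010224) +
         (c1 * (- 1607892) + c2 * (- 22427) + c3 * (- 27) + c4 * (- 58)) * (1488945268) +
         (c1 * (- 4044534) + c2 * (- 44774) + c3 * (- 42) + c4 * (- 227)) * (3555595571)) = 0"
        by Groebner_Basis.algebra
      then show ?thesis unfolding eq by simp
    qed
    moreover
    have "c4 = 0"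
    proof -
      have "c4 * (6972471772) - ((c1 * (- 795366) + c2 * (- 11562) + c3 * (- 6) + c4 * (- 107)) * (204383251) +
         (c1 * (- 1543542) + c2 * (- 19819) + c3 * (- 17) + c4 * (- 138)) * (- 335844948) +
         (c1 * (- 1607892) + c2 * (- 22427) + c3 * (- 27) + c4 * (- 58)) * (76479960) +
         (c1 * (- 4044534) + c2 * (- 44774) + c3 * (- 42) + c4 * (- 227)) * (57573945)) = 0"
        by Groebner_Basis.algebra
      then show ?thesis unfolding eq by simp
    qed
    ultimately have "c i = 0" if "i \<in> {1..4}" for i
      using idx[OF that] unfolding k by (auto simp del: One_nat_def)
    then show ?thesis by blast
  qed
  show "\<forall>\<^sub>F x in gen (2 * 4). poisson_bracket (2 * 4) E_bracket (E8_integral i) (E8_integral j) x = 0"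
    if "i \<in> {1..4}" "j \<in> {1..4}" "i < j" for i j
  proof -
    have "(i, j) \<in> {(1, 2), (1, 3), (1, 4), (2, 3), (2, 4), (3, 4)}" using idx[OF that(1)] idx[OF that(2)] that(3) by auto
    moreover have "2 * 4 = (8 :: nat)" by simp
    ultimately show ?thesis using E8_involution by (auto simp only: insert_iff empty_iff prod.inject eventually_conj_iff)
  qed
qed

theorem theorem1p5:
  shows "(\<forall>N::nat. 5 \<le> N \<and> odd N \<longrightarrow> completely_integrable ((N - 1) div 2) D_form (D_map N)) \<and>
    completely_integrable 3 E_form E6_map \<and>
    completely_integrable 3 E_form E7_map \<and>
    completely_integrable 4 E_form E8_map"
proof (intro conjI allI impI)
  fix N :: nat assume N: "5 \<le> N \<and> odd N"
  then obtain m where "N = 2 * m + 1" by (auto elim: oddE)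
  then show "completely_integrable ((N - 1) div 2) D_form (D_map N)"
    using D_map_completely_integrable[of m] N by simp
qed (fact E6_map_completely_integrable E7_map_completely_integrable E8_map_completely_integrable)+

end
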